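(* Let $A_1>0$ and $A_2\colon\mathbb{R}_{>0}\to\mathbb{R}_{>0}$. Suppose that $f\in\mathscr{M}(A_1,A_2)$ satisfies \[\sum_{p\le t}f(p)\ge B\,\frac{t}{\log 2t}\] for all sufficiently large $t$ with a constant $B>0$. For $\lambda=\lambda(x)=c_0\sqrt{\log_4x}$ with any constant $c_0>2$, where $\log_4x=\log\log\log\log x$, we have \[\lim_{x\to\infty}\left(\sum_{n\le x}f(n)\right)^{-1}\sum_{\substack{n\le x\\ |\omega(s(n))-\log\log x|\ge\lambda\sqrt{\log\log x}}}f(n)=0.\]
   Context: $\mathbb{N}$ is the set of positive integers; $p$ denotes a prime; $\omega(m)$ is the number of distinct prime factors of $m$, and $\Omega(m)$ the number counted with multiplicity. $s(n)=\sigma(n)-n=\sum_{d\mid n,\,d<n}d$ is the sum of proper divisors of $n$. Since $s(1)=0$, $\omega(0)$ may be given any value (the term $n=1$ does not affect the limit). For a constant $A_1>0$ and a function $A_2\colon\mathbb{R}_{>0}\to\mathbb{R}_{>0}$, $\mathscr{M}(A_1,A_2)$ is the class of functions $f\colon\mathbb{N}\to\mathbb{R}_{\ge0}$ that are multiplicative ($f(1)=1$ and $f(mn)=f(m)f(n)$ whenever $\gcd(m,n)=1$) and satisfy (i) $f(n)\le A_1^{\Omega(n)}$ for all $n$; (ii) for every $\epsilon>0$, $f(n)\le A_2(\epsilon)n^{\epsilon}$ for all $n$. *)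

theory Defs
  imports Complex_Main "HOL-Computational_Algebra.Primes"
begin

text \<open>
  Arithmetic functions live on the positive integers. They are represented by functions on
  \<open>nat\<close> about whose value at \<open>0\<close> nothing is assumed.
\<close>

definition omega :: "nat \<Rightarrow> nat" where
  "omega m = card (prime_factors m)"

definition bigomega :: "nat \<Rightarrow> nat" where
  "bigomega m = size (prime_factorization m)"

definition aliquot :: "nat \<Rightarrow> nat" where
  "aliquot n = (\<Sum>d | d dvd n \<and> d < n. d)"

definition multiplicative :: "(nat \<Rightarrow> real) \<Rightarrow> bool" where
  "multiplicative f \<longleftrightarrow>
     f 1 = 1 \<and> (\<forall>m n. 0 < m \<longrightarrow> 0 < n \<longrightarrow> coprime m n \<longrightarrow> f (m * n) = f m * f n)"

definition class_M :: "real \<Rightarrow> (real \<Rightarrow> real) \<Rightarrow> (nat \<Rightarrow> real) set" where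
  "class_M A1 A2 = {f.
     (\<forall>n>0. 0 \<le> f n) \<and> multiplicative f \<and>
     (\<forall>n>0. f n \<le> A1 ^ bigomega n) \<and>
     (\<forall>\<epsilon>>0. \<forall>n>0. f n \<le> A2 \<epsilon> * real n powr \<epsilon>)}"

end

(* Write n = mp with p prime, p not dividing m.  Since log n is the sum of v_p(n) log p, weighting by
   log n reduces sums of f over n <= N to sums over m of f(m) times sums over primes p <= N/m; this
   gives the order of magnitude (N / log N) * sum_(m <= N) f(m)/m for the sum of f, and shows that the
   m > N^(1-delta) contribute a proportion O(delta).  For fixed m, s(mp) = s(m) p + sigma(m) is linear in p.
   A Turan-Kubilius variance bound, taken with respect to a Selberg majorant of the primes instead of
   the primes themselves, shows that omega(s(m) p + sigma(m)) is log log N + O(sqrt(log log N)) for most p.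
   The asymptotics of the majorant in residue classes are elementary, so no equidistribution theorem for
   primes is needed, and the constant lost by majorizing does not matter.  The only primes q which behave
   irregularly are those dividing both m and sigma(m), and there are O(log log log N) of them on average. *)
theory Submission
  imports Defs "HOL-Number_Theory.Number_Theory" "HOL-Computational_Algebra.Squarefree"
    "HOL-Real_Asymp.Real_Asymp" "HOL-Analysis.Analysis"
begin

section \<open>Chebyshev and Mertens bounds\<close>

text \<open>The logarithmic weight is what makes a prime p available: afterwards the cofactor m
  enters only through f(m)/m, and nothing about its distribution is needed. Since f(p) \<le> A1, it
  suffices to bound from above the number of bad p \<le> N/m, and upper bounds are what a sieve can
  give. A majorant that overcounts the primes by a constant factor would ruin an asymptotic formula;
  in a variance, however, every moment is compared with the mean value of the majorant itself, so
  the main terms cancel as long as each class modulo q receives its share up to a factor 1 + O(1/q).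
  The count must still save a full log N to compete with the whole sum. The sieve saves log(N/m),
  which is comparable only for m \<le> N^(1-\<delta>); this is why larger m have to be shown to be
  rare. The outcome is a fixed \<Lambda> for each \<epsilon>: deviations of at least \<Lambda>
  sqrt(log log N) carry a proportion at most \<epsilon>. The limit follows because \<lambda>(x)
  tends to infinity, however slowly.\<close>

definition primes_upto :: "nat \<Rightarrow> nat set" where
  "primes_upto n = {p. prime p \<and> p \<le> n}"

lemma finite_primes_upto [simp]: "finite (primes_upto n)"
  unfolding primes_upto_def by (rule finite_subset[of _ "{..n}"]) auto

lemma primes_upto_ge2: "p \<in> primes_upto n \<Longrightarrow> p \<ge> 2"
  by (auto simp: primes_upto_def dest: prime_ge_2_nat)

lemma primes_upto_Suc:
  "primes_upto (Suc n) = (if prime (Suc n) then insert (Suc n) (primes_upto n) else primes_upto n)"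
  by (auto simp: primes_upto_def le_Suc_eq)

lemma primes_upto_mono: "m \<le> n \<Longrightarrow> primes_upto m \<subseteq> primes_upto n"
  by (auto simp: primes_upto_def)

section \<open>Chebyshev's upper bound for the primes\<close>

lemma prod_primes_dvd:
  fixes x :: nat
  assumes "finite A" "\<And>p. p \<in> A \<Longrightarrow> prime p" "\<And>p. p \<in> A \<Longrightarrow> p dvd x"
  shows "\<Prod>A dvd x"
  using assms
proof (induction A rule: finite_induct)
  case (insert p A)
  have "coprime p (\<Prod>A)"
    using insert by (intro prod_coprime_right) (metis insertCI primes_coprime)
  thus ?case using insert by (simp add: divides_mult)
qed simp

lemma ln_prime_factorization:
  fixes x :: nat assumes "x > 0"
  shows "ln (real x) = (\<Sum>p\<in>prime_factors x. real (multiplicity p x) * ln (real p))"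
proof -
  have "real x = real (\<Prod>p\<in>prime_factors x. p ^ multiplicity p x)"
    using assms by (subst prod_prime_factors) auto
  also have "ln \<dots> = (\<Sum>p\<in>prime_factors x. ln (real p ^ multiplicity p x))"
    by (simp, subst ln_prod) (auto dest!: in_prime_factors_imp_prime simp: prime_gt_0_nat)
  also have "\<dots> = (\<Sum>p\<in>prime_factors x. real (multiplicity p x) * ln (real p))"
    by (intro sum.cong refl ln_realpow)
  finally show ?thesis .
qed

text \<open>Every prime in (k, n], where k = \<open>n - n div 2\<close> is n/2 rounded up, divides
  n! but neither k! nor (n - k)!. Hence it divides the binomial coefficient, which is at most
  2^n.\<close>

lemma theta_step:
  assumes "n \<ge> 2"
  shows "(\<Sum>p\<in>primes_upto n. ln (real p)) \<le> (\<Sum>p\<in>primes_upto (n - n div 2). ln (real p)) + real n * ln 2"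
proof -
  let ?k = "n - n div 2"
  let ?A = "primes_upto n - primes_upto ?k"
  have dvd: "p dvd (n choose ?k)" if p: "p \<in> ?A" for p
  proof -
    have pp: "prime p" "?k < p" "p \<le> n" using p by (auto simp: primes_upto_def)
    have "fact ?k * fact (n - ?k) * (n choose ?k) = (fact n :: nat)"
      by (rule binomial_fact_lemma) simp
    moreover have "p dvd fact n" using pp by (simp add: prime_dvd_fact_iff)
    moreover have "\<not> p dvd fact ?k" "\<not> p dvd fact (n - ?k)"
      using pp by (auto simp: prime_dvd_fact_iff)
    ultimately show ?thesis using pp(1) by (metis prime_dvd_multD)
  qed
  have "\<Prod>?A dvd (n choose ?k)"
    using dvd by (intro prod_primes_dvd) (auto simp: primes_upto_def)
  hence "\<Prod>?A \<le> (n choose ?k)" by (rule dvd_imp_le) (simp add: zero_less_binomial)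
  also have "\<dots> \<le> 2 ^ n" by (rule binomial_le_pow2)
  finally have "real (\<Prod>?A) \<le> real (2 ^ n)" by (rule of_nat_mono)
  moreover have pos: "\<Prod>?A > 0" by (intro prod_pos) (auto simp: primes_upto_def prime_gt_0_nat)
  ultimately have "ln (real (\<Prod>?A)) \<le> ln (real (2 ^ n))" by (subst ln_le_cancel_iff) (auto simp del: of_nat_prod)
  also have "ln (real (2 ^ n)) = real n * ln 2" by (simp add: ln_realpow)
  also have "ln (real (\<Prod>?A)) = (\<Sum>p\<in>?A. ln (real p))"
    by (simp, subst ln_prod) (auto simp: primes_upto_def prime_gt_0_nat)
  finally have "(\<Sum>p\<in>?A. ln (real p)) \<le> real n * ln 2" .
  moreover have "(\<Sum>p\<in>primes_upto n. ln (real p)) = (\<Sum>p\<in>?A. ln (real p)) + (\<Sum>p\<in>primes_upto ?k. ln (real p))"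
    by (rule sum.subset_diff) (auto intro: primes_upto_mono[THEN subsetD, of ?k])
  ultimately show ?thesis by linarith
qed

text \<open>Strong induction by halving: 4k \<le> 2(n + 1) and n ln 2 \<le> n add up to 3n + 2,
  which is at most 4n as soon as n \<ge> 2.\<close>

lemma theta_le: "(\<Sum>p\<in>primes_upto n. ln (real p)) \<le> 4 * real n"
proof (induction n rule: less_induct)
  case (less n)
  show ?case
  proof (cases "n \<ge> 2")
    case False
    have "primes_upto n = {}" using False by (auto simp: primes_upto_def dest: prime_ge_2_nat)
    thus ?thesis by simp
  next
    case True
    let ?k = "n - n div 2"
    have "(\<Sum>p\<in>primes_upto n. ln (real p)) \<le> (\<Sum>p\<in>primes_upto ?k. ln (real p)) + real n * ln 2"
      using theta_step[OF True] .
    moreover have "(\<Sum>p\<in>primes_upto ?k. ln (real p)) \<le> 4 * real ?k" using True by (intro less) auto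
    moreover have "4 * real ?k \<le> 2 * (real n + 1)"
      by (cases "even n") (auto elim!: evenE oddE)
    moreover have "real n * ln 2 \<le> real n * 1" using ln_2_less_1 by (intro mult_left_mono) auto
    moreover have "real n \<ge> 2" using True by simp
    ultimately show ?thesis by linarith
  qed
qed

section \<open>Legendre's formula and bounds for log n!\<close>

lemma multiplicity_fact:
  assumes "prime (p::nat)"
  shows "multiplicity p (fact n) = (\<Sum>m\<in>{1..n}. multiplicity p m)"
proof (induction n)
  case (Suc n)
  have "multiplicity p (Suc n * fact n) = multiplicity p (Suc n) + multiplicity p (fact n)"
    using assms by (intro prime_elem_multiplicity_mult_distrib) auto
  hence "multiplicity p (fact (Suc n)) = multiplicity p (Suc n) + multiplicity p (fact n)"
    unfolding fact_Suc by (simp del: mult_Suc)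
  thus ?case using Suc by (simp add: atLeastAtMostSuc_conv)
qed simp

lemma multiplicity_eq_card:
  assumes "prime (p::nat)" "m > 0" "m \<le> n"
  shows "multiplicity p m = card {k\<in>{1..n}. p ^ k dvd m}"
proof -
  have "p ^ k dvd m \<Longrightarrow> k \<le> n" for k
  proof -
    assume "p ^ k dvd m"
    hence "p ^ k \<le> m" using assms by (intro dvd_imp_le) auto
    moreover have "k < p ^ k" using assms(1) prime_ge_2_nat[OF assms(1)]
      by (metis less_exp power_mono le_less_trans less_le_trans zero_le)
    ultimately show "k \<le> n" using assms by linarith
  qed
  hence "{k\<in>{1..n}. p ^ k dvd m} = {1..multiplicity p m}"
    using assms prime_gt_1_nat[OF assms(1)] by (auto simp: power_dvd_iff_le_multiplicity)
  thus ?thesis by simp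
qed

lemma card_multiples: "d > 0 \<Longrightarrow> card {m\<in>{1..n::nat}. d dvd m} = n div d"
proof -
  assume d: "d > 0"
  have "{m\<in>{1..n}. d dvd m} = (\<lambda>k. d * k) ` {1..n div d}"
    using d by (auto simp: less_eq_div_iff_mult_less_eq ac_simps dvd_def image_iff Suc_le_eq)
  thus ?thesis using d by (simp add: card_image inj_on_def)
qed

lemma real_div_minus_one_le: "real n / real d - 1 \<le> real (n div d)"
proof (cases "d = 0")
  case False
  have "real n / real d = real (n div d) + real (n mod d) / real d"
    by (rule of_nat_of_nat_div_aux)
  moreover have "real (n mod d) / real d \<le> 1" using False by (simp add: less_imp_le)
  ultimately show ?thesis by linarith
qed simp

lemma multiplicity_fact_ge:
  assumes "prime (p::nat)"
  shows "multiplicity p (fact n) \<ge> n div p"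
proof -
  have "n div p = card {m\<in>{1..n}. p dvd m}"
    using card_multiples[of p n] assms by (simp add: prime_gt_0_nat)
  also have "\<dots> = (\<Sum>m\<in>{1..n}. if p dvd m then 1 else 0)"
    by (simp add: sum.If_cases Int_def conj_commute)
  also have "\<dots> \<le> (\<Sum>m\<in>{1..n}. multiplicity p m)"
    using assms by (intro sum_mono) (auto simp: Suc_le_eq prime_multiplicity_gt_zero_iff)
  finally show ?thesis using multiplicity_fact[OF assms] by simp
qed

lemma sum_inverse_power_le:
  fixes p :: real assumes "p > 1"
  shows "(\<Sum>k\<in>{1..n}. 1 / p ^ k) \<le> 1 / (p - 1)"
proof -
  have "(\<Sum>k\<in>{1..n}. 1 / p ^ k) = 1 / (p - 1) - 1 / ((p - 1) * p ^ n)"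
  proof (induction n)
    case (Suc n)
    have "(\<Sum>k\<in>{1..Suc n}. 1 / p ^ k) = 1 / (p - 1) - 1 / ((p - 1) * p ^ n) + 1 / p ^ Suc n"
      using Suc by simp
    also have "\<dots> = 1 / (p - 1) - 1 / ((p - 1) * p ^ Suc n)"
      using assms by (simp add: divide_simps) (simp add: algebra_simps)
    finally show ?case .
  qed simp
  thus ?thesis using assms by simp
qed

text \<open>Legendre's formula: the multiplicity is the sum of \<open>n div p ^ k\<close> over k,
  bounded here by a geometric series.\<close>

lemma multiplicity_fact_le:
  assumes "prime (p::nat)"
  shows "real (multiplicity p (fact n)) \<le> real n / (real p - 1)"
proof -
  have "multiplicity p (fact n) = (\<Sum>m\<in>{1..n}. multiplicity p m)" by (rule multiplicity_fact[OF assms])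
  also have "\<dots> = (\<Sum>m\<in>{1..n}. \<Sum>k\<in>{1..n}. if p ^ k dvd m then 1 else 0)"
    using assms by (intro sum.cong refl, subst multiplicity_eq_card[of _ _ n])
      (auto simp: sum.If_cases Int_def conj_commute)
  also have "\<dots> = (\<Sum>k\<in>{1..n}. \<Sum>m\<in>{1..n}. if p ^ k dvd m then 1 else 0)" by (rule sum.swap)
  also have "\<dots> = (\<Sum>k\<in>{1..n}. n div p ^ k)"
    using assms by (intro sum.cong refl, subst card_multiples[symmetric])
      (auto simp: sum.If_cases Int_def conj_commute prime_gt_0_nat)
  finally have "real (multiplicity p (fact n)) = (\<Sum>k\<in>{1..n}. real (n div p ^ k))" by simp
  also have "\<dots> \<le> (\<Sum>k\<in>{1..n}. real n * (1 / real p ^ k))"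
  proof (intro sum_mono)
    fix k show "real (n div p ^ k) \<le> real n * (1 / real p ^ k)"
      using of_nat_div_le_of_nat[where 'a = real, of n "p ^ k"] by simp
  qed
  also have "\<dots> = real n * (\<Sum>k\<in>{1..n}. 1 / real p ^ k)" by (simp add: sum_distrib_left)
  also have "\<dots> \<le> real n * (1 / (real p - 1))"
    using prime_gt_1_nat[OF assms] by (intro mult_left_mono sum_inverse_power_le) auto
  finally show ?thesis by simp
qed

lemma ln_fact_ge: "ln (fact n) \<ge> real n * ln (real n) - real n"
proof (induction n)
  case (Suc n)
  show ?case
  proof (cases "n = 0")
    case False
    have "ln (real n + 1) - ln (real n) = ln (1 + 1 / real n)"
      using False by (subst ln_divide_pos[symmetric]) (auto simp: field_simps)
    also have "\<dots> \<le> 1 / real n" by (rule ln_add_one_self_le_self) simp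
    finally have "real n * (ln (real n + 1) - ln (real n)) \<le> real n * (1 / real n)"
      by (intro mult_left_mono) auto
    hence "real n * ln (real n + 1) - real n * ln (real n) \<le> 1" using False by (simp add: algebra_simps)
    moreover have "ln (fact (Suc n)) = ln (real n + 1) + ln (fact n)"
      unfolding fact_Suc by (subst ln_mult) (auto simp: add_ac)
    ultimately show ?thesis using Suc by (simp add: algebra_simps)
  qed simp
qed simp

lemma ln_fact_le: "ln (fact n) \<le> real n * ln (real n)"
proof (cases "n = 0")
  case False
  have "(fact n :: real) \<le> real n ^ n" using fact_le_power[of n, where 'a = real] by simp
  hence "ln (fact n) \<le> ln (real n ^ n)" using False by (subst ln_le_cancel_iff) auto
  thus ?thesis using False by (simp add: ln_realpow)
qed simp

lemma ln_fact_eq: "ln (fact n) = (\<Sum>p\<in>primes_upto n. real (multiplicity p (fact n)) * ln (real p))"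
proof -
  have "ln (real (fact n)) = (\<Sum>p\<in>prime_factors (fact n). real (multiplicity p (fact n)) * ln (real p))"
    by (rule ln_prime_factorization) simp
  also have "prime_factors (fact n) = primes_upto n"
    by (auto simp: primes_upto_def in_prime_factors_iff prime_dvd_fact_iff)
  finally show ?thesis by simp
qed

section \<open>Mertens' theorems\<close>

lemma ln_le_2_sqrt: "x > 0 \<Longrightarrow> ln x \<le> 2 * sqrt (x::real)"
  using ln_le_minus_one[of "sqrt x"] by (simp add: ln_sqrt)

lemma sum_powr_three_halves:
  obtains C :: real where "C > 0" "\<And>A :: nat set. finite A \<Longrightarrow> 0 \<notin> A \<Longrightarrow> (\<Sum>n\<in>A. real n powr (-3/2)) \<le> C"
proof
  let ?g = "\<lambda>n. real n powr (-3/2)"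
  have s: "summable ?g" by (subst summable_real_powr_iff) auto
  show "suminf ?g + 1 > 0" using suminf_nonneg[OF s] by auto
  fix A :: "nat set" assume "finite A"
  thus "(\<Sum>n\<in>A. real n powr (-3/2)) \<le> suminf ?g + 1"
    using sum_le_suminf[OF s, of A] by auto
qed

text \<open>Two evaluations of log n! are compared: Legendre's formula, in which the multiplicity of
  p lies between n/p - 1 and n/(p - 1), and n log n + O(n). The -1 costs O(n) by
  \<open>theta_le\<close>; replacing p - 1 by p costs n times a convergent series.\<close>

lemma mertens_first:
  obtains C :: real where "C \<ge> 0" "\<And>n. n \<ge> 1 \<Longrightarrow> \<bar>(\<Sum>p\<in>primes_upto n. ln (real p) / real p) - ln (real n)\<bar> \<le> C"
proof -
  obtain C0 :: real where C0: "C0 > 0" "\<And>A :: nat set. finite A \<Longrightarrow> 0 \<notin> A \<Longrightarrow> (\<Sum>n\<in>A. real n powr (-3/2)) \<le> C0"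
    using sum_powr_three_halves by blast
  show ?thesis
  proof (rule that[of "5 + 4 * C0"])
    fix n :: nat assume n: "n \<ge> 1"
    let ?S = "\<Sum>p\<in>primes_upto n. ln (real p) / real p"
    have "real n * ?S - (\<Sum>p\<in>primes_upto n. ln (real p)) = (\<Sum>p\<in>primes_upto n. (real n / real p - 1) * ln (real p))"
      by (simp add: sum_distrib_left sum_subtractf algebra_simps)
    also have "\<dots> \<le> (\<Sum>p\<in>primes_upto n. real (multiplicity p (fact n)) * ln (real p))"
    proof (intro sum_mono mult_right_mono)
      fix p assume p: "p \<in> primes_upto n"
      have "real n / real p - 1 \<le> real (n div p)"
        by (rule real_div_minus_one_le)
      also have "\<dots> \<le> real (multiplicity p (fact n))"
        using p multiplicity_fact_ge by (auto simp: primes_upto_def)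
      finally show "real n / real p - 1 \<le> real (multiplicity p (fact n))" .
      show "0 \<le> ln (real p)" using primes_upto_ge2[OF p] by simp
    qed
    also have "\<dots> \<le> real n * ln (real n)" using ln_fact_le[of n] by (simp add: ln_fact_eq)
    finally have "real n * ?S \<le> real n * (ln (real n) + 4)" using theta_le[of n] by (simp add: algebra_simps)
    hence 1: "?S \<le> ln (real n) + 4" using n by simp
    have "real n * ln (real n) - real n \<le> (\<Sum>p\<in>primes_upto n. real (multiplicity p (fact n)) * ln (real p))"
      using ln_fact_ge[of n] by (simp add: ln_fact_eq)
    also have "\<dots> \<le> (\<Sum>p\<in>primes_upto n. real n * (ln (real p) / real p + 4 * real p powr (-3/2)))"
    proof (intro sum_mono)
      fix p assume p: "p \<in> primes_upto n"
      have p2: "real p \<ge> 2" using primes_upto_ge2[OF p] by simp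
      have "real (multiplicity p (fact n)) * ln (real p) \<le> real n / (real p - 1) * ln (real p)"
        using p p2 by (intro mult_right_mono multiplicity_fact_le) (auto simp: primes_upto_def)
      also have "\<dots> = real n * (ln (real p) / real p + ln (real p) / (real p * (real p - 1)))"
        using p2 by (simp add: divide_simps) (simp add: algebra_simps)
      also have "ln (real p) / (real p * (real p - 1)) \<le> (2 * sqrt (real p)) / (real p * (real p / 2))"
        using p2 by (intro frac_le mult_mono ln_le_2_sqrt) auto
      also have "\<dots> = 4 * (real p powr (1/2) / real p powr 2)"
        using p2 by (simp add: powr_half_sqrt power2_eq_square)
      also have "\<dots> = 4 * real p powr (-3/2)" using p2 by (subst powr_diff[symmetric]) auto
      finally show "real (multiplicity p (fact n)) * ln (real p) \<le> real n * (ln (real p) / real p + 4 * real p powr (-3/2))"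
        by (simp add: mult_left_mono)
    qed
    also have "\<dots> = real n * (?S + 4 * (\<Sum>p\<in>primes_upto n. real p powr (-3/2)))"
      by (simp add: sum_distrib_left sum.distrib algebra_simps)
    also have "\<dots> \<le> real n * (?S + 4 * C0)"
      using C0(2)[of "primes_upto n"] by (intro mult_left_mono) (auto simp: primes_upto_def)
    finally have "real n * (ln (real n) - 1) \<le> real n * (?S + 4 * C0)" by (simp add: algebra_simps)
    hence 2: "ln (real n) - 1 \<le> ?S + 4 * C0" using n by simp
    show "\<bar>?S - ln (real n)\<bar> \<le> 5 + 4 * C0" using 1 2 C0(1) by linarith
  qed (use C0 in auto)
qed

text \<open>Partial summation from the first theorem, in difference form: the increments of
  \<open>E\<close> are bounded by constant multiples of 1/ln n - 1/ln(n + 1), which telescope, and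
  S(n)/ln n is bounded.\<close>

lemma mertens_second:
  obtains C :: real where "C \<ge> 0" "\<And>n. n \<ge> 2 \<Longrightarrow> \<bar>(\<Sum>p\<in>primes_upto n. 1 / real p) - ln (ln (real n))\<bar> \<le> C"
proof -
  obtain C1 :: real where C1: "C1 \<ge> 0"
    "\<And>n. n \<ge> 1 \<Longrightarrow> \<bar>(\<Sum>p\<in>primes_upto n. ln (real p) / real p) - ln (real n)\<bar> \<le> C1"
    using mertens_first by blast
  define S where "S = (\<lambda>n. \<Sum>p\<in>primes_upto n. ln (real p) / real p)"
  define T where "T = (\<lambda>n. \<Sum>p\<in>primes_upto n. 1 / real p)"
  have S: "\<bar>S n - ln (real n)\<bar> \<le> C1" if "n \<ge> 1" for n using C1(2)[OF that] by (simp add: S_def)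
  define E where "E = (\<lambda>n. T n - S n / ln (real n) - ln (ln (real n)))"
  have up: "E (Suc n) - E n \<le> C1 * (1 / ln n - 1 / ln (Suc n))" (is ?A)
   and low: "E (Suc n) - E n \<ge> - (1 + C1) * (1 / ln n - 1 / ln (Suc n))" (is ?B)
    if n: "n \<ge> 2" for n
  proof -
    define u v where "u = ln (real n)" and "v = ln (real (Suc n))"
    have u: "u > 0" using n by (simp add: u_def)
    have uv: "u < v" unfolding u_def v_def using n by simp
    have "v - u = ln (1 + 1 / real n)"
      unfolding u_def v_def using n by (subst ln_divide_pos[symmetric]) (auto simp: field_simps)
    also have "\<dots> \<le> 1 / real n" by (rule ln_add_one_self_le_self) simp
    also have "\<dots> \<le> 1" using n by simp
    finally have vu1: "v - u \<le> 1" .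
    \<comment> \<open>A new prime p = n + 1 adds 1/p to both terms, since v = ln p. The increment of
      \<open>E\<close> thus only sees the change of the denominator from u to v.\<close>
    have d: "T (Suc n) - S (Suc n) / v = T n - S n / v"
    proof (cases "prime (Suc n)")
      case True
      have "Suc n \<notin> primes_upto n" by (simp add: primes_upto_def)
      thus ?thesis using True u uv
        by (simp add: T_def S_def primes_upto_Suc v_def[symmetric] add_divide_distrib del: of_nat_Suc)
    qed (simp add: T_def S_def primes_upto_Suc)
    have eq: "E (Suc n) - E n = S n * (1 / u - 1 / v) - (ln v - ln u)"
      using d by (simp add: E_def u_def[symmetric] v_def[symmetric] algebra_simps del: of_nat_Suc)
    have w: "1 / u - 1 / v \<ge> 0" using u uv by (simp add: field_simps)
    have l1: "ln v - ln u \<le> (v - u) / u"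
      using ln_le_minus_one[of "v / u"] u uv by (simp add: ln_divide_pos diff_divide_distrib)
    have l2: "ln v - ln u \<ge> (v - u) / v"
      using ln_le_minus_one[of "u / v"] u uv by (simp add: ln_divide_pos diff_divide_distrib)
    \<comment> \<open>The main part u(1/u - 1/v) = (v - u)/v cancels against ln v - ln u. In the
      lower bound this costs one more 1/u - 1/v, because v - u \<le> 1.\<close>
    have "S n * (1 / u - 1 / v) \<le> (u + C1) * (1 / u - 1 / v)"
      using S[of n] n w by (intro mult_right_mono) (auto simp: u_def)
    also have "\<dots> = (v - u) / v + C1 * (1 / u - 1 / v)" using u uv by (simp add: field_simps)
    finally show ?A using eq l2 by (simp add: u_def v_def)
    have "(u - C1) * (1 / u - 1 / v) \<le> S n * (1 / u - 1 / v)"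
      using S[of n] n w by (intro mult_right_mono) (auto simp: u_def)
    moreover have "(u - C1) * (1 / u - 1 / v) = (v - u) / v - C1 * (1 / u - 1 / v)"
      using u uv by (simp add: field_simps)
    moreover have "(v - u) / u - (v - u) / v \<le> 1 / u - 1 / v"
    proof -
      have "(v - u) / u - (v - u) / v = (v - u) * (1 / u - 1 / v)" by (simp add: algebra_simps diff_divide_distrib)
      also have "\<dots> \<le> 1 * (1 / u - 1 / v)" using vu1 w by (intro mult_right_mono)
      finally show ?thesis by simp
    qed
    moreover have "- (1 + C1) * (1 / u - 1 / v) = - (1 / u - 1 / v) - C1 * (1 / u - 1 / v)"
      by (simp only: distrib_right minus_mult_left[symmetric] mult_1_left minus_add_distrib diff_conv_add_uminus)
    ultimately have "E (Suc n) - E n \<ge> - (1 + C1) * (1 / u - 1 / v)" using eq l1 by linarith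
    thus ?B unfolding u_def v_def .
  qed
  have E: "E n \<le> E 2 + C1 * (1 / ln 2 - 1 / ln n) \<and> E n \<ge> E 2 - (1 + C1) * (1 / ln 2 - 1 / ln n)"
    if "n \<ge> 2" for n
    using that
  proof (induction n rule: dec_induct)
    case (step n)
    thus ?case using up[of n] low[of n] by (simp add: algebra_simps add_divide_distrib diff_divide_distrib)
  qed simp
  show ?thesis
  proof (rule that[of "\<bar>E 2\<bar> + (1 + C1) / ln 2 + (1 + C1 / ln 2)"])
    fix n :: nat assume n: "n \<ge> 2"
    have l: "0 < ln (2::real)" "ln 2 \<le> ln (real n)" "0 < ln (real n)" using n by auto
    have i: "0 \<le> 1 / ln 2 - 1 / ln (real n)" "1 / ln 2 - 1 / ln (real n) \<le> 1 / ln 2"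
      using frac_le[of 1 1 "ln 2" "ln (real n)"] l by auto
    have b1: "C1 * (1 / ln 2 - 1 / ln n) \<le> C1 * (1 / ln 2)" using C1 i by (intro mult_left_mono) auto
    have b2: "(1 + C1) * (1 / ln 2 - 1 / ln n) \<le> (1 + C1) * (1 / ln 2)" using C1 i by (intro mult_left_mono) auto
    have En: "\<bar>E n\<bar> \<le> \<bar>E 2\<bar> + (1 + C1) / ln 2"
    proof -
      have "C1 * (1 / ln 2) \<le> (1 + C1) * (1 / ln 2)" using l by (intro mult_right_mono) auto
      moreover have "(1 + C1) * (1 / ln 2) = (1 + C1) / ln 2" by simp
      ultimately show ?thesis using E[OF n] b1 b2 by linarith
    qed
    have "S n / ln n \<le> (ln n + C1) / ln n" using S[of n] n l by (intro divide_right_mono) auto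
    also have "\<dots> = 1 + C1 / ln n" using l by (simp add: add_divide_distrib)
    also have "\<dots> \<le> 1 + C1 / ln 2" using l C1 by (intro add_left_mono divide_left_mono) auto
    finally have 1: "S n / ln n \<le> 1 + C1 / ln 2" .
    have 2: "0 \<le> S n / ln n" using l unfolding S_def
      by (intro divide_nonneg_nonneg sum_nonneg) (auto dest: primes_upto_ge2)
    have "(\<Sum>p\<in>primes_upto n. 1 / real p) - ln (ln (real n)) = E n + S n / ln n"
      by (simp add: E_def T_def)
    thus "\<bar>(\<Sum>p\<in>primes_upto n. 1 / real p) - ln (ln (real n))\<bar> \<le> \<bar>E 2\<bar> + (1 + C1) / ln 2 + (1 + C1 / ln 2)"
      using En 1 2 by linarith
  qed (use C1 in auto)
qed

section \<open>Prime divisors of a single integer\<close>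

lemma card_primes_dvd_le:
  assumes "a > 0" "w \<ge> 1" "\<And>p. p \<in> A \<Longrightarrow> prime p \<and> p dvd a \<and> real p \<ge> w"
  shows "real (card A) * ln w \<le> ln (real a)"
proof -
  have fin: "finite A" using assms by (intro finite_subset[of A "{..a}"]) (auto dest: dvd_imp_le)
  have "w ^ card A = (\<Prod>p\<in>A. w)" by simp
  also have "\<dots> \<le> (\<Prod>p\<in>A. real p)" using assms by (intro prod_mono) auto
  also have "\<dots> = real (\<Prod>A)" by simp
  also have "\<dots> \<le> real a" using assms fin by (intro of_nat_mono dvd_imp_le prod_primes_dvd) auto
  finally have "ln (w ^ card A) \<le> ln (real a)" using assms by (subst ln_le_cancel_iff) auto
  thus ?thesis using assms by (simp add: ln_realpow)
qed

text \<open>Prime factors up to ln N contribute at most ln ln ln N + O(1) by Mertens; there are at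
  most 4 ln N others, each contributing at most 1/ln N. The range a \<le> N^2 covers both s(m) and
  sigma(m) for m \<le> N, and N \<ge> 16 ensures ln N \<ge> 2.\<close>

lemma sum_inverse_prime_factors_le:
  obtains C :: real where "C \<ge> 0"
    "\<And>N a. N \<ge> 16 \<Longrightarrow> a > 0 \<Longrightarrow> a \<le> N\<^sup>2 \<Longrightarrow> (\<Sum>q\<in>prime_factors a. 1 / real q) \<le> ln (ln (ln (real N))) + C"
proof -
  obtain C1 :: real where C1: "C1 \<ge> 0"
    "\<And>n. n \<ge> 2 \<Longrightarrow> \<bar>(\<Sum>p\<in>primes_upto n. 1 / real p) - ln (ln (real n))\<bar> \<le> C1"
    using mertens_second by blast
  have ln16: "ln (real N) \<ge> 2" if "N \<ge> 16" for N
  proof -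
    have "2 \<le> 4 * ln (2::real)" using ln2_ge_two_thirds by simp
    also have "\<dots> = ln (2 ^ 4 :: real)" by (subst ln_realpow) auto
    also have "\<dots> \<le> ln (real N)" using that by simp
    finally show ?thesis .
  qed
  show ?thesis
  proof (rule that[of "C1 + 4"])
    fix N a :: nat assume N: "N \<ge> 16" and a: "a > 0" "a \<le> N\<^sup>2"
    define y where "y = nat \<lfloor>ln (real N)\<rfloor>"
    have y2: "y \<ge> 2" using ln16[OF N] by (simp add: y_def le_nat_iff le_floor_iff)
    have yle: "real y \<le> ln (real N)" using ln16[OF N] by (simp add: y_def)
    have ygt: "q > y \<Longrightarrow> real q \<ge> ln (real N)" for q using ln16[OF N] unfolding y_def by linarith
    let ?A = "{q\<in>prime_factors a. q > y}"
    have "real (card ?A) * ln 2 \<le> ln (real a)"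
      using a by (intro card_primes_dvd_le) (auto simp: in_prime_factors_iff dest: prime_ge_2_nat)
    also have "ln (real a) \<le> ln (real (N\<^sup>2))" using a N by (subst ln_le_cancel_iff) (auto simp del: of_nat_power)
    also have "\<dots> = 2 * ln (real N)" using N by (simp add: ln_realpow)
    finally have "real (card ?A) * ln 2 \<le> 2 * ln (real N)" .
    moreover have "real (card ?A) * (1/2) \<le> real (card ?A) * ln 2"
      using ln2_ge_two_thirds by (intro mult_left_mono) auto
    ultimately have cA: "real (card ?A) \<le> 4 * ln (real N)" by linarith
    have "(\<Sum>q\<in>prime_factors a. 1 / real q) = (\<Sum>q\<in>{q\<in>prime_factors a. q \<le> y}. 1 / real q) + (\<Sum>q\<in>?A. 1 / real q)"
      by (subst sum.union_disjoint[symmetric]) (auto intro!: sum.cong)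
    also have "(\<Sum>q\<in>{q\<in>prime_factors a. q \<le> y}. 1 / real q) \<le> (\<Sum>q\<in>primes_upto y. 1 / real q)"
      by (intro sum_mono2) (auto simp: primes_upto_def)
    also have "\<dots> \<le> ln (ln (real y)) + C1" using C1(2)[OF y2] by linarith
    also have "ln (ln (real y)) \<le> ln (ln (ln (real N)))" using y2 yle by simp
    also have "(\<Sum>q\<in>?A. 1 / real q) \<le> (\<Sum>q\<in>?A. 1 / ln (real N))"
      using ygt ln16[OF N] by (intro sum_mono divide_left_mono mult_pos_pos) (auto simp: prime_gt_0_nat)
    also have "\<dots> = real (card ?A) / ln (real N)" by simp
    also have "\<dots> \<le> 4 * ln (real N) / ln (real N)" using cA ln16[OF N] by (intro divide_right_mono) auto
    also have "\<dots> = 4" using ln16[OF N] by simp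
    finally show "(\<Sum>q\<in>prime_factors a. 1 / real q) \<le> ln (ln (ln (real N))) + (C1 + 4)" by simp
  qed (use C1 in auto)
qed

section \<open>A Selberg majorant for the primes\<close>

definition squarefrees_upto :: "nat \<Rightarrow> nat set" where
  "squarefrees_upto D = {g. squarefree g \<and> g \<le> D}"

definition squarefree_harm :: "nat \<Rightarrow> real" where
  "squarefree_harm D = (\<Sum>g\<in>squarefrees_upto D. 1 / real g)"

text \<open>This agrees with the Moebius function on squarefree numbers, the only arguments that occur.\<close>

definition mu :: "nat \<Rightarrow> real" where
  "mu d = (-1) ^ card (prime_factors d)"

text \<open>The weights $\<lambda>_d$ are chosen such that $\sum_{l \mid d} \<lambda>_d / d = \<mu>(l) / (l H)$, where $H$ is the
  harmonic sum over squarefree numbers.  Taking $\<mu>(l) / \varphi(l)$ instead would be optimal, but would only improve constants.\<close>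

definition selberg_weight :: "nat \<Rightarrow> nat \<Rightarrow> real" where
  "selberg_weight D d = mu d * real d / squarefree_harm D * (\<Sum>g | g \<in> squarefrees_upto D \<and> d dvd g. 1 / real g)"

definition selberg_majorant :: "nat \<Rightarrow> nat \<Rightarrow> real" where
  "selberg_majorant D n = (\<Sum>d | d \<in> squarefrees_upto D \<and> d dvd n. selberg_weight D d)\<^sup>2"

text \<open>The mean value of the majorant over all integers: its quadratic form is the sum of
  phi(l) y_l^2 with y_l = mu(l)/(l H). In the variance it takes the place of the density of the
  primes.\<close>

definition selberg_density :: "nat \<Rightarrow> real" where
  "selberg_density D = (\<Sum>l\<in>squarefrees_upto D. real (totient l) * (1 / (real l * squarefree_harm D))\<^sup>2)"

section \<open>Elementary properties of the weights and of the majorant\<close>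

lemma finite_squarefrees_upto [simp]: "finite (squarefrees_upto D)"
  unfolding squarefrees_upto_def by (rule finite_subset[of _ "{..D}"]) auto

lemma squarefrees_upto_pos: "g \<in> squarefrees_upto D \<Longrightarrow> g > 0"
  by (auto simp: squarefrees_upto_def intro!: Nat.gr0I)

lemma squarefrees_upto_dvd: "g \<in> squarefrees_upto D \<Longrightarrow> d dvd g \<Longrightarrow> d \<in> squarefrees_upto D"
  using squarefrees_upto_pos[of g D]
  by (auto simp: squarefrees_upto_def intro: squarefree_mono dest: dvd_imp_le)

lemma one_in_squarefrees_upto: "D \<ge> 1 \<Longrightarrow> 1 \<in> squarefrees_upto D"
  by (auto simp: squarefrees_upto_def)

lemma card_squarefrees_upto_le: "card (squarefrees_upto D) \<le> D"
proof -
  have "squarefrees_upto D \<subseteq> {1..D}" using squarefrees_upto_pos by (auto simp: squarefrees_upto_def Suc_le_eq)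
  from card_mono[OF _ this] show ?thesis by simp
qed

lemma squarefree_harm_pos: "D \<ge> 1 \<Longrightarrow> squarefree_harm D > 0"
  unfolding squarefree_harm_def using one_in_squarefrees_upto[of D]
  by (intro sum_pos) (auto dest: squarefrees_upto_pos)

lemma mu_1 [simp]: "mu 1 = 1" "mu (Suc 0) = 1"
  by (auto simp: mu_def)

lemma abs_mu [simp]: "\<bar>mu d\<bar> = 1"
  by (simp add: mu_def power_abs)

lemma mu_square [simp]: "(mu d)\<^sup>2 = 1"
  by (metis abs_mu power2_abs one_power2)

lemma mu_mult_coprime: "coprime a b \<Longrightarrow> a > 0 \<Longrightarrow> b > 0 \<Longrightarrow> mu (a * b) = mu a * mu b"
proof -
  assume ab: "coprime a b" "a > 0" "b > 0"
  have "prime_factors a \<inter> prime_factors b = {}"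
    using ab by (auto simp: in_prime_factors_iff) (metis coprime_common_divisor not_prime_unit)
  thus ?thesis using ab by (simp add: mu_def prime_factors_product card_Un_disjoint power_add)
qed

text \<open>If a prime r divides n but not Q, then d and r d have opposite signs and cancel in
  pairs; otherwise 1 is the only divisor of n coprime to Q. For Q = 1 this is the usual Moebius
  identity.\<close>

lemma sum_mu_coprime_divisors:
  fixes n Q :: nat
  assumes "squarefree n" "Q > 0"
  shows "(\<Sum>d | d dvd n \<and> coprime d Q. mu d) = (if prime_factors n \<subseteq> prime_factors Q then 1 else 0)"
proof (cases "\<exists>r. prime r \<and> r dvd n \<and> \<not> r dvd Q")
  case True
  then obtain r where r: "prime r" "r dvd n" "\<not> r dvd Q" by blast
  have n0: "n > 0" using assms by (auto intro!: Nat.gr0I)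
  let ?A = "{d. d dvd n \<and> coprime d Q \<and> \<not> r dvd d}" and ?B = "{d. d dvd n \<and> coprime d Q \<and> r dvd d}"
  have fin: "finite {d. d dvd n}" using n0 by simp
  have B: "?B = (\<lambda>d. r * d) ` ?A"
  proof (intro equalityI subsetI)
    fix d assume d: "d \<in> ?B"
    then obtain e where "d = r * e" by (auto elim: dvdE)
    hence e: "d = r * e" "d dvd n" "coprime d Q" using d by blast+
    have "\<not> r dvd e"
    proof
      assume "r dvd e"
      then obtain f where "e = r * f" by (elim dvdE)
      hence "r\<^sup>2 dvd d" using e(1) by (simp add: power2_eq_square)
      hence "r\<^sup>2 dvd n" using e(2) by (rule dvd_trans)
      thus False using squarefreeD[OF assms(1), of r] r(1) by auto
    qed
    thus "d \<in> (\<lambda>d. r * d) ` ?A" using e dvd_mult_right[of r e n] by auto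
  next
    fix d assume "d \<in> (\<lambda>d. r * d) ` ?A"
    then obtain e where e: "d = r * e" "e dvd n" "coprime e Q" "\<not> r dvd e" by auto
    have "coprime r e" using r(1) e(4) by (simp add: prime_imp_coprime)
    moreover have "coprime r Q" using r by (simp add: prime_imp_coprime)
    ultimately show "d \<in> ?B" using e r(2) by (auto intro: divides_mult)
  qed
  have "(\<Sum>d\<in>?B. mu d) = (\<Sum>d\<in>?A. mu (r * d))"
    unfolding B using r(1) by (subst sum.reindex) (auto simp: inj_on_def prime_gt_0_nat)
  also have "\<dots> = (\<Sum>d\<in>?A. - mu d)"
  proof (intro sum.cong refl)
    fix d assume d: "d \<in> ?A"
    have "coprime r d" using r(1) d by (simp add: prime_imp_coprime)
    moreover have "d > 0" using d n0 by (auto intro!: Nat.gr0I)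
    ultimately have "mu (r * d) = mu r * mu d" using r(1) by (intro mu_mult_coprime) (auto simp: prime_gt_0_nat)
    thus "mu (r * d) = - mu d" using r(1) by (simp add: mu_def prime_prime_factors)
  qed
  finally have "(\<Sum>d\<in>?A. mu d) + (\<Sum>d\<in>?B. mu d) = 0" by (simp add: sum_negf)
  moreover have "(\<Sum>d\<in>?A. mu d) + (\<Sum>d\<in>?B. mu d) = (\<Sum>d | d dvd n \<and> coprime d Q. mu d)"
    by (subst sum.union_disjoint[symmetric]) (auto intro!: sum.cong finite_subset[OF _ fin])
  moreover have "\<not> (prime_factors n \<subseteq> prime_factors Q)" using r n0
    by (auto simp: in_prime_factors_iff)
  ultimately show ?thesis by simp
next
  case False
  have n0: "n > 0" using assms by (auto intro!: Nat.gr0I)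
  have "{d. d dvd n \<and> coprime d Q} = {1}"
  proof -
    have "d = 1" if d: "d dvd n" "coprime d Q" for d
    proof (rule ccontr)
      assume "d \<noteq> 1"
      then obtain r where r: "prime r" "r dvd d" using prime_factor_nat by blast
      have "r dvd Q" using False r d by (meson dvd_trans)
      thus False using r d(2) by (meson coprime_common_divisor not_prime_unit)
    qed
    thus ?thesis by auto
  qed
  moreover have "prime_factors n \<subseteq> prime_factors Q"
    using False n0 assms by (auto simp: in_prime_factors_iff)
  ultimately show ?thesis by simp
qed

text \<open>Writing g = d e turns d times the inner sum into a sum of 1/e over distinct squarefree e
  \<le> D, which is a part of H. Thanks to the bound 1, counting errors are at most the number of
  pairs of divisors.\<close>

lemma selberg_weight_le:
  assumes "d \<in> squarefrees_upto D"
  shows "\<bar>selberg_weight D d\<bar> \<le> 1"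
proof -
  have d0: "d > 0" using assms by (rule squarefrees_upto_pos)
  have D1: "D \<ge> 1" using assms d0 by (auto simp: squarefrees_upto_def)
  let ?G = "{g. g \<in> squarefrees_upto D \<and> d dvd g}"
  have "real d * (\<Sum>g\<in>?G. 1 / real g) = (\<Sum>g\<in>?G. 1 / real (g div d))"
    unfolding sum_distrib_left by (intro sum.cong refl) (simp add: real_of_nat_div)
  also have "\<dots> = (\<Sum>e\<in>(\<lambda>g. g div d) ` ?G. 1 / real e)"
  proof (subst sum.reindex)
    show "inj_on (\<lambda>g. g div d) ?G"
      by (rule inj_onI) (metis dvd_mult_div_cancel mem_Collect_eq)
  qed (simp add: o_def)
  also have "\<dots> \<le> squarefree_harm D"
    unfolding squarefree_harm_def
  proof (intro sum_mono2)
    show "(\<lambda>g. g div d) ` ?G \<subseteq> squarefrees_upto D"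
    proof (intro image_subsetI)
      fix g assume g: "g \<in> ?G"
      then obtain e where e: "g = d * e" by (auto elim: dvdE)
      hence "g div d = e" using d0 by simp
      moreover have "e dvd g" using e by simp
      ultimately show "g div d \<in> squarefrees_upto D" using g squarefrees_upto_dvd[of g D e] by simp
    qed
  qed auto
  finally have "real d * (\<Sum>g\<in>?G. 1 / real g) \<le> squarefree_harm D" .
  moreover have "\<bar>selberg_weight D d\<bar> = real d * (\<Sum>g\<in>?G. 1 / real g) / squarefree_harm D"
  proof -
    have "0 \<le> (\<Sum>g\<in>?G. 1 / real g)" by (intro sum_nonneg) simp
    thus ?thesis using squarefree_harm_pos[OF D1]
      unfolding selberg_weight_def abs_mult abs_divide by (simp only: abs_mu abs_of_nat abs_of_pos abs_of_nonneg) simp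
  qed
  ultimately show ?thesis using squarefree_harm_pos[OF D1] by (simp only: divide_le_eq_1_pos)
qed

lemma selberg_majorant_nonneg: "selberg_majorant D n \<ge> 0"
  by (simp add: selberg_majorant_def)

text \<open>The only squarefree divisor of p up to D is 1, whose weight is 1. Being a square, the
  majorant therefore dominates the indicator function of the primes beyond D.\<close>

lemma selberg_majorant_prime:
  assumes "prime p" "p > D" "D \<ge> 1"
  shows "selberg_majorant D p = 1"
proof -
  have *: "{d. d \<in> squarefrees_upto D \<and> d dvd p} = {1}"
  proof (intro equalityI subsetI)
    fix d assume d: "d \<in> {d. d \<in> squarefrees_upto D \<and> d dvd p}"
    hence "d dvd p" "d \<le> D" by (simp_all add: squarefrees_upto_def)
    hence "d = 1" using assms(1,2) by (metis leD prime_nat_iff)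
    thus "d \<in> {1}" by simp
  next
    fix d :: nat assume "d \<in> {1}"
    hence "d = 1" by simp
    thus "d \<in> {d. d \<in> squarefrees_upto D \<and> d dvd p}" using one_in_squarefrees_upto[OF assms(3)] by simp
  qed
  have "selberg_weight D 1 = 1"
  proof -
    have "{g. g \<in> squarefrees_upto D \<and> 1 dvd g} = squarefrees_upto D" by auto
    hence "selberg_weight D 1 = mu 1 * real 1 / squarefree_harm D * squarefree_harm D"
      unfolding selberg_weight_def squarefree_harm_def by (simp only:)
    thus ?thesis using squarefree_harm_pos[OF assms(3)] by simp
  qed
  thus ?thesis unfolding selberg_majorant_def * by simp
qed

lemma selberg_density_nonneg: "selberg_density D \<ge> 0"
  by (simp add: selberg_density_def sum_nonneg)

lemma selberg_density_le:
  assumes "D \<ge> 1" shows "selberg_density D \<le> 1 / squarefree_harm D"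
proof -
  let ?H = "squarefree_harm D"
  have "selberg_density D \<le> (\<Sum>l\<in>squarefrees_upto D. real l * (1 / (real l * ?H))\<^sup>2)"
    unfolding selberg_density_def by (intro sum_mono mult_right_mono) (auto simp: totient_le)
  also have "\<dots> = (\<Sum>l\<in>squarefrees_upto D. (1 / real l) * (1 / ?H\<^sup>2))"
    by (intro sum.cong refl) (auto simp: power2_eq_square dest: squarefrees_upto_pos)
  also have "\<dots> = ?H * (1 / ?H\<^sup>2)" by (simp only: squarefree_harm_def[of D] sum_distrib_right)
  also have "\<dots> = 1 / ?H" using squarefree_harm_pos[OF assms] by (simp add: power2_eq_square)
  finally show ?thesis .
qed

lemma sum_inverse_squares_le: "n \<ge> 1 \<Longrightarrow> (\<Sum>k\<in>{1..n}. 1 / (real k)\<^sup>2) \<le> 2 - 1 / real n"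
proof (induction n rule: dec_induct)
  case (step n)
  have "1 / (real (Suc n))\<^sup>2 \<le> 1 / (real n * real (Suc n))"
    using step by (intro divide_left_mono) (auto simp: power2_eq_square)
  also have "\<dots> = 1 / real n - 1 / real (Suc n)" using step by (simp add: field_simps)
  finally show ?case using step by simp
qed simp

text \<open>The decomposition n = g k^2 with g squarefree bounds the harmonic sum up to D by H times
  the sum of 1/k^2, which is at most 2. This is where the sieve gains its logarithm.\<close>

lemma squarefree_harm_ge:
  assumes "D \<ge> 1" shows "squarefree_harm D \<ge> ln (real D + 1) / 2"
proof -
  let ?f = "\<lambda>(g, k). 1 / real g * (1 / (real k)\<^sup>2)"
  let ?h = "\<lambda>n::nat. (squarefree_part n, square_part n)"
  have inj: "inj_on ?h {1..D}"
    by (rule inj_onI) (metis prod.inject squarefree_decompose)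
  have "ln (real D + 1) \<le> harm D" by (rule ln_le_harm)
  also have "harm D = (\<Sum>n\<in>{1..D}. ?f (?h n))"
    unfolding harm_def
  proof (intro sum.cong refl)
    fix n
    have "real n = real (squarefree_part n * (square_part n)\<^sup>2)"
      by (simp only: squarefree_decompose[symmetric])
    thus "inverse (real n) = ?f (?h n)" by (simp add: inverse_eq_divide)
  qed
  also have "\<dots> = (\<Sum>x\<in>?h ` {1..D}. ?f x)" using inj by (subst sum.reindex) auto
  also have "\<dots> \<le> (\<Sum>x\<in>squarefrees_upto D \<times> {1..D}. ?f x)"
  proof (intro sum_mono2)
    show "?h ` {1..D} \<subseteq> squarefrees_upto D \<times> {1..D}"
    proof (intro image_subsetI)
      fix n assume n: "n \<in> {1..D}"
      have "squarefree_part n dvd n" "square_part n dvd n"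
        using squarefree_decompose[of n] by (metis dvd_triv_left, metis dvd_triv_right dvd_mult_left power2_eq_square)
      hence "squarefree_part n \<le> n" "square_part n \<le> n" using n by (auto intro: dvd_imp_le)
      thus "?h n \<in> squarefrees_upto D \<times> {1..D}" using n
        by (auto simp: squarefrees_upto_def Suc_le_eq intro!: Nat.gr0I)
    qed
  qed auto
  also have "\<dots> = squarefree_harm D * (\<Sum>k\<in>{1..D}. 1 / (real k)\<^sup>2)"
    unfolding squarefree_harm_def by (simp add: sum_product sum.cartesian_product)
  also have "\<dots> \<le> squarefree_harm D * 2"
    using sum_inverse_squares_le[OF assms] squarefree_harm_pos[OF assms]
    by (intro mult_left_mono) (auto intro: order_trans)
  finally show ?thesis by simp
qed

section \<open>Linear congruences among multiples\<close>

text \<open>As a is invertible modulo Q, each block of Q consecutive k contains one solution: the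
  solutions inject into the blocks that meet {1..K}, and each of the \<open>K div Q\<close> complete
  blocks supplies one.\<close>

lemma card_solutions_linear_cong:
  fixes a b Q K :: nat
  assumes "coprime a Q" "Q > 0"
  shows "card {k\<in>{1..K}. Q dvd a * k + b} \<in> {K div Q, K div Q + 1}"
proof -
  let ?S = "{k\<in>{1..K}. Q dvd a * k + b}"
  obtain k0 where k0: "k0 \<in> {1..Q}" "Q dvd a * k0 + b"
  proof -
    obtain x where x: "[a * x = 1] (mod Q)" using cong_solve_coprime_nat[OF assms(1)] by auto
    \<comment> \<open>The number (Q - 1) b plays the role of -b, which does not exist among the
      naturals.\<close>
    define k where "k = x * ((Q - 1) * b)"
    have "[a * x * ((Q - 1) * b) + b = 1 * ((Q - 1) * b) + b] (mod Q)"
      using x by (intro cong_add cong_mult cong_refl)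
    moreover have "1 * ((Q - 1) * b) + b = Q * b" using assms(2) by (cases Q) auto
    ultimately have "[a * k + b = Q * b] (mod Q)" by (simp only: k_def mult.assoc)
    hence 1: "Q dvd a * k + b" by (simp add: cong_dvd_iff)
    \<comment> \<open>The residue is taken in {1..Q} rather than in {0..Q-1}, so that its translates
      by multiples of Q stay in {1..K}.\<close>
    have "[(if k mod Q = 0 then Q else k mod Q) = k] (mod Q)" by (simp add: Cong.unique_euclidean_semiring_class.cong_def)
    hence "[a * (if k mod Q = 0 then Q else k mod Q) + b = a * k + b] (mod Q)"
      by (intro cong_add cong_mult cong_refl)
    with 1 have "Q dvd a * (if k mod Q = 0 then Q else k mod Q) + b" by (simp add: cong_dvd_iff)
    moreover have "(if k mod Q = 0 then Q else k mod Q) \<in> {1..Q}"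
      using assms(2) by (auto simp: less_imp_le)
    ultimately show ?thesis using that by blast
  qed
  have uniq: "k = k'" if "k \<in> ?S" "k' \<in> ?S" "(k - 1) div Q = (k' - 1) div Q" for k k'
  proof -
    have "Q dvd a * k + b" "Q dvd a * k' + b" using that by auto
    hence "[a * k + b = a * k' + b] (mod Q)" by (simp add: Cong.unique_euclidean_semiring_class.cong_def dvd_eq_mod_eq_0)
    hence "[a * k = a * k'] (mod Q)" using cong_add_rcancel_nat by blast
    hence "[k = k'] (mod Q)" using cong_mult_lcancel_nat[of a Q k k'] assms(1) by simp
    moreover have pos: "k = (k - 1) + 1" "k' = (k' - 1) + 1" using that by auto
    ultimately have "[(k - 1) + 1 = (k' - 1) + 1] (mod Q)" by simp
    hence "[k - 1 = k' - 1] (mod Q)" using cong_add_rcancel_nat by blast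
    hence "(k - 1) mod Q = (k' - 1) mod Q" unfolding Cong.unique_euclidean_semiring_class.cong_def .
    hence "k - 1 = k' - 1" using that(3) by (metis div_mult_mod_eq)
    thus ?thesis using pos by arith
  qed
  have "card ?S = card ((\<lambda>k. (k - 1) div Q) ` ?S)"
    using uniq by (intro card_image[symmetric] inj_onI) auto
  also have "\<dots> \<le> card {..K div Q}"
    by (intro card_mono image_subsetI finite_atMost) (auto intro!: div_le_mono)
  finally have 1: "card ?S \<le> K div Q + 1" by simp
  have "card ((\<lambda>i. Q * i + k0) ` {..<K div Q}) \<le> card ?S"
  proof (intro card_mono image_subsetI)
    fix i assume "i \<in> {..<K div Q}"
    hence "Suc i \<le> K div Q" by simp
    hence "Suc i * Q \<le> K" using assms(2) less_eq_div_iff_mult_less_eq by blast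
    hence "Q * i + Q \<le> K" by (simp add: mult.commute)
    moreover have eq: "a * (Q * i + k0) + b = Q * (a * i) + (a * k0 + b)" by (simp add: algebra_simps)
    have "Q dvd a * (Q * i + k0) + b" unfolding eq by (rule dvd_add[OF dvd_triv_left k0(2)])
    ultimately show "Q * i + k0 \<in> ?S" using k0(1) by simp
  qed auto
  moreover have "card ((\<lambda>i. Q * i + k0) ` {..<K div Q}) = K div Q"
    using assms(2) by (subst card_image) (auto simp: inj_on_def)
  ultimately show ?thesis using 1 by auto
qed

text \<open>The substitution n = e k reduces this to the previous count, with e a in place of a and
  \<open>T div e\<close> in place of T.\<close>

lemma card_multiples_linear_cong:
  fixes a b Q T e :: nat
  assumes "coprime (e * a) Q" "Q > 0" "e > 0"
  shows "\<bar>real (card {n\<in>{1..T}. e dvd n \<and> Q dvd a * n + b}) - real T / (real e * real Q)\<bar> \<le> 1"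
proof -
  have "{n\<in>{1..T}. e dvd n \<and> Q dvd a * n + b} = (\<lambda>k. e * k) ` {k\<in>{1..T div e}. Q dvd (e * a) * k + b}"
    using assms(3) by (auto simp: less_eq_div_iff_mult_less_eq ac_simps dvd_def image_iff Suc_le_eq)
  hence "card {n\<in>{1..T}. e dvd n \<and> Q dvd a * n + b} = card {k\<in>{1..T div e}. Q dvd (e * a) * k + b}"
    using assms(3) by (simp add: card_image inj_on_def)
  also have "\<dots> \<in> {T div e div Q, T div e div Q + 1}" by (rule card_solutions_linear_cong[OF assms(1,2)])
  finally have "card {n\<in>{1..T}. e dvd n \<and> Q dvd a * n + b} \<in> {T div (e * Q), T div (e * Q) + 1}"
    by (simp add: div_mult2_eq)
  moreover have "real (T div (e * Q)) \<le> real T / (real e * real Q)"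
    using of_nat_div_le_of_nat[where 'a = real, of T "e * Q"] by simp
  moreover have "real T / (real e * real Q) \<le> real (T div (e * Q)) + 1"
    using of_nat_of_nat_div_aux[where 'a = real, of T "e * Q"] assms
    mod_less_divisor[of "e * Q" T] by (simp add: less_imp_le del: mod_less_divisor flip: of_nat_mult)
  ultimately show ?thesis by auto
qed

section \<open>The majorant in residue classes and its quadratic form\<close>

lemma squarefree_dvd_of_prime_factors_subset:
  fixes k Q :: nat
  assumes "squarefree k" "prime_factors k \<subseteq> prime_factors Q"
  shows "k dvd Q"
proof -
  have k0: "k \<noteq> 0" using assms(1) by (intro notI) simp
  have "k = (\<Prod>p\<in>prime_factors k. p ^ multiplicity p k)"
    using k0 by (subst prod_prime_factors) auto
  also have "\<dots> = \<Prod>(prime_factors k)"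
    using assms(1) k0 by (intro prod.cong refl) (simp add: squarefree_factorial_semiring')
  also have "\<dots> dvd Q"
    using assms(2) by (intro prod_primes_dvd) (auto simp: subset_iff in_prime_factors_iff)
  finally show ?thesis .
qed

text \<open>The main term of the sum of the majorant over a residue class modulo $Q$ that is coprime to $Q$:
  only the divisors coprime to $Q$ can contribute there.\<close>

definition selberg_form :: "nat \<Rightarrow> nat \<Rightarrow> real" where
  "selberg_form D Q = (\<Sum>d | d \<in> squarefrees_upto D \<and> coprime d Q. \<Sum>e | e \<in> squarefrees_upto D \<and> coprime e Q.
     selberg_weight D d * selberg_weight D e / real (lcm d e))"

text \<open>A divisor of n has no common factor with Q, since such a factor would divide b; so only
  d coprime to Q occur. Expanding the square and counting the multiples of lcm(d, e) leaves an error
  of at most 1 for each of at most D^2 pairs.\<close>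

lemma selberg_majorant_progression:
  assumes "D \<ge> 1" "Q > 0" "coprime a Q" "coprime b Q"
  shows "\<bar>(\<Sum>n | n \<in> {1..T} \<and> Q dvd a * n + b. selberg_majorant D n) - real T / real Q * selberg_form D Q\<bar> \<le> (real D)\<^sup>2"
proof -
  let ?w = "selberg_weight D"
  define S where "S = {d. d \<in> squarefrees_upto D \<and> coprime d Q}"
  define N where "N = {n. n \<in> {1..T} \<and> Q dvd a * n + b}"
  let ?c = "\<lambda>d e. real (card {n\<in>{1..T}. lcm d e dvd n \<and> Q dvd a * n + b})"
  let ?t = "\<lambda>d e. real T / (real (lcm d e) * real Q)"
  let ?i = "\<lambda>d n. if d dvd n then 1 else 0 :: real"
  have finS: "finite S" and finN: "finite N" by (auto simp: S_def N_def)
  have maj: "selberg_majorant D n = (\<Sum>d\<in>S. \<Sum>e\<in>S. ?w d * ?w e * ?i (lcm d e) n)" if n: "n \<in> N" for n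
  proof -
    have "coprime d Q" if "d dvd n" for d
    proof (rule coprimeI)
      fix c assume c: "c dvd d" "c dvd Q"
      have "c dvd n" using c(1) that by (rule dvd_trans)
      moreover have "c dvd a * n + b" using c(2) n by (auto simp: N_def intro: dvd_trans)
      ultimately have "c dvd b" by (metis dvd_add_right_iff dvd_mult)
      thus "is_unit c" using c(2) assms(4) by (meson coprime_common_divisor)
    qed
    hence "{d. d \<in> squarefrees_upto D \<and> d dvd n} = {d. d \<in> S \<and> d dvd n}" unfolding S_def by blast
    hence "selberg_majorant D n = (\<Sum>d | d \<in> S \<and> d dvd n. ?w d)\<^sup>2" unfolding selberg_majorant_def by simp
    also have "(\<Sum>d | d \<in> S \<and> d dvd n. ?w d) = (\<Sum>d\<in>S. ?w d * ?i d n)"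
      using finS by (intro sum.mono_neutral_cong_left) auto
    also have "\<dots>\<^sup>2 = (\<Sum>d\<in>S. \<Sum>e\<in>S. (?w d * ?i d n) * (?w e * ?i e n))"
      by (simp only: power2_eq_square sum_product)
    also have "\<dots> = (\<Sum>d\<in>S. \<Sum>e\<in>S. ?w d * ?w e * ?i (lcm d e) n)"
      by (intro sum.cong refl) simp
    finally show ?thesis .
  qed
  have "(\<Sum>n\<in>N. selberg_majorant D n) = (\<Sum>n\<in>N. \<Sum>d\<in>S. \<Sum>e\<in>S. ?w d * ?w e * ?i (lcm d e) n)"
    by (intro sum.cong refl maj)
  also have "\<dots> = (\<Sum>d\<in>S. \<Sum>n\<in>N. \<Sum>e\<in>S. ?w d * ?w e * ?i (lcm d e) n)"
    by (rule sum.swap)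
  also have "\<dots> = (\<Sum>d\<in>S. \<Sum>e\<in>S. \<Sum>n\<in>N. ?w d * ?w e * ?i (lcm d e) n)"
    by (intro sum.cong refl sum.swap)
  also have "\<dots> = (\<Sum>d\<in>S. \<Sum>e\<in>S. ?w d * ?w e * ?c d e)"
  proof (intro sum.cong refl)
    fix d e
    have "(\<Sum>n\<in>N. if lcm d e dvd n then 1 else 0 :: real) = real (card {n\<in>N. lcm d e dvd n})"
      using finN by (simp only: sum.inter_filter[symmetric]) simp
    also have "{n\<in>N. lcm d e dvd n} = {n\<in>{1..T}. lcm d e dvd n \<and> Q dvd a * n + b}"
      unfolding N_def by blast
    finally show "(\<Sum>n\<in>N. ?w d * ?w e * ?i (lcm d e) n) = ?w d * ?w e * ?c d e"
      by (simp only: sum_distrib_left[symmetric])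
  qed
  finally have eq: "(\<Sum>n\<in>N. selberg_majorant D n) = (\<Sum>d\<in>S. \<Sum>e\<in>S. ?w d * ?w e * ?c d e)" .
  have form: "real T / real Q * selberg_form D Q = (\<Sum>d\<in>S. \<Sum>e\<in>S. ?w d * ?w e * (?t d e))"
    unfolding selberg_form_def S_def[symmetric] sum_distrib_left by (intro sum.cong refl) (simp add: mult_ac)
  have "\<bar>(\<Sum>n\<in>N. selberg_majorant D n) - real T / real Q * selberg_form D Q\<bar> =
    \<bar>\<Sum>d\<in>S. \<Sum>e\<in>S. ?w d * ?w e * (?c d e - ?t d e)\<bar>"
    unfolding eq form by (simp only: sum_subtractf[symmetric] right_diff_distrib)
  also have "\<dots> \<le> (\<Sum>d\<in>S. \<bar>\<Sum>e\<in>S. ?w d * ?w e * (?c d e - ?t d e)\<bar>)"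
    by (rule sum_abs)
  also have "\<dots> \<le> (\<Sum>d\<in>S. \<Sum>e\<in>S. \<bar>?w d * ?w e * (?c d e - ?t d e)\<bar>)"
    by (intro sum_mono sum_abs)
  also have "\<dots> \<le> (\<Sum>d\<in>S. \<Sum>e\<in>S. 1)"
  proof (intro sum_mono)
    fix d e assume d: "d \<in> S" and e: "e \<in> S"
    have "coprime (lcm d e * a) Q"
    proof -
      have "coprime (d * e) Q" using d e by (simp add: S_def)
      moreover have "lcm d e dvd d * e" by (simp add: lcm_least)
      ultimately have "coprime (lcm d e) Q" by (meson coprime_divisors dvd_refl)
      thus ?thesis using assms(3) by simp
    qed
    moreover have "d > 0" "e > 0" using d e by (auto simp: S_def dest: squarefrees_upto_pos)
    hence "lcm d e > 0" by (simp add: lcm_pos_nat)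
    ultimately have "\<bar>?c d e - ?t d e\<bar> \<le> 1"
      using assms(2) by (intro card_multiples_linear_cong)
    moreover have "\<bar>?w d\<bar> \<le> 1" "\<bar>?w e\<bar> \<le> 1" using d e by (auto simp: S_def intro: selberg_weight_le)
    ultimately show "\<bar>?w d * ?w e * (?c d e - ?t d e)\<bar> \<le> 1"
      unfolding abs_mult by (intro mult_le_one mult_nonneg_nonneg) auto
  qed
  also have "\<dots> = (real (card S))\<^sup>2" by (simp add: power2_eq_square)
  also have "\<dots> \<le> (real D)\<^sup>2"
  proof -
    have "card S \<le> card (squarefrees_upto D)" by (intro card_mono) (auto simp: S_def)
    thus ?thesis using card_squarefrees_upto_le[of D] by (intro power_mono) auto
  qed
  finally show ?thesis unfolding N_def .
qed

text \<open>Selberg's diagonalization: 1/lcm(d, e) = gcd(d, e)/(d e), and gcd(d, e) is the sum of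
  phi(l) over the common divisors l. Coprimality to Q passes from d to l.\<close>

lemma selberg_form_diagonal:
  assumes "Q > 0"
  shows "selberg_form D Q = (\<Sum>l | l \<in> squarefrees_upto D \<and> coprime l Q. real (totient l) *
     (\<Sum>d | d \<in> squarefrees_upto D \<and> coprime d Q \<and> l dvd d. selberg_weight D d / real d)\<^sup>2)"
proof -
  define S where "S = {d. d \<in> squarefrees_upto D \<and> coprime d Q}"
  have finS: "finite S" by (simp add: S_def)
  let ?v = "\<lambda>d. selberg_weight D d / real d"
  let ?i = "\<lambda>l d. if l dvd d then 1 else 0 :: real"
  let ?s = "\<lambda>l d e. real (totient l) * ((?v d * ?i l d) * (?v e * ?i l e))"
  have gcd: "real (gcd d e) = (\<Sum>l\<in>S. real (totient l) * ?i l d * ?i l e)"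
    if d: "d \<in> S" and e: "e \<in> S" for d e
  proof -
    have sub: "l \<in> S" if "l dvd d" for l
      using d that squarefrees_upto_dvd[of d D l] coprime_divisors[of l d Q Q] by (auto simp: S_def)
    have "real (gcd d e) = (\<Sum>l | l dvd gcd d e. real (totient l))"
      by (subst totient_divisor_sum[symmetric]) simp
    also have "\<dots> = (\<Sum>l\<in>S. real (totient l) * ?i l d * ?i l e)"
      using finS sub by (intro sum.mono_neutral_cong_left) auto
    finally show ?thesis .
  qed
  have Y: "(\<Sum>d\<in>S. ?v d * ?i l d) = (\<Sum>d | d \<in> squarefrees_upto D \<and> coprime d Q \<and> l dvd d. ?v d)" for l
    using finS by (intro sum.mono_neutral_cong_right) (auto simp: S_def)
  have "selberg_form D Q = (\<Sum>d\<in>S. \<Sum>e\<in>S. \<Sum>l\<in>S. ?s l d e)"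
    unfolding selberg_form_def S_def[symmetric]
  proof (intro sum.cong refl)
    fix d e assume d: "d \<in> S" and e: "e \<in> S"
    have pos: "d > 0" "e > 0" using d e by (auto simp: S_def dest: squarefrees_upto_pos)
    have "real (gcd d e) * real (lcm d e) = real d * real e"
      by (simp only: of_nat_mult[symmetric] prod_gcd_lcm_nat[symmetric])
    moreover have "real (lcm d e) > 0" using pos by (simp add: lcm_pos_nat)
    ultimately have "1 / real (lcm d e) = real (gcd d e) / (real d * real e)"
      using pos by (simp add: field_simps)
    hence "selberg_weight D d * selberg_weight D e / real (lcm d e) = ?v d * ?v e * real (gcd d e)"
      by (simp add: divide_inverse)
    also have "\<dots> = (\<Sum>l\<in>S. ?s l d e)"
      unfolding gcd[OF d e] sum_distrib_left by (intro sum.cong refl) simp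
    finally show "selberg_weight D d * selberg_weight D e / real (lcm d e) =
      (\<Sum>l\<in>S. ?s l d e)" .
  qed
  also have "\<dots> = (\<Sum>d\<in>S. \<Sum>l\<in>S. \<Sum>e\<in>S. ?s l d e)"
    by (intro sum.cong refl sum.swap)
  also have "\<dots> = (\<Sum>l\<in>S. \<Sum>d\<in>S. \<Sum>e\<in>S. ?s l d e)"
    by (rule sum.swap)
  also have "\<dots> = (\<Sum>l\<in>S. real (totient l) * (\<Sum>d\<in>S. ?v d * ?i l d)\<^sup>2)"
    by (simp only: power2_eq_square sum_product sum_distrib_left[symmetric])
  also have "\<dots> = (\<Sum>l\<in>S. real (totient l) * (\<Sum>d | d \<in> squarefrees_upto D \<and> coprime d Q \<and> l dvd d. ?v d)\<^sup>2)"
    by (simp only: Y)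
  finally show ?thesis unfolding S_def .
qed

text \<open>Moebius inversion. After inserting the weights, the sum of mu(d) over l | d | g with d
  coprime to Q vanishes unless g/l is composed of primes dividing Q. For Q = 1 only g = l survives,
  and the variable is mu(l)/(l H).\<close>

lemma selberg_diagonal_variable:
  assumes "Q > 0" "l \<in> squarefrees_upto D" "coprime l Q"
  shows "(\<Sum>d | d \<in> squarefrees_upto D \<and> coprime d Q \<and> l dvd d. selberg_weight D d / real d) =
    mu l / squarefree_harm D * (\<Sum>g | g \<in> squarefrees_upto D \<and> l dvd g \<and> prime_factors (g div l) \<subseteq> prime_factors Q. 1 / real g)"
proof -
  define A where "A = {d. d \<in> squarefrees_upto D \<and> coprime d Q \<and> l dvd d}"
  let ?i = "\<lambda>d g. if d dvd g then 1 else 0 :: real"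
  let ?r = "\<lambda>g. 1 / squarefree_harm D * (1 / real g)"
  have l0: "l > 0" using assms(2) by (rule squarefrees_upto_pos)
  have finA: "finite A" by (simp add: A_def)
  have inner: "(\<Sum>d\<in>A. mu d * ?i d g) = (if l dvd g \<and> prime_factors (g div l) \<subseteq> prime_factors Q then mu l else 0)"
    if g: "g \<in> squarefrees_upto D" for g
  proof (cases "l dvd g")
    case False
    have "(\<Sum>d\<in>A. mu d * ?i d g) = 0"
      using False by (intro sum.neutral) (auto simp: A_def intro: dvd_trans)
    thus ?thesis using False by simp
  next
    case True
    then obtain h where h: "g = l * h" by (elim dvdE)
    have sqg: "squarefree g" using g by (simp add: squarefrees_upto_def)
    have sqh: "squarefree h" using squarefree_mono[of h g] sqg h by simp
    have h0: "h > 0" using g h squarefrees_upto_pos[of g D] by simp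
    have "(\<Sum>d\<in>A. mu d * ?i d g) = (\<Sum>d | d \<in> A \<and> d dvd g. mu d)"
      using finA by (intro sum.mono_neutral_cong_right) auto
    also have "{d. d \<in> A \<and> d dvd g} = (\<lambda>e. l * e) ` {e. e dvd h \<and> coprime e Q}"
    proof (intro equalityI subsetI)
      fix d assume d: "d \<in> {d. d \<in> A \<and> d dvd g}"
      hence "l dvd d" by (simp add: A_def)
      then obtain e where e: "d = l * e" by (elim dvdE)
      have "e dvd h" using d e h l0 by simp
      moreover have "coprime e Q" using d e by (simp add: A_def)
      ultimately show "d \<in> (\<lambda>e. l * e) ` {e. e dvd h \<and> coprime e Q}" using e by blast
    next
      fix d assume "d \<in> (\<lambda>e. l * e) ` {e. e dvd h \<and> coprime e Q}"
      then obtain e where e: "d = l * e" "e dvd h" "coprime e Q" by blast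
      have "d dvd g" using e h by simp
      thus "d \<in> {d. d \<in> A \<and> d dvd g}"
        using e assms(3) squarefrees_upto_dvd[OF g] by (simp add: A_def)
    qed
    also have "(\<Sum>d\<in>(\<lambda>e. l * e) ` {e. e dvd h \<and> coprime e Q}. mu d) = (\<Sum>e | e dvd h \<and> coprime e Q. mu (l * e))"
      using l0 by (subst sum.reindex) (auto simp: inj_on_def)
    also have "\<dots> = (\<Sum>e | e dvd h \<and> coprime e Q. mu l * mu e)"
    proof (intro sum.cong refl mu_mult_coprime l0)
      fix e assume e: "e \<in> {e. e dvd h \<and> coprime e Q}"
      have "l * e dvd g" using e h by simp
      hence sq: "squarefree (l * e)" using sqg squarefree_mono by blast
      show "coprime l e"
      proof (rule coprimeI)
        fix c assume "c dvd l" "c dvd e"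
        hence "c\<^sup>2 dvd l * e" by (simp add: power2_eq_square mult_dvd_mono)
        thus "is_unit c" using squarefreeD[OF sq] by blast
      qed
      show "e > 0" using e h0 by (auto intro!: Nat.gr0I)
    qed
    also have "\<dots> = mu l * (if prime_factors h \<subseteq> prime_factors Q then 1 else 0)"
      unfolding sum_distrib_left[symmetric] using sum_mu_coprime_divisors[OF sqh assms(1)] by simp
    finally show ?thesis using h l0 True by simp
  qed
  have "(\<Sum>d\<in>A. selberg_weight D d / real d) = (\<Sum>d\<in>A. \<Sum>g\<in>squarefrees_upto D. ?r g * (mu d * ?i d g))"
  proof (intro sum.cong refl)
    fix d assume "d \<in> A"
    hence d0: "d > 0" by (auto simp: A_def dest: squarefrees_upto_pos)
    have "(\<Sum>g | g \<in> squarefrees_upto D \<and> d dvd g. 1 / real g) = (\<Sum>g\<in>squarefrees_upto D. 1 / real g * ?i d g)"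
      by (intro sum.mono_neutral_cong_left) auto
    hence "selberg_weight D d / real d = mu d / squarefree_harm D * (\<Sum>g\<in>squarefrees_upto D. 1 / real g * ?i d g)"
      using d0 by (simp add: selberg_weight_def)
    also have "\<dots> = (\<Sum>g\<in>squarefrees_upto D. ?r g * (mu d * ?i d g))"
      unfolding sum_distrib_left by (intro sum.cong refl) simp
    finally show "selberg_weight D d / real d = (\<Sum>g\<in>squarefrees_upto D. ?r g * (mu d * ?i d g))" .
  qed
  also have "\<dots> = (\<Sum>g\<in>squarefrees_upto D. \<Sum>d\<in>A. ?r g * (mu d * ?i d g))"
    by (rule sum.swap)
  also have "\<dots> = (\<Sum>g\<in>squarefrees_upto D. ?r g * (if l dvd g \<and> prime_factors (g div l) \<subseteq> prime_factors Q then mu l else 0))"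
    unfolding sum_distrib_left[symmetric] by (intro sum.cong refl) (simp only: inner)
  also have "\<dots> = (\<Sum>g | g \<in> squarefrees_upto D \<and> l dvd g \<and> prime_factors (g div l) \<subseteq> prime_factors Q. mu l / squarefree_harm D * (1 / real g))"
    by (intro sum.mono_neutral_cong_right) auto
  finally show ?thesis unfolding A_def sum_distrib_left .
qed

text \<open>The term g = l alone gives the lower bound. For the upper bound, g/l is squarefree with
  all its primes dividing Q, hence it is a divisor of Q.\<close>

lemma selberg_diagonal_variable_bounds:
  assumes "Q > 0" "l \<in> squarefrees_upto D" "coprime l Q"
  defines "Y \<equiv> (\<Sum>d | d \<in> squarefrees_upto D \<and> coprime d Q \<and> l dvd d. selberg_weight D d / real d)"
  shows "Y\<^sup>2 \<le> (\<Sum>k | k dvd Q. 1 / real k)\<^sup>2 * (1 / (real l * squarefree_harm D))\<^sup>2"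
    and "Y\<^sup>2 \<ge> (1 / (real l * squarefree_harm D))\<^sup>2"
proof -
  define G where "G = {g. g \<in> squarefrees_upto D \<and> l dvd g \<and> prime_factors (g div l) \<subseteq> prime_factors Q}"
  have l0: "l > 0" using assms(2) by (rule squarefrees_upto_pos)
  have D1: "D \<ge> 1" using l0 assms(2) by (simp add: squarefrees_upto_def)
  have H: "squarefree_harm D > 0" by (rule squarefree_harm_pos[OF D1])
  have finG: "finite G" by (simp add: G_def)
  have Y: "Y\<^sup>2 = (1 / squarefree_harm D * (\<Sum>g\<in>G. 1 / real g))\<^sup>2"
    unfolding Y_def selberg_diagonal_variable[OF assms(1-3)] G_def[symmetric]
    by (simp add: power_mult_distrib power_divide)
  have "l \<in> G" using assms(2) l0 by (simp add: G_def)
  hence "1 / real l \<le> (\<Sum>g\<in>G. 1 / real g)" using finG by (intro member_le_sum) auto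
  hence "1 / squarefree_harm D * (1 / real l) \<le> 1 / squarefree_harm D * (\<Sum>g\<in>G. 1 / real g)"
    using H by (intro mult_left_mono) auto
  hence "(1 / squarefree_harm D * (1 / real l))\<^sup>2 \<le> Y\<^sup>2" unfolding Y using H by (intro power_mono) auto
  thus "Y\<^sup>2 \<ge> (1 / (real l * squarefree_harm D))\<^sup>2" by (simp add: mult.commute)
  have "(\<Sum>g\<in>G. 1 / real g) = (\<Sum>g\<in>G. 1 / real l * (1 / real (g div l)))"
    by (intro sum.cong refl) (auto simp: G_def real_of_nat_div)
  also have "\<dots> = 1 / real l * (\<Sum>k\<in>(\<lambda>g. g div l) ` G. 1 / real k)"
  proof (subst sum.reindex)
    show "inj_on (\<lambda>g. g div l) G"
      unfolding G_def by (rule inj_onI) (metis (no_types, lifting) dvd_mult_div_cancel mem_Collect_eq)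
  qed (simp add: o_def sum_distrib_left)
  also have "\<dots> \<le> 1 / real l * (\<Sum>k | k dvd Q. 1 / real k)"
  proof (intro mult_left_mono sum_mono2 image_subsetI)
    fix g assume g: "g \<in> G"
    then obtain h where h: "g = l * h" by (auto simp: G_def elim: dvdE)
    have "squarefree h" using g squarefree_mono[of h g] h by (simp add: G_def squarefrees_upto_def)
    moreover have "g div l = h" using h l0 by simp
    ultimately show "g div l \<in> {k. k dvd Q}"
      using g by (auto simp: G_def intro!: squarefree_dvd_of_prime_factors_subset)
  qed (use assms(1) in auto)
  finally have "1 / squarefree_harm D * (\<Sum>g\<in>G. 1 / real g) \<le> 1 / squarefree_harm D * (1 / real l * (\<Sum>k | k dvd Q. 1 / real k))"
    using H by (intro mult_left_mono) auto
  hence "Y\<^sup>2 \<le> (1 / squarefree_harm D * (1 / real l * (\<Sum>k | k dvd Q. 1 / real k)))\<^sup>2"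
    unfolding Y using H by (intro power_mono mult_nonneg_nonneg sum_nonneg) auto
  also have "\<dots> = (\<Sum>k | k dvd Q. 1 / real k)\<^sup>2 * (1 / (real l * squarefree_harm D))\<^sup>2"
    by (simp add: power_mult_distrib power_divide)
  finally show "Y\<^sup>2 \<le> (\<Sum>k | k dvd Q. 1 / real k)\<^sup>2 * (1 / (real l * squarefree_harm D))\<^sup>2" .
qed

text \<open>The factor is 1 + O(1/q) when Q = q is prime. Relative errors of this size are summable
  against 1/q, and this is the precision at which the variance can cancel.\<close>

lemma selberg_form_le:
  assumes "Q > 0"
  shows "selberg_form D Q \<le> (\<Sum>k | k dvd Q. 1 / real k)\<^sup>2 * selberg_density D"
proof -
  have "selberg_form D Q \<le> (\<Sum>l | l \<in> squarefrees_upto D \<and> coprime l Q. real (totient l) *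
     ((\<Sum>k | k dvd Q. 1 / real k)\<^sup>2 * (1 / (real l * squarefree_harm D))\<^sup>2))"
    unfolding selberg_form_diagonal[OF assms]
    using selberg_diagonal_variable_bounds(1)[OF assms] by (intro sum_mono mult_left_mono) auto
  also have "\<dots> \<le> (\<Sum>l\<in>squarefrees_upto D. real (totient l) *
     ((\<Sum>k | k dvd Q. 1 / real k)\<^sup>2 * (1 / (real l * squarefree_harm D))\<^sup>2))"
    by (intro sum_mono2) auto
  also have "\<dots> = (\<Sum>k | k dvd Q. 1 / real k)\<^sup>2 * selberg_density D"
    unfolding selberg_density_def sum_distrib_left by (intro sum.cong refl) simp
  finally show ?thesis .
qed

lemma selberg_form_ge:
  assumes "Q > 0"
  shows "selberg_form D Q \<ge> (\<Sum>l | l \<in> squarefrees_upto D \<and> coprime l Q. real (totient l) * (1 / (real l * squarefree_harm D))\<^sup>2)"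
  unfolding selberg_form_diagonal[OF assms]
  using selberg_diagonal_variable_bounds(2)[OF assms] by (intro sum_mono mult_left_mono) auto

lemma selberg_form_1: "selberg_form D 1 = selberg_density D"
proof (rule antisym)
  have "{k::nat. k dvd 1} = {1}" by auto
  thus "selberg_form D 1 \<le> selberg_density D" using selberg_form_le[of 1 D] by simp
  show "selberg_form D 1 \<ge> selberg_density D" using selberg_form_ge[of 1 D] by (simp add: selberg_density_def)
qed

text \<open>The multiples l = q h of q carry at most the fraction 1/q of the density: q does not
  divide h, so phi(q h)/(q h)^2 is (q - 1)/q^2 times phi(h)/h^2.\<close>

lemma selberg_form_prime_ge:
  assumes "prime q"
  shows "selberg_form D q \<ge> (1 - 1 / real q) * selberg_density D"
proof -
  let ?t = "\<lambda>l. real (totient l) * (1 / (real l * squarefree_harm D))\<^sup>2"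
  let ?A = "{l. l \<in> squarefrees_upto D \<and> coprime l q}" and ?B = "{l. l \<in> squarefrees_upto D \<and> q dvd l}"
  have q0: "q > 0" using assms by (simp add: prime_gt_0_nat)
  have AB: "squarefrees_upto D = ?A \<union> ?B" "?A \<inter> ?B = {}"
  proof -
    have "coprime l q \<longleftrightarrow> \<not> q dvd l" for l
      using assms by (metis coprime_commute coprime_common_divisor dvd_refl not_prime_unit prime_imp_coprime)
    thus "squarefrees_upto D = ?A \<union> ?B" "?A \<inter> ?B = {}" by blast+
  qed
  have sum: "selberg_density D = sum ?t ?A + sum ?t ?B"
    unfolding selberg_density_def by (subst AB(1), rule sum.union_disjoint) (use AB(2) in auto)
  have "sum ?t ?B \<le> 1 / real q * selberg_density D"
  proof -
    have "sum ?t ?B \<le> (\<Sum>l\<in>?B. 1 / real q * ?t (l div q))"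
    proof (intro sum_mono)
      fix l assume l: "l \<in> ?B"
      then obtain h where h: "l = q * h" by (auto elim: dvdE)
      have sq: "squarefree (q * h)" using l h by (simp add: squarefrees_upto_def)
      have "\<not> q dvd h"
      proof
        assume "q dvd h"
        hence "q\<^sup>2 dvd q * h" by (simp add: power2_eq_square)
        thus False using squarefreeD[OF sq, of q] assms not_prime_unit by blast
      qed
      hence "coprime q h" using assms by (simp add: prime_imp_coprime)
      hence tot: "totient (q * h) = (q - 1) * totient h" using assms by (simp add: totient_mult_coprime totient_prime)
      have "?t l = real (q - 1) / (real q)\<^sup>2 * ?t h"
        unfolding h tot by (simp add: power_mult_distrib power_divide)
      also have "\<dots> \<le> 1 / real q * ?t h"
        using q0 by (intro mult_right_mono) (auto simp: power2_eq_square divide_simps)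
      finally show "?t l \<le> 1 / real q * ?t (l div q)" using h q0 by simp
    qed
    also have "\<dots> = 1 / real q * (\<Sum>h\<in>(\<lambda>l. l div q) ` ?B. ?t h)"
    proof (subst sum.reindex)
      show "inj_on (\<lambda>l. l div q) ?B"
        by (rule inj_onI) (metis (no_types, lifting) dvd_mult_div_cancel mem_Collect_eq)
    qed (simp add: o_def sum_distrib_left)
    also have "\<dots> \<le> 1 / real q * selberg_density D"
      unfolding selberg_density_def
    proof (intro mult_left_mono sum_mono2 image_subsetI)
      fix l assume l: "l \<in> ?B"
      then obtain h where h: "l = q * h" by (auto elim: dvdE)
      moreover have "h dvd l" using h by simp
      ultimately show "l div q \<in> squarefrees_upto D" using l q0 squarefrees_upto_dvd[of l D h] by simp
    qed auto
    finally show ?thesis .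
  qed
  moreover have "selberg_form D q \<ge> sum ?t ?A" by (rule selberg_form_ge[OF q0])
  ultimately show ?thesis using sum by (simp add: algebra_simps)
qed

section \<open>A Turan-Kubilius inequality\<close>

lemma sum_divisors_prime:
  assumes "prime q" shows "(\<Sum>k | k dvd q. 1 / real k) = 1 + 1 / real q"
proof -
  have "{k. k dvd q} = {1, q}" using assms by (auto simp: prime_nat_iff)
  thus ?thesis using prime_gt_1_nat[OF assms] by simp
qed

text \<open>Every divisor of q q' is a product of a divisor of q and one of q'. Only the
  surjectivity of this map is used, so q = q' is covered as well.\<close>

lemma sum_divisors_two_primes_le:
  assumes "prime q" "prime q'"
  shows "(\<Sum>k | k dvd q * q'. 1 / real k) \<le> (1 + 1 / real q) * (1 + 1 / real q')"
proof -
  have sub: "{k. k dvd q * q'} \<subseteq> (\<lambda>(x, y). x * y) ` ({k. k dvd q} \<times> {k. k dvd q'})"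
  proof
    fix k assume "k \<in> {k. k dvd q * q'}"
    then obtain x y where "k = x * y" "x dvd q" "y dvd q'" using division_decomp[of k q q'] by auto
    thus "k \<in> (\<lambda>(x, y). x * y) ` ({k. k dvd q} \<times> {k. k dvd q'})" by force
  qed
  have fin: "finite ({k. k dvd q} \<times> {k. k dvd q'})" using assms by (simp add: prime_gt_0_nat)
  have "(\<Sum>k | k dvd q * q'. 1 / real k) \<le> (\<Sum>k\<in>(\<lambda>(x, y). x * y) ` ({k. k dvd q} \<times> {k. k dvd q'}). 1 / real k)"
    using fin by (intro sum_mono2[OF _ sub]) auto
  also have "\<dots> \<le> (\<Sum>p\<in>{k. k dvd q} \<times> {k. k dvd q'}. 1 / real (case p of (x, y) \<Rightarrow> x * y))"
    using sum_image_le[OF fin, of "\<lambda>k. 1 / real k" "\<lambda>(x, y). x * y"] by (simp add: o_def)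
  also have "\<dots> = (\<Sum>k | k dvd q. 1 / real k) * (\<Sum>k | k dvd q'. 1 / real k)"
    unfolding sum_product sum.cartesian_product by (intro sum.cong refl) auto
  finally show ?thesis using assms by (simp add: sum_divisors_prime)
qed

lemma sum_over_squares_of_primes_le:
  assumes "P \<subseteq> primes_upto z"
  shows "(\<Sum>q\<in>P. 1 / (real q)\<^sup>2) \<le> 1"
proof (cases "z \<ge> 1")
  case True
  have "P \<subseteq> {1..z} - {1}"
  proof
    fix q assume "q \<in> P"
    hence "prime q" "q \<le> z" using assms by (auto simp: primes_upto_def)
    thus "q \<in> {1..z} - {1}" using prime_gt_1_nat[of q] by simp
  qed
  hence "(\<Sum>q\<in>P. 1 / (real q)\<^sup>2) \<le> (\<Sum>q\<in>{1..z} - {1}. 1 / (real q)\<^sup>2)"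
    by (intro sum_mono2) auto
  also have "\<dots> = (\<Sum>q\<in>{1..z}. 1 / (real q)\<^sup>2) - 1"
    using True by (subst sum_diff1) auto
  also have "\<dots> \<le> 1" using sum_inverse_squares_le[OF True] by (smt (verit) divide_nonneg_nonneg of_nat_0_le_iff)
  finally show ?thesis .
next
  case False
  hence "primes_upto z = {}" by (auto simp: primes_upto_def dest: prime_gt_1_nat)
  hence "P = {}" using assms by simp
  thus ?thesis by simp
qed

text \<open>The square is expanded into second moment, first moment and total mass, each of which is
  known from the majorant in residue classes. As q divides neither a nor b, the congruence a n + b =
  0 modulo q describes a class coprime to q. One parameter z serves both as the level of the sieve
  and as the bound for the primes q.\<close>

lemma turan_kubilius_selberg:
  fixes a b z T :: nat
  assumes z: "z \<ge> 1" and P: "P \<subseteq> primes_upto z" and ndvd: "\<And>q. q \<in> P \<Longrightarrow> \<not> q dvd a \<and> \<not> q dvd b"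
  defines "m \<equiv> (\<Sum>q\<in>P. 1 / real q)"
  shows "(\<Sum>n\<in>{1..T}. selberg_majorant z n * (real (card {q\<in>P. q dvd a * n + b}) - m)\<^sup>2)
    \<le> real T * selberg_density z * (12 * m + 9) + 5 * real z ^ 4"
proof -
  define \<beta> where "\<beta> = selberg_majorant z"
  define M where "M = selberg_density z"
  define A where "A = (\<lambda>Q. \<Sum>n | n \<in> {1..T} \<and> Q dvd a * n + b. \<beta> n)"
  define X where "X = (\<lambda>q n. if q dvd a * n + b then 1 else 0 :: real)"
  \<comment> \<open>An upper bound for the share of the class modulo q, relative to T times the mean
    value; the product u(q) u(q') serves for the modulus q q'.\<close>
  define u where "u = (\<lambda>q. (1 + 1 / real q)\<^sup>2 / real q)"
  let ?w = "\<lambda>n. real (card {q\<in>P. q dvd a * n + b})"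
  let ?x = "\<lambda>n q q'. \<beta> n * (X q n * X q' n)"
  \<comment> \<open>The excess on the diagonal, where the condition is imposed modulo q only and not
    modulo q q'.\<close>
  let ?d = "\<lambda>q q'. if q = q' then real T * M * (4 * (1 / real q)) else 0"
  have finP: "finite P" using P by (rule finite_subset) simp
  have prime: "prime q" if "q \<in> P" for q using P that by (auto simp: primes_upto_def)
  have q0: "real q > 0" if "q \<in> P" for q using prime[OF that] by (simp add: prime_gt_0_nat)
  have M0: "M \<ge> 0" by (simp add: M_def selberg_density_nonneg)
  have m0: "m \<ge> 0" by (simp add: m_def sum_nonneg)
  have cardP: "real (card P) \<le> real z"
  proof -
    have "P \<subseteq> {1..z}" using P by (auto simp: primes_upto_def Suc_le_eq prime_gt_0_nat)
    from card_mono[OF _ this] show ?thesis by simp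
  qed
  have "m \<le> (\<Sum>q\<in>P. 1)" unfolding m_def by (intro sum_mono) (use q0 in \<open>auto simp: divide_le_eq_1 Suc_le_eq\<close>)
  hence mz: "m \<le> real z" using cardP by simp
  have cop: "coprime a q" "coprime b q" if "q \<in> P" for q
    using prime[OF that] ndvd[OF that] by (metis coprime_commute prime_imp_coprime)+
  have prog: "\<bar>A Q - real T / real Q * selberg_form z Q\<bar> \<le> (real z)\<^sup>2"
    if "Q > 0" "coprime a Q" "coprime b Q" for Q
    unfolding A_def \<beta>_def using selberg_majorant_progression[OF z that] .
  have A1: "A 1 \<le> real T * M + (real z)\<^sup>2"
    using prog[of 1] by (simp add: selberg_form_1 M_def del: One_nat_def)
  have Aq_le: "A q \<le> real T * M * u q + (real z)\<^sup>2" if q: "q \<in> P" for q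
  proof -
    have "selberg_form z q \<le> (1 + 1 / real q)\<^sup>2 * M"
      using selberg_form_le[of q z] prime[OF q] by (simp add: sum_divisors_prime M_def prime_gt_0_nat)
    hence "real T / real q * selberg_form z q \<le> real T / real q * ((1 + 1 / real q)\<^sup>2 * M)"
      by (intro mult_left_mono) auto
    also have "\<dots> = real T * M * u q" by (simp add: u_def)
    finally show ?thesis using prog[of q] cop[OF q] q0[OF q] by simp
  qed
  have Aq_ge: "A q \<ge> real T * M * (1 / real q - 1 / (real q)\<^sup>2) - (real z)\<^sup>2" if q: "q \<in> P" for q
  proof -
    have "real T / real q * selberg_form z q \<ge> real T / real q * ((1 - 1 / real q) * M)"
      using selberg_form_prime_ge[OF prime[OF q], of z] unfolding M_def by (intro mult_left_mono) auto
    also have "real T / real q * ((1 - 1 / real q) * M) = real T * M * (1 / real q - 1 / (real q)\<^sup>2)"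
      by (simp add: algebra_simps power2_eq_square)
    finally show ?thesis using prog[of q] cop[OF q] q0[OF q] by simp
  qed
  have Aqq_le: "A (q * q') \<le> real T * M * (u q * u q') + (real z)\<^sup>2" if q: "q \<in> P" "q' \<in> P" for q q'
  proof -
    have "(\<Sum>k | k dvd q * q'. 1 / real k)\<^sup>2 \<le> ((1 + 1 / real q) * (1 + 1 / real q'))\<^sup>2"
      using sum_divisors_two_primes_le[OF prime[OF q(1)] prime[OF q(2)]] by (intro power_mono sum_nonneg) auto
    hence "(\<Sum>k | k dvd q * q'. 1 / real k)\<^sup>2 * M \<le> ((1 + 1 / real q) * (1 + 1 / real q'))\<^sup>2 * M"
      using M0 by (rule mult_right_mono)
    hence "selberg_form z (q * q') \<le> ((1 + 1 / real q) * (1 + 1 / real q'))\<^sup>2 * M"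
      using selberg_form_le[of "q * q'" z] q0[OF q(1)] q0[OF q(2)] by (simp add: M_def)
    hence "real T / real (q * q') * selberg_form z (q * q') \<le> real T / real (q * q') * (((1 + 1 / real q) * (1 + 1 / real q'))\<^sup>2 * M)"
      by (intro mult_left_mono) auto
    also have "\<dots> = real T * M * (u q * u q')" by (simp add: u_def power_mult_distrib)
    finally show ?thesis using prog[of "q * q'"] cop q q0[OF q(1)] q0[OF q(2)] by simp
  qed
  have usmall: "u q \<le> 1 / real q + 3 * (1 / (real q)\<^sup>2)" "u q \<le> 4 * (1 / real q)" "u q \<ge> 0" if q: "q \<in> P" for q
  proof -
    define x where "x = 1 / real q"
    have x: "0 \<le> x" "x \<le> 1" using q0[OF q] by (auto simp: x_def divide_le_eq_1 Suc_le_eq)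
    have ux: "u q = (1 + x)\<^sup>2 * x" by (simp add: u_def x_def)
    have x3: "x ^ 3 \<le> x\<^sup>2" "x\<^sup>2 \<le> x" using x power_decreasing[of 2 3 x] power_decreasing[of 1 2 x] by auto
    have e: "(1 + x)\<^sup>2 * x = x + 2 * x\<^sup>2 + x ^ 3" by (simp add: power2_eq_square power3_eq_cube algebra_simps)
    show "u q \<le> 1 / real q + 3 * (1 / (real q)\<^sup>2)"
      using x3 e ux by (simp add: x_def[symmetric] power_divide[symmetric]) (simp add: x_def power_divide)
    show "u q \<le> 4 * (1 / real q)" using x3 e ux unfolding x_def[symmetric] by linarith
    show "u q \<ge> 0" using ux x by simp
  qed
  define U where "U = (\<Sum>q\<in>P. u q)"
  \<comment> \<open>For 0 \<le> x \<le> 1 one has (1 + x)^2 x \<le> x + 3 x^2, and the sum of 1/q^2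
    over primes is at most 1.\<close>
  have U: "U \<le> m + 3"
  proof -
    have "U \<le> (\<Sum>q\<in>P. 1 / real q + 3 * (1 / (real q)\<^sup>2))" unfolding U_def by (intro sum_mono usmall)
    also have "\<dots> = m + 3 * (\<Sum>q\<in>P. 1 / (real q)\<^sup>2)" by (simp only: sum.distrib m_def sum_distrib_left)
    finally show ?thesis using sum_over_squares_of_primes_le[OF P] by linarith
  qed
  have U0: "U \<ge> 0" unfolding U_def by (intro sum_nonneg usmall)
  have B: "(\<Sum>n\<in>{1..T}. ?x n q q') \<le> real T * M * (u q * u q') + (real z)\<^sup>2 + ?d q q'"
    if q: "q \<in> P" "q' \<in> P" for q q'
  proof (cases "q = q'")
    case True
    have "(\<Sum>n\<in>{1..T}. ?x n q q') = A q"
      unfolding A_def X_def True by (intro sum.mono_neutral_cong_right) auto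
    also have "\<dots> \<le> real T * M * u q + (real z)\<^sup>2" by (rule Aq_le[OF q(1)])
    also have "real T * M * u q \<le> real T * M * (4 * (1 / real q))"
      using M0 usmall(2)[OF q(1)] by (intro mult_left_mono) auto
    finally have "(\<Sum>n\<in>{1..T}. ?x n q q') \<le> real T * M * (4 * (1 / real q)) + (real z)\<^sup>2" by simp
    moreover have "0 \<le> real T * M * (u q * u q')" using M0 usmall(3)[OF q(1)] usmall(3)[OF q(2)] by simp
    ultimately show ?thesis using True by simp
  next
    case False
    have "q * q' dvd n \<longleftrightarrow> q dvd n \<and> q' dvd n" for n
    proof -
      have "coprime q q'" using False prime[OF q(1)] prime[OF q(2)] by (rule primes_coprime[rotated 2])
      thus ?thesis by (metis divides_mult dvd_mult_left dvd_mult_right)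
    qed
    hence "(\<Sum>n\<in>{1..T}. ?x n q q') = A (q * q')"
      unfolding A_def X_def by (intro sum.mono_neutral_cong_right) auto
    also have "\<dots> \<le> real T * M * (u q * u q') + (real z)\<^sup>2" by (rule Aqq_le[OF q])
    finally show ?thesis using False by simp
  qed
  have w: "?w n = (\<Sum>q\<in>P. X q n)" for n
    unfolding X_def using finP by (simp add: sum.inter_filter[symmetric])
  have "(\<Sum>n\<in>{1..T}. \<beta> n * (?w n - m)\<^sup>2)
    = (\<Sum>n\<in>{1..T}. (\<Sum>q\<in>P. \<Sum>q'\<in>P. ?x n q q') - 2 * m * (\<Sum>q\<in>P. \<beta> n * X q n) + m\<^sup>2 * \<beta> n)"
  proof (intro sum.cong refl)
    fix n
    have "(\<Sum>q\<in>P. \<Sum>q'\<in>P. ?x n q q') = \<beta> n * ((\<Sum>q\<in>P. X q n) * (\<Sum>q\<in>P. X q n))"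
      unfolding sum_product by (simp only: sum_distrib_left)
    moreover have "(\<Sum>q\<in>P. \<beta> n * X q n) = \<beta> n * (\<Sum>q\<in>P. X q n)" by (simp only: sum_distrib_left)
    ultimately show "\<beta> n * (?w n - m)\<^sup>2 =
      (\<Sum>q\<in>P. \<Sum>q'\<in>P. ?x n q q') - 2 * m * (\<Sum>q\<in>P. \<beta> n * X q n) + m\<^sup>2 * \<beta> n"
      unfolding w by (simp add: power2_eq_square algebra_simps)
  qed
  also have "\<dots> = (\<Sum>n\<in>{1..T}. \<Sum>q\<in>P. \<Sum>q'\<in>P. ?x n q q') - 2 * m * (\<Sum>n\<in>{1..T}. \<Sum>q\<in>P. \<beta> n * X q n) + m\<^sup>2 * (\<Sum>n\<in>{1..T}. \<beta> n)"
    by (simp only: sum.distrib sum_subtractf sum_distrib_left)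
  also have "(\<Sum>n\<in>{1..T}. \<Sum>q\<in>P. \<Sum>q'\<in>P. ?x n q q') = (\<Sum>q\<in>P. \<Sum>n\<in>{1..T}. \<Sum>q'\<in>P. ?x n q q')"
    by (rule sum.swap)
  also have "\<dots> = (\<Sum>q\<in>P. \<Sum>q'\<in>P. \<Sum>n\<in>{1..T}. ?x n q q')"
    by (intro sum.cong refl sum.swap)
  also have "(\<Sum>n\<in>{1..T}. \<Sum>q\<in>P. \<beta> n * X q n) = (\<Sum>q\<in>P. \<Sum>n\<in>{1..T}. \<beta> n * X q n)"
    by (rule sum.swap)
  also have "\<dots> = (\<Sum>q\<in>P. A q)"
    unfolding A_def X_def by (intro sum.cong refl sum.mono_neutral_cong_right) auto
  also have "(\<Sum>n\<in>{1..T}. \<beta> n) = A 1"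
    unfolding A_def by (intro sum.cong) auto
  finally have eq: "(\<Sum>n\<in>{1..T}. \<beta> n * (?w n - m)\<^sup>2) =
    (\<Sum>q\<in>P. \<Sum>q'\<in>P. \<Sum>n\<in>{1..T}. ?x n q q') - 2 * m * (\<Sum>q\<in>P. A q) + m\<^sup>2 * A 1" .
  have "(\<Sum>q\<in>P. \<Sum>q'\<in>P. \<Sum>n\<in>{1..T}. ?x n q q')
    \<le> (\<Sum>q\<in>P. \<Sum>q'\<in>P. real T * M * (u q * u q') + (real z)\<^sup>2 + ?d q q')"
    by (intro sum_mono B)
  also have "\<dots> = real T * M * U\<^sup>2 + (real (card P))\<^sup>2 * (real z)\<^sup>2 + real T * M * (4 * m)"
  proof -
    have "(\<Sum>q\<in>P. \<Sum>q'\<in>P. real T * M * (u q * u q')) = real T * M * U\<^sup>2"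
      unfolding U_def power2_eq_square sum_product by (simp only: sum_distrib_left)
    moreover have "(\<Sum>q\<in>P. \<Sum>q'\<in>P. if q = q' then real T * M * (4 * (1 / real q)) else 0) = real T * M * (4 * m)"
      using finP by (simp add: m_def sum_distrib_left)
    moreover have "(\<Sum>q\<in>P. \<Sum>q'\<in>P. (real z)\<^sup>2) = (real (card P))\<^sup>2 * (real z)\<^sup>2"
      by (simp add: power2_eq_square)
    ultimately show ?thesis by (simp only: sum.distrib)
  qed
  also have "\<dots> \<le> real T * M * (m + 3)\<^sup>2 + (real z)\<^sup>2 * (real z)\<^sup>2 + real T * M * (4 * m)"
    using M0 U U0 m0 cardP by (intro add_mono mult_mono power_mono) auto
  finally have 1: "(\<Sum>q\<in>P. \<Sum>q'\<in>P. \<Sum>n\<in>{1..T}. ?x n q q') \<le> real T * M * (m + 3)\<^sup>2 + real z ^ 4 + real T * M * (4 * m)"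
    by (simp add: power_add[symmetric])
  have "(\<Sum>q\<in>P. A q) \<ge> (\<Sum>q\<in>P. real T * M * (1 / real q - 1 / (real q)\<^sup>2) - (real z)\<^sup>2)"
    by (intro sum_mono Aq_ge)
  also have "(\<Sum>q\<in>P. real T * M * (1 / real q - 1 / (real q)\<^sup>2) - (real z)\<^sup>2) = real T * M * (m - (\<Sum>q\<in>P. 1 / (real q)\<^sup>2)) - real (card P) * (real z)\<^sup>2"
    by (simp only: sum_subtractf m_def sum_distrib_left[symmetric] sum_constant)
  also have "\<dots> \<ge> real T * M * (m - 1) - real z * (real z)\<^sup>2"
    using M0 sum_over_squares_of_primes_le[OF P] cardP by (intro diff_mono mult_left_mono mult_right_mono) auto
  finally have "2 * m * (\<Sum>q\<in>P. A q) \<ge> 2 * m * (real T * M * (m - 1) - real z * (real z)\<^sup>2)"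
    using m0 by (intro mult_left_mono) auto
  hence 2: "- (2 * m * (\<Sum>q\<in>P. A q)) \<le> - (real T * M * (2 * m * (m - 1))) + 2 * m * (real z * (real z)\<^sup>2)"
    by (simp add: algebra_simps)
  have "2 * m * (real z * (real z)\<^sup>2) \<le> 2 * real z * (real z * (real z)\<^sup>2)"
    using mz by (intro mult_right_mono) auto
  also have "\<dots> = 2 * real z ^ 4" by (simp add: power2_eq_square power4_eq_xxxx)
  finally have 3: "2 * m * (real z * (real z)\<^sup>2) \<le> 2 * real z ^ 4" .
  have "m\<^sup>2 * A 1 \<le> m\<^sup>2 * (real T * M + (real z)\<^sup>2)" using A1 by (intro mult_left_mono) auto
  also have "\<dots> = real T * M * m\<^sup>2 + m\<^sup>2 * (real z)\<^sup>2" by (simp add: algebra_simps)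
  also have "m\<^sup>2 * (real z)\<^sup>2 \<le> (real z)\<^sup>2 * (real z)\<^sup>2" using mz m0 by (intro mult_right_mono power_mono) auto
  also have "\<dots> = real z ^ 4" by (simp add: power_add[symmetric])
  finally have 4: "m\<^sup>2 * A 1 \<le> real T * M * m\<^sup>2 + real z ^ 4" by simp
  \<comment> \<open>Here the terms in m^2 cancel, because all three moments are measured against the
    same mean value M. The error terms amount to z^4 + 2 z^4 + z^4.\<close>
  have "real T * M * (m + 3)\<^sup>2 + real T * M * (4 * m) - real T * M * (2 * m * (m - 1)) + real T * M * m\<^sup>2 = real T * M * (12 * m + 9)"
    by (simp add: power2_eq_square algebra_simps)
  hence "(\<Sum>n\<in>{1..T}. \<beta> n * (?w n - m)\<^sup>2) \<le> real T * M * (12 * m + 9) + 5 * real z ^ 4"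
    using eq 1 2 3 4 zero_le_power[of "real z" 4] by linarith
  thus ?thesis unfolding \<beta>_def M_def .
qed

text \<open>Chebyshev's inequality for the variance above. Primes p > z have majorant 1 and are
  counted by the weighted sum; those up to z are counted trivially.\<close>

lemma card_primes_abnormal_le:
  fixes a b z T :: nat and h :: real
  assumes z: "z \<ge> 1" and P: "P \<subseteq> primes_upto z" and ndvd: "\<And>q. q \<in> P \<Longrightarrow> \<not> q dvd a \<and> \<not> q dvd b"
    and h: "h > 0"
  defines "m \<equiv> (\<Sum>q\<in>P. 1 / real q)"
  shows "real (card {p\<in>primes_upto T. \<bar>real (card {q\<in>P. q dvd a * p + b}) - m\<bar> \<ge> h})
    \<le> real z + (real T * (2 / ln (real z + 1)) * (12 * m + 9) + 5 * real z ^ 4) / h\<^sup>2"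
proof -
  let ?d = "\<lambda>n. real (card {q\<in>P. q dvd a * n + b}) - m"
  let ?A = "{p\<in>primes_upto T. \<bar>?d p\<bar> \<ge> h}"
  let ?B = "{p\<in>?A. p > z}"
  have m0: "m \<ge> 0" by (simp add: m_def sum_nonneg)
  have "h\<^sup>2 * real (card ?B) = (\<Sum>p\<in>?B. h\<^sup>2)" by simp
  also have "\<dots> \<le> (\<Sum>p\<in>?B. selberg_majorant z p * (?d p)\<^sup>2)"
  proof (intro sum_mono)
    fix p assume p: "p \<in> ?B"
    hence "selberg_majorant z p = 1" using z by (intro selberg_majorant_prime) (auto simp: primes_upto_def)
    moreover have "h\<^sup>2 \<le> \<bar>?d p\<bar>\<^sup>2" using p h by (intro power_mono) auto
    ultimately show "h\<^sup>2 \<le> selberg_majorant z p * (?d p)\<^sup>2" by simp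
  qed
  also have "\<dots> \<le> (\<Sum>n\<in>{1..T}. selberg_majorant z n * (?d n)\<^sup>2)"
    by (intro sum_mono2) (auto simp: primes_upto_def Suc_le_eq prime_gt_0_nat selberg_majorant_nonneg)
  also have "\<dots> \<le> real T * selberg_density z * (12 * m + 9) + 5 * real z ^ 4"
    unfolding m_def using z P ndvd by (rule turan_kubilius_selberg)
  also have "\<dots> \<le> real T * (2 / ln (real z + 1)) * (12 * m + 9) + 5 * real z ^ 4"
  proof -
    have l: "ln (real z + 1) > 0" using z by simp
    have "selberg_density z \<le> 1 / squarefree_harm z" by (rule selberg_density_le[OF z])
    also have "\<dots> \<le> 1 / (ln (real z + 1) / 2)"
      using squarefree_harm_ge[OF z] l squarefree_harm_pos[OF z] by (intro divide_left_mono mult_pos_pos) auto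
    finally have "selberg_density z \<le> 2 / ln (real z + 1)" by simp
    thus ?thesis using m0 by (intro add_right_mono mult_right_mono mult_left_mono) auto
  qed
  finally have "real (card ?B) \<le> (real T * (2 / ln (real z + 1)) * (12 * m + 9) + 5 * real z ^ 4) / h\<^sup>2"
    using h by (simp add: field_simps)
  moreover have "card ?A \<le> z + card ?B"
  proof -
    have "card ?A \<le> card ({1..z} \<union> ?B)"
      by (intro card_mono) (auto simp: primes_upto_def Suc_le_eq prime_gt_0_nat)
    also have "\<dots> \<le> card {1..z} + card ?B" by (rule card_Un_le)
    finally show ?thesis by simp
  qed
  ultimately show ?thesis by linarith
qed

section \<open>Multiplicative weights\<close>

lemma geometric_tail_le:
  fixes x :: real assumes "0 \<le> x" "x \<le> 3/4"
  shows "(\<Sum>k\<in>{2..n}. x ^ k) \<le> 4 * x\<^sup>2"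
proof (cases "n \<ge> 2")
  case True
  have "(\<Sum>k\<in>{2..n}. x ^ k) \<le> 4 * x\<^sup>2 - 4 * x ^ Suc n"
    using True
  proof (induction n rule: dec_induct)
    case base
    have "4 * x ^ 3 = 4 * x * x\<^sup>2" by (simp add: power2_eq_square power3_eq_cube)
    also have "\<dots> \<le> 3 * x\<^sup>2" using assms by (intro mult_right_mono) auto
    finally show ?case by (simp add: numeral_3_eq_3 numeral_2_eq_2)
  next
    case (step n)
    have "4 * x ^ Suc (Suc n) = 4 * x * x ^ Suc n" by simp
    also have "\<dots> \<le> 3 * x ^ Suc n" using assms by (intro mult_right_mono) auto
    finally show ?case using step by simp
  qed
  thus ?thesis using assms by (smt (verit) zero_le_power)
qed (use assms in auto)

text \<open>This is the ratio of the geometric series that bounds f on prime powers; the value 3/4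
  is checked on fourth powers, where it reads 2^(-3) \<le> (3/4)^4.\<close>

lemma prime_powr_le:
  assumes "prime (p::nat)" shows "real p powr (-3/4) \<le> 3/4" "(real p powr (-3/4))\<^sup>2 = real p powr (-3/2)"
proof -
  have p: "real p \<ge> 2" using prime_ge_2_nat[OF assms] by simp
  have "(real p powr (-3/4)) ^ 4 = real p powr (-3)"
    using p by (simp add: powr_power)
  also have "\<dots> \<le> 2 powr (-3)" using p by (intro powr_mono2') auto
  also have "(2::real) powr (-3) = 1 / 8" by (simp add: powr_minus_divide)
  also have "(1 / 8 :: real) \<le> (3/4) ^ 4" by (simp add: power4_eq_xxxx)
  finally show "real p powr (-3/4) \<le> 3/4" by (rule power_le_imp_le_base[of _ 3, simplified]) simp
  show "(real p powr (-3/4))\<^sup>2 = real p powr (-3/2)" using p by (simp add: powr_power)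
qed

lemma power_powr_swap: "real (p ^ k) powr x = (real p powr x) ^ k" if "p > 0"
  using that by (simp add: powr_power powr_realpow[symmetric] powr_powr mult.commute)

locale arith_weight =
  fixes f :: "nat \<Rightarrow> real" and A1 :: real and A2 :: "real \<Rightarrow> real"
  assumes class_M: "f \<in> class_M A1 A2" and A1_pos: "A1 > 0" and A2_pos: "\<epsilon> > 0 \<Longrightarrow> A2 \<epsilon> > 0"
begin

lemma f_nonneg: "n > 0 \<Longrightarrow> f n \<ge> 0"
  using class_M by (auto simp: class_M_def)

lemma f_1 [simp]: "f 1 = 1" "f (Suc 0) = 1"
  using class_M by (auto simp: class_M_def multiplicative_def)

lemma f_mult: "coprime m n \<Longrightarrow> m > 0 \<Longrightarrow> n > 0 \<Longrightarrow> f (m * n) = f m * f n"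
  using class_M by (auto simp: class_M_def multiplicative_def)

lemma f_prime_le: "prime p \<Longrightarrow> f p \<le> A1"
proof -
  assume p: "prime p"
  have "f p \<le> A1 ^ Defs.bigomega p" using class_M prime_gt_0_nat[OF p] by (auto simp: class_M_def)
  thus ?thesis using p by (simp add: Defs.bigomega_def prime_factorization_prime)
qed

lemma f_le_powr: "\<epsilon> > 0 \<Longrightarrow> n > 0 \<Longrightarrow> f n \<le> A2 \<epsilon> * real n powr \<epsilon>"
  using class_M by (auto simp: class_M_def)

definition weight_sum :: "nat \<Rightarrow> real" where "weight_sum N = (\<Sum>n\<in>{1..N}. f n)"
definition harmonic_sum :: "nat \<Rightarrow> real" where "harmonic_sum N = (\<Sum>n\<in>{1..N}. f n / real n)"

lemma harmonic_sum_mono: "M \<le> N \<Longrightarrow> harmonic_sum M \<le> harmonic_sum N"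
  unfolding harmonic_sum_def by (intro sum_mono2) (auto intro!: divide_nonneg_nonneg f_nonneg)

lemma harmonic_sum_ge_1: "N \<ge> 1 \<Longrightarrow> harmonic_sum N \<ge> 1"
  using harmonic_sum_mono[of 1 N] by (simp add: harmonic_sum_def)

lemma weight_sum_nonneg: "weight_sum N \<ge> 0"
  unfolding weight_sum_def by (intro sum_nonneg f_nonneg) auto

text \<open>For j = 1 the bound f(q) \<le> A1 applies. For j \<ge> 2 the bound f(n) \<le> A2(1/4)
  n^(1/4) leaves a geometric series of order q^(-3/2).\<close>

lemma sum_prime_power_ratio_le:
  obtains K where "K > 0" "\<And>q J. prime q \<Longrightarrow> (\<Sum>j\<in>{1..J}. f (q ^ j) / real (q ^ j)) \<le> K / real q"
proof (rule that[of "A1 + 4 * A2 (1/4)"])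
  show "A1 + 4 * A2 (1/4) > 0" using A1_pos A2_pos[of "1/4"] by simp
  fix q J :: nat assume q: "prime q"
  have q2: "real q \<ge> 2" using prime_ge_2_nat[OF q] by simp
  let ?x = "real q powr (-3/4)"
  have "(\<Sum>j\<in>{1..J}. f (q ^ j) / real (q ^ j)) \<le> A1 / real q + (\<Sum>j\<in>{2..J}. f (q ^ j) / real (q ^ j))"
  proof (cases "J \<ge> 1")
    case True
    hence "(\<Sum>j\<in>{1..J}. f (q ^ j) / real (q ^ j)) = f (q ^ 1) / real (q ^ 1) + (\<Sum>j\<in>{2..J}. f (q ^ j) / real (q ^ j))"
      by (subst sum.atLeast_Suc_atMost) (auto simp: numeral_2_eq_2)
    moreover have "f (q ^ 1) / real (q ^ 1) \<le> A1 / real q" using f_prime_le[OF q] q2 by (auto intro: divide_right_mono)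
    ultimately show ?thesis by linarith
  qed (use A1_pos in auto)
  also have "(\<Sum>j\<in>{2..J}. f (q ^ j) / real (q ^ j)) \<le> (\<Sum>j\<in>{2..J}. A2 (1/4) * ?x ^ j)"
  proof (intro sum_mono)
    fix j
    have "f (q ^ j) / real (q ^ j) \<le> A2 (1/4) * real (q ^ j) powr (1/4) / real (q ^ j)"
      using f_le_powr[of "1/4" "q ^ j"] q2 by (intro divide_right_mono) auto
    also have "\<dots> = A2 (1/4) * (real (q ^ j) powr (1/4) / real (q ^ j) powr 1)" using q2 by simp
    also have "real (q ^ j) powr (1/4) / real (q ^ j) powr 1 = real (q ^ j) powr (-3/4)"
      by (subst powr_diff[symmetric]) simp
    also have "real (q ^ j) powr (-3/4) = ?x ^ j" using q2 by (intro power_powr_swap) auto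
    finally show "f (q ^ j) / real (q ^ j) \<le> A2 (1/4) * ?x ^ j" .
  qed
  also have "\<dots> = A2 (1/4) * (\<Sum>j\<in>{2..J}. ?x ^ j)" by (simp add: sum_distrib_left)
  also have "\<dots> \<le> A2 (1/4) * (4 * ?x\<^sup>2)"
    using A2_pos[of "1/4"] prime_powr_le[OF q] by (intro mult_left_mono geometric_tail_le) auto
  also have "?x\<^sup>2 = real q powr (-3/2)" by (rule prime_powr_le[OF q])
  also have "\<dots> \<le> real q powr (-1)" using q2 by (intro powr_mono) auto
  also have "\<dots> = 1 / real q" using q2 by (simp add: powr_minus_divide)
  finally show "(\<Sum>j\<in>{1..J}. f (q ^ j) / real (q ^ j)) \<le> (A1 + 4 * A2 (1/4)) / real q"
    using A2_pos[of "1/4"] by (simp add: add_divide_distrib mult.commute mult_right_mono)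
qed

text \<open>With y = p^k, f(y) ln y is O(y^(1/8)), and y^(1/8) = y^(7/8) y^(-3/4), where the first
  factor is at most u^(7/8) and the second is summable over proper prime powers. The exponent below
  1 is what makes higher prime powers negligible.\<close>

lemma sum_proper_prime_powers_le:
  obtains C where "C > 0"
    "\<And>R u. finite R \<Longrightarrow> u > 0 \<Longrightarrow> (\<And>p k. (p, k) \<in> R \<Longrightarrow> prime p \<and> k \<ge> 2 \<and> real (p ^ k) \<le> u) \<Longrightarrow>
       (\<Sum>(p, k)\<in>R. f (p ^ k) * real k * ln (real p)) \<le> C * u powr (7/8)"
proof -
  obtain C0 :: real where C0: "C0 > 0" "\<And>A :: nat set. finite A \<Longrightarrow> 0 \<notin> A \<Longrightarrow> (\<Sum>n\<in>A. real n powr (-3/2)) \<le> C0"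
    using sum_powr_three_halves by blast
  let ?c = "16 * A2 (1/16)"
  have c: "?c > 0" using A2_pos[of "1/16"] by simp
  show ?thesis
  proof (rule that[of "?c * (4 * C0)"])
    show "?c * (4 * C0) > 0" using c C0 by simp
    fix R :: "(nat \<times> nat) set" and u :: real
    assume R: "finite R" "u > 0" "\<And>p k. (p, k) \<in> R \<Longrightarrow> prime p \<and> k \<ge> 2 \<and> real (p ^ k) \<le> u"
    \<comment> \<open>A common bound for the exponents embeds R in a product set, on which the sum
      over k is a geometric sum for each p.\<close>
    define K where "K = Max (insert 0 (snd ` R))"
    have K: "k \<le> K" if "(p, k) \<in> R" for p k unfolding K_def using R(1) imageI[OF that, of snd] by (intro Max_ge) auto
    have each: "f (p ^ k) * real k * ln (real p) \<le> ?c * u powr (7/8) * (real p powr (-3/4)) ^ k" if "(p, k) \<in> R" for p k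
    proof -
      have pk: "prime p" "k \<ge> 2" "real (p ^ k) \<le> u" using R(3)[OF that] by auto
      have p0: "p > 0" using pk by (simp add: prime_gt_0_nat)
      let ?y = "real (p ^ k)"
      have y1: "?y \<ge> 1" using p0 by (simp add: Suc_le_eq)
      have "real k * ln (real p) = ln ?y" using p0 by (simp add: ln_realpow)
      also have "\<dots> \<le> ?y powr (1/16) / (1/16)" using y1 by (intro ln_powr_bound) auto
      finally have l: "real k * ln (real p) \<le> 16 * ?y powr (1/16)" by simp
      have "f (p ^ k) * (real k * ln (real p)) \<le> (A2 (1/16) * ?y powr (1/16)) * (16 * ?y powr (1/16))"
      proof (rule mult_mono[OF _ l])
        show "f (p ^ k) \<le> A2 (1/16) * ?y powr (1/16)" using p0 by (intro f_le_powr) auto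
        show "0 \<le> A2 (1/16) * ?y powr (1/16)" using A2_pos[of "1/16"] by simp
        show "0 \<le> real k * ln (real p)" using p0 by (simp add: Suc_le_eq)
      qed
      also have "\<dots> = ?c * (?y powr (1/16) * ?y powr (1/16))" by simp
      also have "?y powr (1/16) * ?y powr (1/16) = ?y powr (1/8)" by (simp only: powr_add[symmetric]) simp
      also have "\<dots> = ?y powr (7/8) * ?y powr (-3/4)" by (simp only: powr_add[symmetric]) simp
      also have "?y powr (-3/4) = (real p powr (-3/4)) ^ k" using p0 by (rule power_powr_swap)
      finally have 1: "f (p ^ k) * (real k * ln (real p)) \<le> ?c * (?y powr (7/8) * (real p powr (-3/4)) ^ k)" .
      have "?y powr (7/8) * (real p powr (-3/4)) ^ k \<le> u powr (7/8) * (real p powr (-3/4)) ^ k"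
        using pk y1 by (intro mult_right_mono powr_mono2) auto
      hence "?c * (?y powr (7/8) * (real p powr (-3/4)) ^ k) \<le> ?c * (u powr (7/8) * (real p powr (-3/4)) ^ k)"
        using c by (intro mult_left_mono) auto
      with 1 show ?thesis by (simp only: mult.assoc)
    qed
    have "(\<Sum>(p, k)\<in>R. f (p ^ k) * real k * ln (real p)) \<le> (\<Sum>(p, k)\<in>R. ?c * u powr (7/8) * (real p powr (-3/4)) ^ k)"
      using each by (intro sum_mono) auto
    also have "\<dots> \<le> (\<Sum>(p, k)\<in>fst ` R \<times> {2..K}. ?c * u powr (7/8) * (real p powr (-3/4)) ^ k)"
    proof (intro sum_mono2 subsetI)
      fix x assume x: "x \<in> R"
      obtain p k where pk: "x = (p, k)" by (cases x)
      show "x \<in> fst ` R \<times> {2..K}"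
        using imageI[OF x, of fst] R(3)[of p k] K[of p k] x unfolding pk by simp
    next
      fix x assume "x \<in> fst ` R \<times> {2..K} - R"
      show "0 \<le> (case x of (p, k) \<Rightarrow> ?c * u powr (7/8) * (real p powr (-3/4)) ^ k)"
        using c by (cases x) (simp only: prod.case, intro mult_nonneg_nonneg, auto)
    qed (use R in auto)
    also have "\<dots> = ?c * u powr (7/8) * (\<Sum>p\<in>fst ` R. \<Sum>k\<in>{2..K}. (real p powr (-3/4)) ^ k)"
      by (simp add: sum.cartesian_product[symmetric] sum_distrib_left)
    also have "\<dots> \<le> ?c * u powr (7/8) * (\<Sum>p\<in>fst ` R. 4 * real p powr (-3/2))"
    proof (intro mult_left_mono sum_mono)
      fix p assume "p \<in> fst ` R"
      then obtain k where "(p, k) \<in> R" by force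
      hence p: "prime p" using R(3) by blast
      show "(\<Sum>k\<in>{2..K}. (real p powr (-3/4)) ^ k) \<le> 4 * real p powr (-3/2)"
        using geometric_tail_le[of "real p powr (-3/4)" K] prime_powr_le[OF p] by simp
    qed (use c in auto)
    also have "\<dots> = ?c * u powr (7/8) * (4 * (\<Sum>p\<in>fst ` R. real p powr (-3/2)))" by (simp add: sum_distrib_left)
    also have "\<dots> \<le> ?c * u powr (7/8) * (4 * C0)"
    proof (intro mult_left_mono C0(2))
      show "0 \<notin> fst ` R" using R(3) by (force dest: prime_gt_0_nat)
    qed (use c R in auto)
    finally show "(\<Sum>(p, k)\<in>R. f (p ^ k) * real k * ln (real p)) \<le> ?c * (4 * C0) * u powr (7/8)"
      by (simp add: mult_ac)
  qed
qed


section \<open>Logarithmic weighting\<close>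

lemma prime_multiplicity_cases:
  assumes "n > 0" "prime (p::nat)" "p dvd n"
  obtains k y where "n = y * p ^ k" "k = multiplicity p n" "k \<ge> 1" "\<not> p dvd y" "y > 0" "f n = f y * f (p ^ k)"
proof -
  have "n \<noteq> 0" "\<not> is_unit p" using assms by auto
  then obtain y where y: "n = p ^ multiplicity p n * y" "\<not> p dvd y" by (rule multiplicity_decompose')
  have y0: "y > 0" using y assms by (auto intro!: Nat.gr0I)
  have "coprime y (p ^ multiplicity p n)"
    using assms(2) y(2) by (simp add: coprime_commute prime_imp_coprime)
  hence "f (y * p ^ multiplicity p n) = f y * f (p ^ multiplicity p n)"
    using y0 assms by (intro f_mult) (auto simp: prime_gt_0_nat)
  moreover have "n = y * p ^ multiplicity p n" using y(1) by (simp only: mult.commute)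
  moreover have "multiplicity p n \<ge> 1" using assms by (simp add: Suc_le_eq prime_multiplicity_gt_zero_iff)
  ultimately show ?thesis using that[of y "multiplicity p n"] y(2) y0 by metis
qed

lemma sum_f_ln_eq:
  assumes "X \<subseteq> {1..N}"
  shows "(\<Sum>n\<in>X. f n * ln (real n)) = (\<Sum>(n, p)\<in>(SIGMA n:X. prime_factors n). f n * (real (multiplicity p n) * ln (real p)))"
proof -
  have fin: "finite X" using assms by (rule finite_subset) simp
  have "(\<Sum>n\<in>X. f n * ln (real n)) = (\<Sum>n\<in>X. \<Sum>p\<in>prime_factors n. f n * (real (multiplicity p n) * ln (real p)))"
  proof (intro sum.cong refl)
    fix n assume "n \<in> X"
    hence "n > 0" using assms by auto
    thus "f n * ln (real n) = (\<Sum>p\<in>prime_factors n. f n * (real (multiplicity p n) * ln (real p)))"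
      by (simp only: ln_prime_factorization sum_distrib_left)
  qed
  also have "\<dots> = (\<Sum>(n, p)\<in>(SIGMA n:X. prime_factors n). f n * (real (multiplicity p n) * ln (real p)))"
    using fin by (intro sum.Sigma) auto
  finally show ?thesis .
qed

text \<open>The pairs (n, p) with p | n are sorted by the multiplicity k of p: k = 1 gives n = m p,
  and k \<ge> 2 gives n = m p^k, where membership in X is dropped. The set X is left free because
  the bound is applied both to {1..N} and to the atypical n.\<close>

lemma sum_f_ln_le:
  obtains C where "C > 0"
    "\<And>N X. X \<subseteq> {1..N} \<Longrightarrow> (\<Sum>n\<in>X. f n * ln (real n)) \<le>
       (\<Sum>m\<in>{1..N}. f m * (\<Sum>p | p \<in> primes_upto (N div m) \<and> \<not> p dvd m \<and> m * p \<in> X. f p * ln (real p)))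
       + C * (\<Sum>m\<in>{1..N}. f m * (real N / real m) powr (7/8))"
proof -
  obtain C where C: "C > 0"
    "\<And>R u. finite R \<Longrightarrow> u > 0 \<Longrightarrow> (\<And>p k. (p, k) \<in> R \<Longrightarrow> prime p \<and> k \<ge> 2 \<and> real (p ^ k) \<le> u) \<Longrightarrow>
       (\<Sum>(p, k)\<in>R. f (p ^ k) * real k * ln (real p)) \<le> C * u powr (7/8)"
    using sum_proper_prime_powers_le by blast
  show ?thesis
  proof (rule that[OF C(1)])
    fix N X assume X: "X \<subseteq> {1..N::nat}"
    have finX: "finite X" using X by (rule finite_subset) simp
    define Z where "Z = (SIGMA n:X. prime_factors n)"
    define G where "G = (\<lambda>(n, p). f n * (real (multiplicity p n) * ln (real p)))"
    define Z1 where "Z1 = {x\<in>Z. multiplicity (snd x) (fst x) = 1}"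
    define Z2 where "Z2 = {x\<in>Z. multiplicity (snd x) (fst x) \<noteq> 1}"
    define A where "A = (\<lambda>m. {p. p \<in> primes_upto (N div m) \<and> \<not> p dvd m \<and> m * p \<in> X})"
    define B where "B = (\<lambda>m. {(p, k). prime p \<and> 2 \<le> k \<and> m * p ^ k \<le> N})"
    let ?g1 = "\<lambda>y. case y of (m, p) \<Rightarrow> f m * (f p * ln (real p))"
    let ?g = "\<lambda>x. case x of (p, k) \<Rightarrow> f (p ^ k) * real k * ln (real p)"
    let ?g2 = "\<lambda>y. case y of (m, x) \<Rightarrow> f m * ?g x"
    have finZ: "finite Z" using finX by (auto simp: Z_def)
    have finA: "finite (A m)" for m by (simp add: A_def)
    have finB: "finite (B m)" if "m \<in> {1..N}" for m
    proof (rule finite_subset)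
      show "B m \<subseteq> {..N} \<times> {..N}"
      proof
        fix x assume "x \<in> B m"
        then obtain p k where x: "x = (p, k)" "prime p" "2 \<le> k" "m * p ^ k \<le> N" by (auto simp: B_def)
        have "p ^ k \<le> m * p ^ k" using that by simp
        hence le: "p ^ k \<le> N" using x(4) by linarith
        have "p ^ 1 \<le> p ^ k" using x by (intro power_increasing) (auto simp: Suc_le_eq prime_gt_0_nat)
        moreover have "k < p ^ k"
          using prime_ge_2_nat[OF x(2)] by (metis less_exp power_mono le_less_trans less_le_trans zero_le)
        ultimately show "x \<in> {..N} \<times> {..N}" using le x(1) by simp
      qed
    qed simp
    have "(\<Sum>n\<in>X. f n * ln (real n)) = sum G Z"
      unfolding G_def Z_def by (rule sum_f_ln_eq[OF X])
    also have "\<dots> = sum G Z1 + sum G Z2"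
      unfolding Z1_def Z2_def using finZ by (subst sum.union_disjoint[symmetric]) (auto intro!: sum.cong)
    finally have eq: "(\<Sum>n\<in>X. f n * ln (real n)) = sum G Z1 + sum G Z2" .
    have "sum G Z1 \<le> (\<Sum>(m, p)\<in>(SIGMA m:{1..N}. A m). f m * (f p * ln (real p)))"
    proof (rule sum_le_included[where i = "\<lambda>(m, p). (m * p, p)"])
      show "\<forall>y\<in>(SIGMA m:{1..N}. A m). 0 \<le> ?g1 y"
        by (auto simp: A_def primes_upto_def Suc_le_eq prime_gt_0_nat intro!: mult_nonneg_nonneg f_nonneg)
      show "\<forall>x\<in>Z1. \<exists>y\<in>(SIGMA m:{1..N}. A m). (case y of (m, p) \<Rightarrow> (m * p, p)) = x \<and> G x \<le> ?g1 y"
      proof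
        fix x assume x: "x \<in> Z1"
        obtain n p where np: "x = (n, p)" by (cases x)
        have n: "n \<in> X" "prime p" "p dvd n" "multiplicity p n = 1" "n > 0" "n \<le> N"
          using x X by (auto simp: np Z1_def Z_def in_prime_factors_iff)
        obtain k y where y: "n = y * p ^ k" "k = multiplicity p n" "\<not> p dvd y" "y > 0" "f n = f y * f (p ^ k)"
          using prime_multiplicity_cases[OF n(5,2,3)] by metis
        have k: "k = 1" using y n by simp
        have n': "n = y * p" using y(1) k by simp
        have p0: "p > 0" using n(2) by (simp add: prime_gt_0_nat)
        have "y \<le> n" using n' p0 by simp
        hence "y \<in> {1..N}" using y(4) n(6) by simp
        moreover have "p \<le> N div y" using n(6) y(4) n' by (simp add: less_eq_div_iff_mult_less_eq mult.commute)
        hence "p \<in> A y" using n y(3) n' by (simp add: A_def primes_upto_def)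
        moreover have "G x = f y * (f p * ln (real p))" 
        proof -
          have "f n = f y * f p" using y(5) k by simp
          thus ?thesis using n(4) by (simp add: G_def np)
        qed
        ultimately show "\<exists>y\<in>(SIGMA m:{1..N}. A m). (case y of (m, p) \<Rightarrow> (m * p, p)) = x \<and> G x \<le> ?g1 y"
          using n' np by (intro bexI[of _ "(y, p)"]) auto
      qed
    qed (use finZ finA in \<open>auto simp: Z1_def\<close>)
    also have "\<dots> = (\<Sum>m\<in>{1..N}. \<Sum>p\<in>A m. f m * (f p * ln (real p)))"
      using finA by (intro sum.Sigma[symmetric]) auto
    finally have 1: "sum G Z1 \<le> (\<Sum>m\<in>{1..N}. f m * (\<Sum>p\<in>A m. f p * ln (real p)))"
      by (simp only: sum_distrib_left)
    have "sum G Z2 \<le> (\<Sum>(m, x)\<in>(SIGMA m:{1..N}. B m). f m * ?g x)"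
    proof (rule sum_le_included[where i = "\<lambda>(m, (p, k)). (m * p ^ k, p)"])
      show "\<forall>y\<in>(SIGMA m:{1..N}. B m). 0 \<le> ?g2 y"
        by (auto simp: B_def Suc_le_eq prime_gt_0_nat intro!: mult_nonneg_nonneg f_nonneg)
      show "\<forall>x\<in>Z2. \<exists>y\<in>(SIGMA m:{1..N}. B m). (case y of (m, (p, k)) \<Rightarrow> (m * p ^ k, p)) = x \<and> G x \<le> ?g2 y"
      proof
        fix x assume x: "x \<in> Z2"
        obtain n p where np: "x = (n, p)" by (cases x)
        have n: "n \<in> X" "prime p" "p dvd n" "multiplicity p n \<noteq> 1" "n > 0" "n \<le> N"
          using x X by (auto simp: np Z2_def Z_def in_prime_factors_iff)
        obtain k y where y: "n = y * p ^ k" "k = multiplicity p n" "k \<ge> 1" "\<not> p dvd y" "y > 0" "f n = f y * f (p ^ k)"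
          using prime_multiplicity_cases[OF n(5,2,3)] by metis
        have k: "k \<ge> 2" using y n by simp
        have "p ^ k > 0" using n(2) by (simp add: prime_gt_0_nat)
        hence "1 \<le> p ^ k" by linarith
        hence "y * 1 \<le> y * p ^ k" by (rule mult_le_mono2)
        hence "y \<le> n" using y(1) by simp
        hence "y \<in> {1..N}" using y(5) n(6) by simp
        moreover have "(p, k) \<in> B y" using n y(1) k by (simp add: B_def)
        moreover have "G x = f y * (f (p ^ k) * real k * ln (real p))" using y(2,6) by (simp add: G_def np)
        ultimately show "\<exists>y\<in>(SIGMA m:{1..N}. B m). (case y of (m, (p, k)) \<Rightarrow> (m * p ^ k, p)) = x \<and> G x \<le> ?g2 y"
          using y(1) np by (intro bexI[of _ "(y, (p, k))"]) auto
      qed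
    qed (use finZ finB in \<open>auto simp: Z2_def\<close>)
    also have "\<dots> = (\<Sum>m\<in>{1..N}. \<Sum>x\<in>B m. f m * ?g x)"
      using finB by (intro sum.Sigma[symmetric]) auto
    also have "\<dots> = (\<Sum>m\<in>{1..N}. f m * (\<Sum>(p, k)\<in>B m. f (p ^ k) * real k * ln (real p)))"
      by (simp only: sum_distrib_left)
    also have "\<dots> \<le> (\<Sum>m\<in>{1..N}. f m * (C * (real N / real m) powr (7/8)))"
    proof (intro sum_mono mult_left_mono C(2) finB)
      fix m p k assume m: "m \<in> {1..N}" and "(p, k) \<in> B m"
      hence pk: "prime p" "2 \<le> k" "m * p ^ k \<le> N" by (auto simp: B_def)
      have "real (m * p ^ k) \<le> real N" using pk(3) by (rule of_nat_mono)
      hence "real (p ^ k) \<le> real N / real m" using m by (simp add: field_simps)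
      thus "prime p \<and> 2 \<le> k \<and> real (p ^ k) \<le> real N / real m" using pk by simp
    qed (auto intro!: f_nonneg)
    also have "\<dots> = C * (\<Sum>m\<in>{1..N}. f m * (real N / real m) powr (7/8))"
      by (simp add: sum_distrib_left mult_ac)
    finally have 2: "sum G Z2 \<le> C * (\<Sum>m\<in>{1..N}. f m * (real N / real m) powr (7/8))" .
    show "(\<Sum>n\<in>X. f n * ln (real n)) \<le>
       (\<Sum>m\<in>{1..N}. f m * (\<Sum>p | p \<in> primes_upto (N div m) \<and> \<not> p dvd m \<and> m * p \<in> X. f p * ln (real p)))
       + C * (\<Sum>m\<in>{1..N}. f m * (real N / real m) powr (7/8))"
      using eq 1 2 unfolding A_def by linarith
  qed
qed

text \<open>Conversely, the pairs (m, p) with p not dividing m yield distinct pairs (m p, p) with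
  f(m p) = f(m) f(p), and the remaining pairs (n, p) contribute nonnegative terms.\<close>

lemma sum_f_ln_ge:
  "(\<Sum>n\<in>{1..N}. f n * ln (real n)) \<ge> (\<Sum>m\<in>{1..N}. f m * (\<Sum>p | p \<in> primes_upto (N div m) \<and> \<not> p dvd m. f p * ln (real p)))"
proof -
  define A where "A = (\<lambda>m. {p. p \<in> primes_upto (N div m) \<and> \<not> p dvd m})"
  let ?g = "\<lambda>y. case y of (n, p) \<Rightarrow> f n * (real (multiplicity p n) * ln (real p))"
  let ?h = "\<lambda>x. case x of (m, p) \<Rightarrow> f m * (f p * ln (real p))"
  let ?Z = "SIGMA n:{1..N}. prime_factors n"
  have finA: "finite (A m)" for m by (simp add: A_def)
  have "(\<Sum>m\<in>{1..N}. f m * (\<Sum>p\<in>A m. f p * ln (real p))) = (\<Sum>m\<in>{1..N}. \<Sum>p\<in>A m. f m * (f p * ln (real p)))"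
    by (simp only: sum_distrib_left)
  also have "\<dots> = (\<Sum>(m, p)\<in>(SIGMA m:{1..N}. A m). f m * (f p * ln (real p)))"
    using finA by (intro sum.Sigma) auto
  also have "\<dots> \<le> (\<Sum>(n, p)\<in>?Z. f n * (real (multiplicity p n) * ln (real p)))"
  proof (rule sum_le_included[where i = "\<lambda>(n, p). (n div p, p)"])
    show "\<forall>y\<in>?Z. 0 \<le> ?g y"
      by (auto simp: in_prime_factors_iff Suc_le_eq prime_gt_0_nat intro!: mult_nonneg_nonneg f_nonneg)
    show "\<forall>x\<in>(SIGMA m:{1..N}. A m). \<exists>y\<in>?Z. (case y of (n, p) \<Rightarrow> (n div p, p)) = x \<and>
      ?h x \<le> ?g y"
    proof
      fix x assume x: "x \<in> (SIGMA m:{1..N}. A m)"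
      obtain m p where mp: "x = (m, p)" by (cases x)
      have m: "m \<in> {1..N}" "prime p" "p \<le> N div m" "\<not> p dvd m"
        using x by (auto simp: mp A_def primes_upto_def)
      have p0: "p > 0" using m(2) by (simp add: prime_gt_0_nat)
      have "m * p \<le> N" using m(1,3) by (simp add: less_eq_div_iff_mult_less_eq mult.commute)
      moreover have "m * p > 0" using m(1) p0 by simp
      ultimately have n: "m * p \<in> {1..N}" "p \<in> prime_factors (m * p)"
        using m(2) by (auto simp: in_prime_factors_iff)
      have "coprime m p" using m(2,4) by (metis coprime_commute prime_imp_coprime)
      hence fmp: "f (m * p) = f m * f p" using m(1) p0 by (intro f_mult) auto
      have mult: "real (multiplicity p (m * p)) \<ge> 1"
        using m(2) n by (simp add: Suc_le_eq prime_multiplicity_gt_zero_iff in_prime_factors_iff)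
      have l: "ln (real p) \<ge> 0" using p0 by (simp add: Suc_le_eq)
      have "f m * f p * (1 * ln (real p)) \<le> f m * f p * (real (multiplicity p (m * p)) * ln (real p))"
        using mult l m(1) p0 by (intro mult_left_mono mult_right_mono mult_nonneg_nonneg f_nonneg) auto
      hence "f m * (f p * ln (real p)) \<le> f (m * p) * (real (multiplicity p (m * p)) * ln (real p))"
        by (simp add: fmp mult.assoc)
      thus "\<exists>y\<in>?Z. (case y of (n, p) \<Rightarrow> (n div p, p)) = x \<and>
        ?h x \<le> ?g y"
        using n p0 mp by (intro bexI[of _ "(m * p, p)"]) auto
    qed
  qed (use finA in auto)
  also have "\<dots> = (\<Sum>n\<in>{1..N}. f n * ln (real n))" by (rule sum_f_ln_eq[symmetric, OF order_refl])
  finally show ?thesis unfolding A_def .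
qed

end

section \<open>Upper bounds for the sum of f and for the tail of its harmonic sum\<close>

lemma card_primes_upto_le: "card (primes_upto n) \<le> n"
proof -
  have "primes_upto n \<subseteq> {1..n}" by (auto simp: primes_upto_def Suc_le_eq prime_gt_0_nat)
  from card_mono[OF _ this] show ?thesis by simp
qed

lemma sum_recip_le_ln_diff:
  assumes "M \<ge> 1" "M \<le> N"
  shows "(\<Sum>k\<in>{M..<N}. 1 / (real k + 1)) \<le> ln (real N) - ln (real M)"
  using assms(2)
proof (induction N rule: dec_induct)
  case (step n)
  have n: "n \<ge> 1" using step assms by simp
  have "ln (real n / (real n + 1)) \<le> real n / (real n + 1) - 1" using n by (intro ln_le_minus_one) auto
  also have "\<dots> = - (1 / (real n + 1))" by (simp add: field_simps)
  finally have "1 / (real n + 1) \<le> ln (real n + 1) - ln (real n)" using n by (simp add: ln_divide_pos)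
  thus ?case using step by (simp add: add_ac)
qed simp

context arith_weight begin

text \<open>Chebyshev's bound together with f(p) \<le> A1. The predicate is free, so that any
  restriction on m p may be carried along.\<close>

lemma sum_f_ln_primes_le:
  assumes "m \<ge> 1"
  shows "(\<Sum>p | p \<in> primes_upto (N div m) \<and> Q p. f p * ln (real p)) \<le> 4 * A1 * (real N / real m)"
proof -
  have "(\<Sum>p | p \<in> primes_upto (N div m) \<and> Q p. f p * ln (real p)) \<le> (\<Sum>p | p \<in> primes_upto (N div m) \<and> Q p. A1 * ln (real p))"
    by (intro sum_mono mult_right_mono f_prime_le) (auto simp: primes_upto_def Suc_le_eq prime_gt_0_nat)
  also have "\<dots> \<le> (\<Sum>p\<in>primes_upto (N div m). A1 * ln (real p))"
    using A1_pos by (intro sum_mono2) (auto dest: primes_upto_ge2)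
  also have "\<dots> = A1 * (\<Sum>p\<in>primes_upto (N div m). ln (real p))" by (simp add: sum_distrib_left)
  also have "\<dots> \<le> A1 * (4 * real (N div m))" using A1_pos by (intro mult_left_mono theta_le) auto
  also have "\<dots> \<le> A1 * (4 * (real N / real m))"
    using A1_pos of_nat_div_le_of_nat[where 'a = real, of N m] by (intro mult_left_mono) auto
  finally show ?thesis by (simp add: mult_ac)
qed

text \<open>Split ln N = ln n + ln(N/n). The first part is handled by the decomposition n = m p^k;
  the second is at most N/n and again sums to N times the harmonic sum.\<close>

lemma weight_sum_ln_le:
  obtains C where "C > 0" "\<And>N. N \<ge> 1 \<Longrightarrow> weight_sum N * ln (real N) \<le> C * real N * harmonic_sum N"
proof -
  obtain C where C: "C > 0"
    "\<And>N X. X \<subseteq> {1..N} \<Longrightarrow> (\<Sum>n\<in>X. f n * ln (real n)) \<le>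
       (\<Sum>m\<in>{1..N}. f m * (\<Sum>p | p \<in> primes_upto (N div m) \<and> \<not> p dvd m \<and> m * p \<in> X. f p * ln (real p)))
       + C * (\<Sum>m\<in>{1..N}. f m * (real N / real m) powr (7/8))"
    using sum_f_ln_le by blast
  show ?thesis
  proof (rule that[of "4 * A1 + C + 1"])
    show "4 * A1 + C + 1 > 0" using A1_pos C by simp
    fix N :: nat assume N: "N \<ge> 1"
    have 1: "(\<Sum>m\<in>{1..N}. f m * (\<Sum>p | p \<in> primes_upto (N div m) \<and> \<not> p dvd m \<and> m * p \<in> {1..N}. f p * ln (real p)))
      \<le> (\<Sum>m\<in>{1..N}. f m * (4 * A1 * (real N / real m)))"
      by (intro sum_mono mult_left_mono sum_f_ln_primes_le f_nonneg) auto
    have 2: "(\<Sum>m\<in>{1..N}. f m * (real N / real m) powr (7/8)) \<le> (\<Sum>m\<in>{1..N}. f m * (real N / real m))"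
    proof (intro sum_mono mult_left_mono f_nonneg)
      fix m assume m: "m \<in> {1..N}"
      have "(real N / real m) powr (7/8) \<le> (real N / real m) powr 1"
        using m by (intro powr_mono) auto
      thus "(real N / real m) powr (7/8) \<le> real N / real m" using m by simp
    qed auto
    have NF: "(\<Sum>m\<in>{1..N}. f m * (real N / real m)) = real N * harmonic_sum N"
      by (simp add: harmonic_sum_def sum_distrib_left mult_ac)
    have 3: "(\<Sum>m\<in>{1..N}. f m * (4 * A1 * (real N / real m))) = 4 * A1 * (real N * harmonic_sum N)"
      unfolding NF[symmetric] sum_distrib_left by (intro sum.cong refl) (simp add: mult_ac)
    have "(\<Sum>n\<in>{1..N}. f n * ln (real n)) \<le> 4 * A1 * (real N * harmonic_sum N) + C * (real N * harmonic_sum N)"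
      using C(2)[of "{1..N}" N] 1 2 3 C(1) unfolding NF by (smt (verit) mult_left_mono order_refl)
    moreover have "weight_sum N * ln (real N) - (\<Sum>n\<in>{1..N}. f n * ln (real n)) \<le> real N * harmonic_sum N"
    proof -
      have "weight_sum N * ln (real N) - (\<Sum>n\<in>{1..N}. f n * ln (real n)) = (\<Sum>n\<in>{1..N}. f n * (ln (real N) - ln (real n)))"
        unfolding weight_sum_def sum_distrib_right sum_subtractf[symmetric]
        by (intro sum.cong refl) (simp add: algebra_simps)
      also have "\<dots> \<le> (\<Sum>n\<in>{1..N}. f n * (real N / real n))"
      proof (intro sum_mono mult_left_mono f_nonneg)
        fix n assume n: "n \<in> {1..N}"
        have "ln (real N) - ln (real n) = ln (real N / real n)" using n by (subst ln_divide_pos) auto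
        also have "\<dots> \<le> real N / real n - 1" using n by (intro ln_le_minus_one) auto
        finally show "ln (real N) - ln (real n) \<le> real N / real n" by simp
      qed auto
      finally show ?thesis unfolding NF .
    qed
    ultimately show "weight_sum N * ln (real N) \<le> (4 * A1 + C + 1) * real N * harmonic_sum N" by (simp add: algebra_simps)
  qed
qed

lemma harmonic_sum_eq_partial_summation:
  assumes "M \<ge> 1" "M \<le> N"
  shows "harmonic_sum N - harmonic_sum M = weight_sum N / real N - weight_sum M / real M + (\<Sum>k\<in>{M..<N}. weight_sum k / (real k * (real k + 1)))"
  using assms(2)
proof (induction N rule: dec_induct)
  case (step n)
  have n: "n \<ge> 1" using step assms by simp
  have "harmonic_sum (Suc n) - harmonic_sum n = f (Suc n) / real (Suc n)" by (simp add: harmonic_sum_def atLeastAtMostSuc_conv)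
  also have "f (Suc n) = weight_sum (Suc n) - weight_sum n" by (simp add: weight_sum_def atLeastAtMostSuc_conv)
  also have "(weight_sum (Suc n) - weight_sum n) / real (Suc n) = weight_sum (Suc n) / real (Suc n) - weight_sum n / real n + weight_sum n / (real n * (real n + 1))"
  proof -
    have "1 / (real n * (real n + 1)) = 1 / real n - 1 / (real n + 1)" using n by (simp add: field_simps)
    hence "weight_sum n * (1 / (real n * (real n + 1))) = weight_sum n * (1 / real n) - weight_sum n * (1 / (real n + 1))"
      by (simp only: right_diff_distrib)
    thus ?thesis by (simp add: diff_divide_distrib add_ac)
  qed
  finally show ?case using step by simp
qed simp

text \<open>Partial summation, where \<open>weight_sum_ln_le\<close> bounds the mean value of f up
  to k by C F / ln M for M \<le> k \<le> N. Taking F at N instead of at k allows F to be factored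
  out of the sum.\<close>

lemma harmonic_sum_increment_le:
  obtains C where "C > 0" "\<And>M N. 2 \<le> M \<Longrightarrow> M \<le> N \<Longrightarrow> harmonic_sum N - harmonic_sum M \<le> C * harmonic_sum N * ((1 + ln (real N) - ln (real M)) / ln (real M))"
proof -
  obtain C where C: "C > 0" "\<And>N. N \<ge> 1 \<Longrightarrow> weight_sum N * ln (real N) \<le> C * real N * harmonic_sum N"
    using weight_sum_ln_le by blast
  show ?thesis
  proof (rule that[OF C(1)])
    fix M N :: nat assume MN: "2 \<le> M" "M \<le> N"
    have lM: "ln (real M) > 0" using MN by simp
    have F0: "harmonic_sum N \<ge> 0" using harmonic_sum_ge_1[of N] MN by simp
    have Sk: "weight_sum k / real k \<le> C * harmonic_sum N / ln (real M)" if "M \<le> k" "k \<le> N" for k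
    proof -
      have "weight_sum k * ln (real M) \<le> weight_sum k * ln (real k)" using that MN weight_sum_nonneg by (intro mult_left_mono) auto
      also have "\<dots> \<le> C * real k * harmonic_sum k" using C(2)[of k] that MN by simp
      also have "\<dots> \<le> C * real k * harmonic_sum N" using C(1) harmonic_sum_mono[OF that(2)] by (intro mult_left_mono) auto
      finally show ?thesis using lM that MN by (simp add: field_simps)
    qed
    have "harmonic_sum N - harmonic_sum M \<le> weight_sum N / real N + (\<Sum>k\<in>{M..<N}. weight_sum k / (real k * (real k + 1)))"
      using harmonic_sum_eq_partial_summation[of M N] MN weight_sum_nonneg[of M] by simp
    also have "\<dots> \<le> C * harmonic_sum N / ln (real M) + (\<Sum>k\<in>{M..<N}. C * harmonic_sum N / ln (real M) * (1 / (real k + 1)))"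
    proof (intro add_mono sum_mono Sk)
      fix k assume k: "k \<in> {M..<N}"
      have "weight_sum k / (real k * (real k + 1)) = weight_sum k / real k * (1 / (real k + 1))" by simp
      also have "\<dots> \<le> C * harmonic_sum N / ln (real M) * (1 / (real k + 1))"
        using k by (intro mult_right_mono Sk) auto
      finally show "weight_sum k / (real k * (real k + 1)) \<le> C * harmonic_sum N / ln (real M) * (1 / (real k + 1))" .
    qed (use MN in auto)
    also have "\<dots> = C * harmonic_sum N / ln (real M) * (1 + (\<Sum>k\<in>{M..<N}. 1 / (real k + 1)))"
      by (simp add: sum_distrib_left algebra_simps)
    also have "\<dots> \<le> C * harmonic_sum N / ln (real M) * (1 + (ln (real N) - ln (real M)))"
      using sum_recip_le_ln_diff[of M N] MN C(1) F0 lM by (intro mult_left_mono) auto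
    finally show "harmonic_sum N - harmonic_sum M \<le> C * harmonic_sum N * ((1 + ln (real N) - ln (real M)) / ln (real M))"
      by (simp add: algebra_simps)
  qed
qed

text \<open>For M = N^(1-\<delta>) the quotient ln(N/M) / ln M in the increment bound is of order
  \<delta>, and the additional 1 is absorbed for large N.\<close>

lemma harmonic_sum_tail_le:
  obtains C where "C > 0" "\<And>\<delta>. 0 < \<delta> \<Longrightarrow> \<delta> \<le> 1/4 \<Longrightarrow>
    eventually (\<lambda>N. harmonic_sum N - harmonic_sum (nat \<lfloor>real N powr (1 - \<delta>)\<rfloor>) \<le> C * \<delta> * harmonic_sum N) sequentially"
proof -
  obtain C where C: "C > 0" "\<And>M N. 2 \<le> M \<Longrightarrow> M \<le> N \<Longrightarrow> harmonic_sum N - harmonic_sum M \<le> C * harmonic_sum N * ((1 + ln (real N) - ln (real M)) / ln (real M))"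
    using harmonic_sum_increment_le by blast
  show ?thesis
  proof (rule that[of "3 * C"])
    show "3 * C > 0" using C by simp
    fix \<delta> :: real assume \<delta>: "0 < \<delta>" "\<delta> \<le> 1/4"
    \<comment> \<open>As \<delta> \<le> 1/4 gives X \<ge> N^(3/4), this keeps M \<ge> sqrt N after
      rounding down, and so ln M \<ge> (ln N)/2.\<close>
    have e1: "eventually (\<lambda>N. real N powr (3/4) - 1 \<ge> real N powr (1/2)) sequentially" by real_asymp
    have e2: "eventually (\<lambda>N. real N powr (1/2) \<ge> 3) sequentially" by real_asymp
    have e3: "eventually (\<lambda>N. ln (real N) \<ge> 4 / \<delta>) sequentially" by real_asymp
    have e4: "eventually (\<lambda>N. N \<ge> 2) sequentially" by (rule eventually_ge_at_top)
    show "eventually (\<lambda>N. harmonic_sum N - harmonic_sum (nat \<lfloor>real N powr (1 - \<delta>)\<rfloor>) \<le> 3 * C * \<delta> * harmonic_sum N) sequentially"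
      using e1 e2 e3 e4
    proof eventually_elim
      case (elim N)
      define X where "X = real N powr (1 - \<delta>)"
      define M where "M = nat \<lfloor>X\<rfloor>"
      have lN: "ln (real N) > 0" using elim by simp
      have X1: "X \<ge> real N powr (3/4)" unfolding X_def using \<delta> elim by (intro powr_mono) auto
      have XM: "X - 1 \<le> real M" "real M \<le> X" using X1 elim(1,2) by (auto simp: M_def)
      have "X \<le> real N powr 1" unfolding X_def using \<delta> elim by (intro powr_mono) auto
      hence MN: "M \<le> N" using XM by simp
      have M1: "real M \<ge> real N powr (1/2)" using XM X1 elim(1) by linarith
      have M2: "2 \<le> M" using M1 elim(2) by linarith
      have "ln (real M) \<ge> ln (real N powr (1/2))" using M1 elim M2 by (subst ln_le_cancel_iff) auto
      hence lM: "ln (real M) \<ge> ln (real N) / 2" using elim(4) by (simp add: ln_powr)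
      have "real M \<ge> X / 2" using XM X1 elim(1,2) by linarith
      hence "ln (real M) \<ge> ln (X / 2)" using M2 elim(4) by (subst ln_le_cancel_iff) (auto simp: X_def)
      also have "ln (X / 2) = (1 - \<delta>) * ln (real N) - ln 2"
        using elim(4) by (simp add: X_def ln_divide_pos ln_powr)
      finally have d: "1 + ln (real N) - ln (real M) \<le> 2 + \<delta> * ln (real N)"
        using ln_2_less_1 by (simp add: algebra_simps)
      have "(1 + ln (real N) - ln (real M)) / ln (real M) \<le> (2 + \<delta> * ln (real N)) / (ln (real N) / 2)"
        using d lM lN \<delta> by (intro frac_le) auto
      also have "\<dots> = 4 / ln (real N) + 2 * \<delta>" using lN by (simp add: field_simps)
      also have "4 / ln (real N) \<le> \<delta>" using elim(3) lN \<delta> by (simp add: field_simps)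
      finally have "(1 + ln (real N) - ln (real M)) / ln (real M) \<le> 3 * \<delta>" by simp
      hence "C * harmonic_sum N * ((1 + ln (real N) - ln (real M)) / ln (real M)) \<le> C * harmonic_sum N * (3 * \<delta>)"
        using C(1) harmonic_sum_ge_1[of N] elim(4) by (intro mult_left_mono mult_nonneg_nonneg) auto
      with C(2)[OF M2 MN] show ?case unfolding M_def X_def by (simp add: mult_ac)
    qed
  qed
qed


text \<open>The price of imposing that p does not divide m in lower bounds: it is only logarithmic
  in m.\<close>

lemma sum_f_ln_prime_factors_le:
  assumes "m \<ge> 1"
  shows "(\<Sum>p\<in>prime_factors m. f p * ln (real p)) \<le> A1 * ln (real m)"
proof -
  have "(\<Sum>p\<in>prime_factors m. f p * ln (real p)) \<le> (\<Sum>p\<in>prime_factors m. A1 * (real (multiplicity p m) * ln (real p)))"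
  proof (rule sum_mono)
    fix p assume p: "p \<in> prime_factors m"
    hence pp: "prime p" "p dvd m" by (auto simp: in_prime_factors_iff)
    have l: "ln (real p) \<ge> 0" using prime_ge_1_nat[OF pp(1)] by simp
    have "multiplicity p m > 0" using pp assms by (subst prime_multiplicity_gt_zero_iff) auto
    hence "1 * ln (real p) \<le> real (multiplicity p m) * ln (real p)" using l by (intro mult_right_mono) linarith+
    hence "f p * ln (real p) \<le> A1 * (1 * ln (real p))" "A1 * (1 * ln (real p)) \<le> A1 * (real (multiplicity p m) * ln (real p))"
      using f_prime_le[OF pp(1)] l A1_pos mult_left_mono[of _ _ A1] by (auto intro: mult_right_mono)
    thus "f p * ln (real p) \<le> A1 * (real (multiplicity p m) * ln (real p))" by linarith
  qed
  also have "\<dots> = A1 * (\<Sum>p\<in>prime_factors m. real (multiplicity p m) * ln (real p))" by (simp only: sum_distrib_left)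
  also have "\<dots> = A1 * ln (real m)"
    using ln_prime_factorization[of m] assms by simp
  finally show ?thesis .
qed

end

section \<open>Lower bounds from the values of f on the primes\<close>

locale dense_arith_weight = arith_weight +
  fixes B :: real
  assumes B_pos: "B > 0"
    and sum_f_primes_ge: "eventually (\<lambda>n. (\<Sum>p\<in>primes_upto n. f p) \<ge> B * (real n / ln (2 * real n))) sequentially"
begin

text \<open>Primes up to sqrt n contribute at most A1 sqrt n to the hypothesis, and all others have
  ln p \<ge> (ln n)/2. With ln(2n) \<le> 2 ln n this gives B/4; half of it pays for the small
  primes.\<close>

lemma sum_f_ln_primes_ge:
  obtains b where "b > 0" "eventually (\<lambda>n. (\<Sum>p\<in>primes_upto n. f p * ln (real p)) \<ge> b * real n) sequentially"
proof (rule that[of "B / 8"])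
  show "B / 8 > 0" using B_pos by simp
  have "((\<lambda>n. A1 * sqrt (real n) * ln (real n) / 2 / real n) \<longlongrightarrow> 0) sequentially" by real_asymp
  hence e1: "eventually (\<lambda>n. A1 * sqrt (real n) * ln (real n) / 2 / real n < B / 8) sequentially"
    using B_pos by (intro order_tendstoD(2)) auto
  show "eventually (\<lambda>n. (\<Sum>p\<in>primes_upto n. f p * ln (real p)) \<ge> B / 8 * real n) sequentially"
    using sum_f_primes_ge e1 eventually_ge_at_top[of 2]
  proof eventually_elim
    case (elim n)
    define y where "y = nat \<lfloor>sqrt (real n)\<rfloor>"
    have ln0: "ln (real n) > 0" using elim(3) by simp
    have yn: "real y \<le> sqrt (real n)" by (simp add: y_def)
    have pf0: "f p \<ge> 0" "ln (real p) \<ge> 0" if "p \<in> primes_upto n" for p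
      using that by (auto simp: primes_upto_def Suc_le_eq prime_gt_0_nat intro: f_nonneg)
    have "(\<Sum>p\<in>primes_upto y. f p) \<le> (\<Sum>p\<in>primes_upto y. A1)"
      by (intro sum_mono f_prime_le) (auto simp: primes_upto_def)
    also have "\<dots> = A1 * real (card (primes_upto y))" by simp
    also have "\<dots> \<le> A1 * sqrt (real n)"
      using A1_pos card_primes_upto_le[of y] yn by (intro mult_left_mono) auto
    finally have small: "(\<Sum>p\<in>primes_upto y. f p) \<le> A1 * sqrt (real n)" .
    have "real n \<le> real n * real n" using elim(3) by simp
    hence "sqrt (real n) \<le> real n" by (simp add: real_le_lsqrt power2_eq_square)
    hence "y \<le> n" using yn by linarith
    hence "(\<Sum>p\<in>primes_upto n. f p) = (\<Sum>p\<in>primes_upto n - primes_upto y. f p) + (\<Sum>p\<in>primes_upto y. f p)"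
      by (intro sum.subset_diff primes_upto_mono) auto
    hence large: "(\<Sum>p\<in>primes_upto n - primes_upto y. f p) \<ge> B * (real n / ln (2 * real n)) - A1 * sqrt (real n)"
      using elim(1) small by linarith
    have "ln (2 * real n) = ln 2 + ln (real n)" using elim(3) by (subst ln_mult) auto
    also have "\<dots> \<le> 2 * ln (real n)" using elim(3) by simp
    finally have l2: "ln (2 * real n) \<le> 2 * ln (real n)" .
    have "B * (real n / (2 * ln (real n))) \<le> B * (real n / ln (2 * real n))"
      using l2 ln0 elim(3) B_pos by (intro mult_left_mono divide_left_mono mult_pos_pos) auto
    with large have "B * (real n / (2 * ln (real n))) - A1 * sqrt (real n) \<le> (\<Sum>p\<in>primes_upto n - primes_upto y. f p)" by linarith
    hence "(B * (real n / (2 * ln (real n))) - A1 * sqrt (real n)) * (ln (real n) / 2) \<le> (\<Sum>p\<in>primes_upto n - primes_upto y. f p) * (ln (real n) / 2)"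
      using ln0 by (intro mult_right_mono) auto
    moreover have "(B * (real n / (2 * ln (real n))) - A1 * sqrt (real n)) * (ln (real n) / 2) = 2 * (B / 8 * real n) - A1 * sqrt (real n) * ln (real n) / 2"
      using ln0 by (simp add: field_simps)
    moreover have "A1 * sqrt (real n) * ln (real n) / 2 \<le> B / 8 * real n"
      using elim(2,3) by (simp add: field_simps)
    moreover have "Y \<le> W" if "X \<le> W" "X = 2 * Y - E" "E \<le> Y" for X Y W E :: real using that by linarith
    ultimately have "B / 8 * real n \<le> (\<Sum>p\<in>primes_upto n - primes_upto y. f p) * (ln (real n) / 2)" by blast
    also have "\<dots> = (\<Sum>p\<in>primes_upto n - primes_upto y. f p * (ln (real n) / 2))" by (simp only: sum_distrib_right)
    also have "\<dots> \<le> (\<Sum>p\<in>primes_upto n - primes_upto y. f p * ln (real p))"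
    proof (intro sum_mono mult_left_mono pf0)
      fix p assume p: "p \<in> primes_upto n - primes_upto y"
      hence "p > y" by (auto simp: primes_upto_def)
      hence "real p \<ge> sqrt (real n)" unfolding y_def by linarith
      hence "ln (real p) \<ge> ln (sqrt (real n))" using elim(3) by (subst ln_le_cancel_iff) (use \<open>p > y\<close> in auto)
      thus "ln (real n) / 2 \<le> ln (real p)" using elim(3) by (simp add: ln_sqrt)
    qed auto
    also have "\<dots> \<le> (\<Sum>p\<in>primes_upto n. f p * ln (real p))"
      using pf0 by (intro sum_mono2) auto
    finally show ?case .
  qed
qed

text \<open>Only m \<le> N^(1-\<delta>) are used: for these N/m is large enough for the bound on
  primes, and \<delta> is so small that they still carry half of the harmonic sum.\<close>

lemma weight_sum_ln_ge:
  obtains c where "c > 0" "eventually (\<lambda>N. weight_sum N * ln (real N) \<ge> c * real N * harmonic_sum N) sequentially"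
proof -
  obtain b where b: "b > 0" "eventually (\<lambda>n. (\<Sum>p\<in>primes_upto n. f p * ln (real p)) \<ge> b * real n) sequentially"
    using sum_f_ln_primes_ge by blast
  then obtain t0 where t0: "\<And>n. n \<ge> t0 \<Longrightarrow> (\<Sum>p\<in>primes_upto n. f p * ln (real p)) \<ge> b * real n"
    unfolding eventually_sequentially by blast
  obtain C where C: "C > 0" "\<And>\<delta>. 0 < \<delta> \<Longrightarrow> \<delta> \<le> 1/4 \<Longrightarrow>
    eventually (\<lambda>N. harmonic_sum N - harmonic_sum (nat \<lfloor>real N powr (1 - \<delta>)\<rfloor>) \<le> C * \<delta> * harmonic_sum N) sequentially"
    using harmonic_sum_tail_le by blast
  define \<delta> where "\<delta> = min (1/4) (1 / (2 * C))"
  have \<delta>: "0 < \<delta>" "\<delta> \<le> 1/4" "C * \<delta> \<le> 1/2"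
    using C(1) by (auto simp: \<delta>_def min_def field_simps)
  have "((\<lambda>N. A1 * ln (real N) / real N powr \<delta>) \<longlongrightarrow> 0) sequentially" using \<delta>(1) by real_asymp
  hence e1: "eventually (\<lambda>N. A1 * ln (real N) / real N powr \<delta> < b / 4) sequentially"
    using b(1) by (intro order_tendstoD(2)) auto
  have e2: "eventually (\<lambda>N. real N powr \<delta> \<ge> 2 * real t0) sequentially" using \<delta>(1) by real_asymp
  show ?thesis
  proof (rule that[of "b / 8"])
    show "b / 8 > 0" using b by simp
    show "eventually (\<lambda>N. weight_sum N * ln (real N) \<ge> b / 8 * real N * harmonic_sum N) sequentially"
      using C(2)[OF \<delta>(1,2)] e1 e2 eventually_ge_at_top[of 2]
    proof eventually_elim
      case (elim N)
      define M where "M = nat \<lfloor>real N powr (1 - \<delta>)\<rfloor>"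
      have "real N powr (1 - \<delta>) \<le> real N powr 1" using \<delta> elim(4) by (intro powr_mono) auto
      hence MN: "M \<le> N" using elim(4) by (simp add: M_def nat_le_iff floor_le_iff)
      have "C * \<delta> * harmonic_sum N \<le> 1/2 * harmonic_sum N" using \<delta>(3) harmonic_sum_ge_1[of N] elim(4) by (intro mult_right_mono) auto
      hence FM: "harmonic_sum M \<ge> harmonic_sum N / 2" using elim(1) unfolding M_def by linarith
      \<comment> \<open>Rounding N/m down to T \<ge> 1 loses at most a factor 2; half of what
        remains is given up for the primes dividing m.\<close>
      have each: "b / 4 * (real N / real m) \<le> (\<Sum>p | p \<in> primes_upto (N div m) \<and> \<not> p dvd m. f p * ln (real p))"
        if m: "m \<in> {1..M}" for m
      proof -
        define T where "T = N div m"
        have "real m \<le> real N powr (1 - \<delta>)" using m unfolding M_def by (simp add: le_nat_iff le_floor_iff)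
        hence "real N powr \<delta> * real m \<le> real N powr \<delta> * real N powr (1 - \<delta>)" by (intro mult_left_mono) auto
        also have "\<dots> = real N" using elim(4) by (simp add: powr_add[symmetric])
        finally have Nm: "real N powr \<delta> \<le> real N / real m" using m by (simp add: field_simps)
        have "real N / real m - 1 \<le> real T" unfolding T_def by (rule real_div_minus_one_le)
        moreover have "1 \<le> T" using m MN unfolding T_def by (simp add: less_eq_div_iff_mult_less_eq)
        hence "1 \<le> real T" by simp
        moreover have halve: "x / 2 \<le> t" if "x - 1 \<le> t" "1 \<le> t" for x t :: real using that by linarith
        ultimately have T: "real T \<ge> real N / real m / 2" by blast
        have "s \<le> t" if "x / 2 \<le> t" "d \<le> x" "2 * s \<le> d" for s t x d :: real using that by linarith
        hence "real T \<ge> real t0" using T Nm elim(3) by blast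
        hence "T \<ge> t0" by simp
        hence "b * real T \<le> (\<Sum>p\<in>primes_upto T. f p * ln (real p))" by (rule t0)
        also have "\<dots> \<le> (\<Sum>p\<in>{p. p \<in> primes_upto T \<and> \<not> p dvd m} \<union> prime_factors m. f p * ln (real p))"
          using m by (intro sum_mono2) (auto simp: primes_upto_def in_prime_factors_iff Suc_le_eq prime_gt_0_nat intro!: mult_nonneg_nonneg f_nonneg)
        also have "\<dots> = (\<Sum>p | p \<in> primes_upto T \<and> \<not> p dvd m. f p * ln (real p)) + (\<Sum>p\<in>prime_factors m. f p * ln (real p))"
          by (intro sum.union_disjoint) (auto simp: in_prime_factors_iff)
        also have "(\<Sum>p\<in>prime_factors m. f p * ln (real p)) \<le> A1 * ln (real m)"
          using m by (intro sum_f_ln_prime_factors_le) auto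
        also have "\<dots> \<le> A1 * ln (real N)" using m MN A1_pos by (intro mult_left_mono) auto
        also have "\<dots> \<le> b / 4 * real N powr \<delta>" using elim(2,4) by (simp add: field_simps)
        also have "\<dots> \<le> b / 4 * (real N / real m)" using Nm b(1) by (intro mult_left_mono) auto
        finally have "b * real T \<le> (\<Sum>p | p \<in> primes_upto T \<and> \<not> p dvd m. f p * ln (real p)) + b / 4 * (real N / real m)"
          by simp
        moreover have "b * (real N / real m / 2) \<le> b * real T" using T b(1) by (intro mult_left_mono) auto
        ultimately show ?thesis unfolding T_def by simp
      qed
      have "b / 4 * real N * harmonic_sum M = (\<Sum>m\<in>{1..M}. f m * (b / 4 * (real N / real m)))"
        unfolding harmonic_sum_def sum_distrib_left by (intro sum.cong refl) simp
      also have "\<dots> \<le> (\<Sum>m\<in>{1..M}. f m * (\<Sum>p | p \<in> primes_upto (N div m) \<and> \<not> p dvd m. f p * ln (real p)))"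
        using each by (intro sum_mono mult_left_mono f_nonneg) auto
      also have "\<dots> \<le> (\<Sum>m\<in>{1..N}. f m * (\<Sum>p | p \<in> primes_upto (N div m) \<and> \<not> p dvd m. f p * ln (real p)))"
        using MN by (intro sum_mono2) (auto simp: primes_upto_def Suc_le_eq prime_gt_0_nat intro!: mult_nonneg_nonneg f_nonneg sum_nonneg)
      also have "\<dots> \<le> (\<Sum>n\<in>{1..N}. f n * ln (real n))" by (rule sum_f_ln_ge)
      also have "\<dots> \<le> (\<Sum>n\<in>{1..N}. f n * ln (real N))"
        by (intro sum_mono mult_left_mono f_nonneg) auto
      also have "\<dots> = weight_sum N * ln (real N)" by (simp only: weight_sum_def sum_distrib_right)
      finally have "b / 4 * real N * harmonic_sum M \<le> weight_sum N * ln (real N)" .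
      moreover have "b / 4 * real N * (harmonic_sum N / 2) \<le> b / 4 * real N * harmonic_sum M" using FM b(1) by (intro mult_left_mono) auto
      ultimately show ?case by simp
    qed
  qed
qed

text \<open>The sum of f(p)/p alone grows at least like (B/2) log log N. Divergence makes the
  cofactor m = 1 negligible, that is the prime values n, for which s(n) = 1.\<close>

lemma harmonic_sum_at_top: "filterlim harmonic_sum at_top sequentially"
proof -
  obtain n1 where n1: "\<And>n. n \<ge> n1 \<Longrightarrow> (\<Sum>p\<in>primes_upto n. f p) \<ge> B * (real n / ln (2 * real n))"
    using sum_f_primes_ge unfolding eventually_sequentially by blast
  define n0 where "n0 = max n1 2"
  define Q where "Q = (\<lambda>n. \<Sum>p\<in>primes_upto n. f p)"
  define R where "R = (\<lambda>n. \<Sum>p\<in>primes_upto n. f p / real p)"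
  define g where "g = (\<lambda>n. ln (ln (2 * real n)))"
  have Q: "Q n \<ge> B * (real n / ln (2 * real n))" if "n \<ge> n0" for n using n1 that by (auto simp: Q_def n0_def)
  \<comment> \<open>Passing from n to n + 1 adds Q(n)/(n (n + 1)) to the left side, since a new
    prime cancels out of the difference. The factor 1/2 comes from n + 1 \<le> 2n.\<close>
  have "R N - Q N / real N \<ge> B / 2 * (g N - g n0)" if "N \<ge> n0" for N
    using that
  proof (induction N rule: dec_induct)
    case base
    have "Q n0 / real n0 = (\<Sum>p\<in>primes_upto n0. f p / real n0)" by (simp add: Q_def sum_divide_distrib)
    also have "\<dots> \<le> R n0" unfolding R_def
      by (intro sum_mono divide_left_mono f_nonneg mult_pos_pos) (auto simp: primes_upto_def prime_gt_0_nat n0_def)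
    finally show ?case by simp
  next
    case (step n)
    have n: "n \<ge> 2" using step by (simp add: n0_def)
    have eq: "R (Suc n) - Q (Suc n) / real (Suc n) = R n - Q n / real (Suc n)"
    proof (cases "prime (Suc n)")
      case True
      have "Suc n \<notin> primes_upto n" by (simp add: primes_upto_def)
      thus ?thesis using True by (simp add: R_def Q_def primes_upto_Suc add_divide_distrib del: of_nat_Suc)
    qed (simp add: R_def Q_def primes_upto_Suc)
    define u v where "u = ln (2 * real n)" and "v = ln (2 * real (Suc n))"
    have u: "u > 0" using n by (simp add: u_def)
    have uv: "u < v" unfolding u_def v_def using n by simp
    have "v - u = ln (1 + 1 / real n)"
      unfolding u_def v_def using n by (subst ln_divide_pos[symmetric]) (auto simp: field_simps)
    also have "\<dots> \<le> 1 / real n" by (rule ln_add_one_self_le_self) simp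
    finally have vu: "v - u \<le> 1 / real n" .
    have "g (Suc n) - g n = ln (v / u)" using u uv by (simp add: g_def u_def v_def ln_divide_pos)
    also have "\<dots> \<le> v / u - 1" using u uv by (intro ln_le_minus_one) auto
    also have "\<dots> = (v - u) / u" using u by (simp add: field_simps)
    also have "\<dots> \<le> (1 / real n) / u" using vu u by (intro divide_right_mono) auto
    finally have g: "g (Suc n) - g n \<le> 1 / (real n * u)" by simp
    have "B / 2 * (g (Suc n) - g n) \<le> B / 2 * (1 / (real n * u))" using g B_pos by (intro mult_left_mono) auto
    also have "\<dots> = B * (real n / u) * (1 / (2 * real n * real n))" using n u by (simp add: field_simps)
    also have "\<dots> \<le> B * (real n / u) * (1 / (real n * real (Suc n)))"
    proof (intro mult_left_mono divide_left_mono)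
      have "real n * real (Suc n) \<le> real n * (2 * real n)" using n by (intro mult_left_mono) auto
      thus "real n * real (Suc n) \<le> 2 * real n * real n" by simp
      have "0 < real n" using n by simp
      thus "0 < 2 * real n * real n * (real n * real (Suc n))" by (intro mult_pos_pos) auto
    qed (use n u B_pos in auto)
    also have "\<dots> \<le> Q n * (1 / (real n * real (Suc n)))"
      using Q[of n] step by (intro mult_right_mono) (auto simp: u_def)
    also have "\<dots> = Q n / real n - Q n / real (Suc n)"
    proof -
      have "1 / (real n * real (Suc n)) = 1 / real n - 1 / real (Suc n)" using n by (simp add: field_simps)
      hence "Q n * (1 / (real n * real (Suc n))) = Q n * (1 / real n) - Q n * (1 / real (Suc n))"
        by (simp only: right_diff_distrib)
      thus ?thesis by simp
    qed
    finally have "B / 2 * (g (Suc n) - g n) \<le> Q n / real n - Q n / real (Suc n)" .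
    hence "B / 2 * (g n - g n0) + (B / 2 * (g (Suc n) - g n)) \<le> R (Suc n) - Q (Suc n) / real (Suc n)"
      using step.IH eq by linarith
    moreover have "B / 2 * (g n - g n0) + (B / 2 * (g (Suc n) - g n)) = B / 2 * (g (Suc n) - g n0)"
      by (simp only: distrib_left[symmetric]) simp
    ultimately show ?case by (simp only:)
  qed
  moreover have "R N \<le> harmonic_sum N" for N
    unfolding R_def harmonic_sum_def by (intro sum_mono2) (auto simp: primes_upto_def Suc_le_eq prime_gt_0_nat intro!: f_nonneg divide_nonneg_nonneg)
  moreover have "Q N / real N \<ge> 0" for N
    unfolding Q_def by (intro divide_nonneg_nonneg sum_nonneg f_nonneg) (auto simp: primes_upto_def prime_gt_0_nat)
  ultimately have "harmonic_sum N \<ge> B / 2 * (g N - g n0)" if "N \<ge> n0" for N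
    using that by (smt (verit))
  hence "eventually (\<lambda>N. harmonic_sum N \<ge> B / 2 * (g N - g n0)) sequentially"
    unfolding eventually_sequentially by blast
  moreover have "filterlim (\<lambda>N. B / 2 * (ln (ln (2 * real N)) - g n0)) at_top sequentially"
    using B_pos by real_asymp
  hence "filterlim (\<lambda>N. B / 2 * (g N - g n0)) at_top sequentially" by (simp only: g_def)
  ultimately show ?thesis by (rule filterlim_at_top_mono[rotated])
qed

end

section \<open>The sum of proper divisors\<close>

definition divisor_sum :: "nat \<Rightarrow> nat" where
  "divisor_sum m = (\<Sum>d | d dvd m. d)"

lemma aliquot_add_self: "m > 0 \<Longrightarrow> aliquot m + m = divisor_sum m"
proof -
  assume m: "m > 0"
  have "{d. d dvd m} = insert m {d. d dvd m \<and> d < m}"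
    using m by (auto dest: dvd_imp_le simp: le_less)
  thus ?thesis using m by (simp add: divisor_sum_def aliquot_def)
qed

lemma divisor_sum_pos: "m > 0 \<Longrightarrow> divisor_sum m > 0"
  using aliquot_add_self[of m] by linarith

text \<open>Crude on purpose: only the logarithm of this bound matters later.\<close>

lemma divisor_sum_le: "m > 0 \<Longrightarrow> divisor_sum m \<le> m\<^sup>2"
proof -
  assume m: "m > 0"
  have "divisor_sum m \<le> (\<Sum>d\<in>{1..m}. d)"
    unfolding divisor_sum_def using m by (intro sum_mono2) (auto simp: Suc_le_eq dest: dvd_imp_le intro: Nat.gr0I)
  also have "\<dots> \<le> (\<Sum>d\<in>{1..m}. m)" by (intro sum_mono) auto
  finally show ?thesis by (simp add: power2_eq_square)
qed

lemma aliquot_le: "n > 0 \<Longrightarrow> aliquot n \<le> n\<^sup>2"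
  using aliquot_add_self[of n] divisor_sum_le[of n] by linarith

lemma aliquot_pos: "m \<ge> 2 \<Longrightarrow> aliquot m > 0"
proof -
  assume m: "m \<ge> 2"
  have "(\<Sum>d\<in>{1}. d) \<le> aliquot m"
    unfolding aliquot_def using m by (intro sum_mono2) auto
  thus ?thesis by simp
qed

lemma divisor_sum_mult_prime:
  assumes "prime p" "\<not> p dvd m" "m > 0"
  shows "divisor_sum (m * p) = divisor_sum m * (p + 1)"
proof -
  have p0: "p > 0" using assms(1) by (simp add: prime_gt_0_nat)
  have eq: "{d. d dvd m * p} = {d. d dvd m} \<union> (\<lambda>d. d * p) ` {d. d dvd m}"
  proof (intro equalityI subsetI)
    fix d assume "d \<in> {d. d dvd m * p}"
    then obtain x y where xy: "d = x * y" "x dvd m" "y dvd p" using division_decomp[of d m p] by auto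
    have "y = 1 \<or> y = p" using xy(3) assms(1) by (auto simp: prime_nat_iff)
    thus "d \<in> {d. d dvd m} \<union> (\<lambda>d. d * p) ` {d. d dvd m}" using xy by auto
  next
    fix d assume "d \<in> {d. d dvd m} \<union> (\<lambda>d. d * p) ` {d. d dvd m}"
    thus "d \<in> {d. d dvd m * p}" by (elim UnE imageE) simp_all
  qed
  have "divisor_sum (m * p) = (\<Sum>d | d dvd m. d) + (\<Sum>d\<in>(\<lambda>d. d * p) ` {d. d dvd m}. d)"
    unfolding divisor_sum_def eq
  proof (intro sum.union_disjoint)
    have "\<not> d * p dvd m" for d using assms(2) by (meson dvd_mult_right)
    thus "{d. d dvd m} \<inter> (\<lambda>d. d * p) ` {d. d dvd m} = {}" by blast
  qed (use assms(3) in auto)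
  also have "(\<Sum>d\<in>(\<lambda>d. d * p) ` {d. d dvd m}. d) = (\<Sum>d | d dvd m. d * p)"
    using p0 by (subst sum.reindex) (auto simp: inj_on_def)
  also have "\<dots> = (\<Sum>d | d dvd m. d) * p" by (simp only: sum_distrib_right)
  finally show ?thesis by (simp add: divisor_sum_def)
qed

lemma aliquot_mult_prime:
  assumes "prime p" "\<not> p dvd m" "m > 0"
  shows "aliquot (m * p) = aliquot m * p + divisor_sum m"
proof -
  have "m * p > 0" using assms by (simp add: prime_gt_0_nat)
  hence "aliquot (m * p) + m * p = divisor_sum m * (p + 1)"
    using aliquot_add_self divisor_sum_mult_prime[OF assms] by simp
  also have "\<dots> = (aliquot m + m) * p + divisor_sum m" using aliquot_add_self[OF assms(3)] by simp
  finally show ?thesis by (simp add: algebra_simps)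
qed

text \<open>If q does not divide m, the divisors of m q^k prime to q are exactly those of m, and all
  others vanish modulo q; so sigma(m q^k) and sigma(m) agree modulo q.\<close>

lemma prime_dvd_divisor_sum_mult_power:
  assumes "prime q" "m > 0" "q dvd divisor_sum (m * q ^ k)"
  shows "q dvd divisor_sum m \<or> q dvd m"
proof (cases "q dvd m")
  case False
  have q0: "m * q ^ k > 0" using assms by (simp add: prime_gt_0_nat)
  have eq: "{d. d dvd m * q ^ k} = {d. d dvd m} \<union> {d. d dvd m * q ^ k \<and> q dvd d}"
  proof (intro equalityI subsetI)
    fix d assume d: "d \<in> {d. d dvd m * q ^ k}"
    have "d dvd m" if "\<not> q dvd d"
    proof -
      have "coprime d (q ^ k)" using that assms(1) by (metis coprime_commute coprime_power_left_iff prime_imp_coprime)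
      thus ?thesis using d by (simp add: coprime_dvd_mult_left_iff)
    qed
    thus "d \<in> {d. d dvd m} \<union> {d. d dvd m * q ^ k \<and> q dvd d}" using d by blast
  qed auto
  have "divisor_sum (m * q ^ k) = divisor_sum m + (\<Sum>d | d dvd m * q ^ k \<and> q dvd d. d)"
    unfolding divisor_sum_def
  proof (subst eq, intro sum.union_disjoint)
    show "{d. d dvd m} \<inter> {d. d dvd m * q ^ k \<and> q dvd d} = {}" using False by (auto intro: dvd_trans)
  qed (use assms q0 in auto)
  moreover have "q dvd (\<Sum>d | d dvd m * q ^ k \<and> q dvd d. d)" by (intro dvd_sum) auto
  ultimately show ?thesis using assms(3) by (metis dvd_add_left_iff)
qed simp

text \<open>A prime q dividing s(m) p + sigma(m) is of one of four kinds: counted by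
  \<open>w\<close>; a divisor of s(m), hence also of sigma(m) and of m = sigma(m) - s(m); equal to
  p, if it divides sigma(m) but not s(m); or larger than z, of which there are at most log s(m p) /
  log(z + 1).\<close>

lemma omega_linear_bounds:
  fixes m p z :: nat
  assumes m: "m \<ge> 2" and p: "prime p" "\<not> p dvd m" and z: "z \<ge> 1"
  defines "P \<equiv> {q\<in>primes_upto z. \<not> q dvd aliquot m \<and> \<not> q dvd divisor_sum m}"
  defines "w \<equiv> card {q\<in>P. q dvd aliquot m * p + divisor_sum m}"
  shows "w \<le> omega (aliquot (m * p))"
    and "real (omega (aliquot (m * p))) \<le> real w + real (card {q\<in>prime_factors m. q dvd divisor_sum m}) + 1
      + ln (real (aliquot (m * p))) / ln (real z + 1)"
proof -
  let ?a = "aliquot m" and ?b = "divisor_sum m"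
  let ?n = "?a * p + ?b"
  have m0: "m > 0" using m by simp
  have n: "aliquot (m * p) = ?n" by (rule aliquot_mult_prime[OF p m0])
  have n0: "?n > 0" using divisor_sum_pos[OF m0] by simp
  let ?W = "{q\<in>P. q dvd ?n}" and ?D = "{q\<in>prime_factors m. q dvd ?b}" and ?L = "{q\<in>prime_factors ?n. q > z}"
  have finW: "finite ?W" by (simp add: P_def)
  have "?W \<subseteq> prime_factors ?n" using n0 by (auto simp: P_def primes_upto_def in_prime_factors_iff)
  thus "w \<le> omega (aliquot (m * p))" unfolding w_def omega_def n by (intro card_mono) auto
  have sub: "prime_factors ?n \<subseteq> ((?W \<union> ?D) \<union> {p}) \<union> ?L"
  proof
    fix q assume q: "q \<in> prime_factors ?n"
    hence qp: "prime q" "q dvd ?n" by (auto simp: in_prime_factors_iff)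
    show "q \<in> ((?W \<union> ?D) \<union> {p}) \<union> ?L"
    proof (cases "q > z \<or> (\<not> q dvd ?a \<and> \<not> q dvd ?b)")
      case True
      thus ?thesis using q qp by (auto simp: P_def primes_upto_def)
    next
      case False
      have *: "q \<in> ?D" if "q dvd ?a" "q dvd ?b"
      proof -
        have "q dvd m" using that aliquot_add_self[OF m0] by (metis dvd_add_right_iff)
        thus ?thesis using qp(1) that m0 by (auto simp: in_prime_factors_iff)
      qed
      show ?thesis
      proof (cases "q dvd ?a")
        case True
        hence "q dvd ?b" using qp(2) by (metis dvd_add_right_iff dvd_mult2)
        thus ?thesis using * True by blast
      next
        case na: False
        hence b: "q dvd ?b" using False by blast
        hence "q dvd ?a * p" using qp(2) by (metis dvd_add_left_iff)
        hence "q dvd p" using na qp(1) prime_dvd_multD by blast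
        hence "q = p" using qp(1) p(1) by (metis primes_dvd_imp_eq)
        thus ?thesis by blast
      qed
    qed
  qed
  have "omega (aliquot (m * p)) \<le> card (((?W \<union> ?D) \<union> {p}) \<union> ?L)"
    unfolding omega_def n using finW by (intro card_mono[OF _ sub]) auto
  also have "\<dots> \<le> card ((?W \<union> ?D) \<union> {p}) + card ?L" by (rule card_Un_le)
  also have "card ((?W \<union> ?D) \<union> {p}) \<le> card (?W \<union> ?D) + card {p}" by (rule card_Un_le)
  also have "card (?W \<union> ?D) \<le> card ?W + card ?D" by (rule card_Un_le)
  finally have 1: "omega (aliquot (m * p)) \<le> w + card ?D + 1 + card ?L" by (simp add: w_def)
  have "real (card ?L) * ln (real z + 1) \<le> ln (real ?n)"
    using n0 by (intro card_primes_dvd_le) (auto simp: in_prime_factors_iff)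
  hence 2: "real (card ?L) \<le> ln (real (aliquot (m * p))) / ln (real z + 1)"
    using z n by (simp add: field_simps)
  have "real (omega (aliquot (m * p))) \<le> real (w + card ?D + 1 + card ?L)" using 1 by (rule of_nat_mono)
  thus "real (omega (aliquot (m * p))) \<le> real w + real (card ?D) + 1 + ln (real (aliquot (m * p))) / ln (real z + 1)"
    using 2 by simp
qed

section \<open>Primes dividing both m and sigma(m), on average\<close>

context arith_weight begin

text \<open>If a prime $q$ divides both $m = q^k y$ and $\<sigma>(m)$, where $q \nmid y$, then it divides $\<sigma>(y)$, because
  $\<sigma>(q^k) \equiv 1$ modulo $q$; hence the factor $q^k$ only costs a factor $O(1/q)$.\<close>

lemma sum_common_primes_le:
  obtains K C where "K > 0" "C \<ge> 0"
    "\<And>N. N \<ge> 16 \<Longrightarrow> (\<Sum>m\<in>{1..N}. f m / real m * real (card {q\<in>prime_factors m. q dvd divisor_sum m}))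
      \<le> K * (ln (ln (ln (real N))) + C) * harmonic_sum N"
proof -
  obtain K where K: "K > 0" "\<And>q J. prime q \<Longrightarrow> (\<Sum>j\<in>{1..J}. f (q ^ j) / real (q ^ j)) \<le> K / real q"
    using sum_prime_power_ratio_le by blast
  obtain C :: real where C: "C \<ge> 0"
    "\<And>N a. N \<ge> 16 \<Longrightarrow> a > 0 \<Longrightarrow> a \<le> N\<^sup>2 \<Longrightarrow> (\<Sum>q\<in>prime_factors a. 1 / real q) \<le> ln (ln (ln (real N))) + C"
    using sum_inverse_prime_factors_le by blast
  show ?thesis
  proof (rule that[OF K(1) C(1)])
    fix N :: nat assume N: "N \<ge> 16"
    define Z where "Z = (SIGMA m:{1..N}. {q\<in>prime_factors m. q dvd divisor_sum m})"
    \<comment> \<open>Triples (y, q, k) standing for m = y q^k. The condition on q now concerns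
      sigma(y) only, so the sum over k is free.\<close>
    define U where "U = (SIGMA y:{1..N}. prime_factors (divisor_sum y) \<times> {1..N})"
    let ?g = "\<lambda>y. case y of (y, x) \<Rightarrow> f y / real y * (f (fst x ^ snd x) / real (fst x ^ snd x))"
    let ?S = "\<lambda>y. \<Sum>q\<in>prime_factors (divisor_sum y). \<Sum>j\<in>{1..N}. f (q ^ j) / real (q ^ j)"
    let ?b = "K * (ln (ln (ln (real N))) + C)"
    have finZ: "finite Z" and finU: "finite U" by (auto simp: Z_def U_def)
    have "(\<Sum>m\<in>{1..N}. f m / real m * real (card {q\<in>prime_factors m. q dvd divisor_sum m}))
      = (\<Sum>m\<in>{1..N}. \<Sum>q | q \<in> prime_factors m \<and> q dvd divisor_sum m. f m / real m)"
      by (simp add: mult.commute)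
    also have "\<dots> = (\<Sum>(m, q)\<in>Z. f m / real m)"
      unfolding Z_def by (intro sum.Sigma) auto
    also have "\<dots> \<le> (\<Sum>(y, x)\<in>U. f y / real y * (f (fst x ^ snd x) / real (fst x ^ snd x)))"
    proof (rule sum_le_included[where i = "\<lambda>(y, x). (y * fst x ^ snd x, fst x)"])
      show "\<forall>y\<in>U. 0 \<le> ?g y"
        by (auto simp: U_def in_prime_factors_iff prime_gt_0_nat intro!: mult_nonneg_nonneg divide_nonneg_nonneg f_nonneg)
      show "\<forall>x\<in>Z. \<exists>y\<in>U. (case y of (y, x) \<Rightarrow> (y * fst x ^ snd x, fst x)) = x \<and>
        (case x of (m, q) \<Rightarrow> f m / real m) \<le> ?g y"
      proof
        fix x assume x: "x \<in> Z"
        obtain m q where mq: "x = (m, q)" by (cases x)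
        have m: "m > 0" "m \<le> N" "prime q" "q dvd m" "q dvd divisor_sum m"
          using x by (auto simp: mq Z_def in_prime_factors_iff)
        obtain k y where y: "m = y * q ^ k" "k = multiplicity q m" "k \<ge> 1" "\<not> q dvd y" "y > 0" "f m = f y * f (q ^ k)"
          using prime_multiplicity_cases[OF m(1,3,4)] by metis
        have "q dvd divisor_sum (y * q ^ k)" using m(5) y(1) by simp
        hence "q dvd divisor_sum y" using prime_dvd_divisor_sum_mult_power[OF m(3) y(5)] y(4) by blast
        hence qy: "q \<in> prime_factors (divisor_sum y)"
          using m(3) divisor_sum_pos[OF y(5)] by (simp add: in_prime_factors_iff)
        have "q ^ k > 0" using m(3) by (simp add: prime_gt_0_nat)
        hence ge1: "1 \<le> q ^ k" by linarith
        have "y * 1 \<le> y * q ^ k" using ge1 by (rule mult_le_mono2)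
        hence "y \<le> m" using y(1) by linarith
        hence yN: "y \<in> {1..N}" using y(5) m(2) by simp
        have "1 * q ^ k \<le> y * q ^ k" using y(5) by (intro mult_le_mono1) simp
        hence "q ^ k \<le> m" using y(1) by linarith
        moreover have "k < q ^ k"
          using prime_ge_2_nat[OF m(3)] by (metis less_exp power_mono le_less_trans less_le_trans zero_le)
        ultimately have kN: "k \<in> {1..N}" using y(3) m(2) by simp
        have "f m / real m = f y / real y * (f (q ^ k) / real (q ^ k))"
          unfolding y(6) by (subst y(1)) simp
        thus "\<exists>y\<in>U. (case y of (y, x) \<Rightarrow> (y * fst x ^ snd x, fst x)) = x \<and>
          (case x of (m, q) \<Rightarrow> f m / real m) \<le> ?g y"
          using qy yN kN mq y(1) by (intro bexI[of _ "(y, (q, k))"]) (auto simp: U_def)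
      qed
    qed (use finZ finU in auto)
    also have "\<dots> = (\<Sum>y\<in>{1..N}. \<Sum>x\<in>prime_factors (divisor_sum y) \<times> {1..N}. f y / real y * (f (fst x ^ snd x) / real (fst x ^ snd x)))"
      unfolding U_def by (intro sum.Sigma[symmetric]) auto
    also have "\<dots> = (\<Sum>y\<in>{1..N}. f y / real y * ?S y)"
      by (simp add: sum_distrib_left sum.cartesian_product split_def)
    also have "\<dots> \<le> (\<Sum>y\<in>{1..N}. f y / real y * (?b))"
    proof (intro sum_mono mult_left_mono)
      fix y assume y: "y \<in> {1..N}"
      have "?S y \<le> (\<Sum>q\<in>prime_factors (divisor_sum y). K * (1 / real q))"
        using K(2)[of _ N] by (intro sum_mono) (auto simp: in_prime_factors_iff)
      also have "\<dots> = K * (\<Sum>q\<in>prime_factors (divisor_sum y). 1 / real q)" by (simp only: sum_distrib_left)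
      also have "\<dots> \<le> ?b"
      proof (intro mult_left_mono C(2) N)
        show "divisor_sum y > 0" using y by (intro divisor_sum_pos) auto
        have "divisor_sum y \<le> y\<^sup>2" using y by (intro divisor_sum_le) auto
        also have "\<dots> \<le> N\<^sup>2" using y by (intro power_mono) auto
        finally show "divisor_sum y \<le> N\<^sup>2" .
      qed (use K in auto)
      finally show "?S y \<le> ?b" .
    qed (auto intro!: divide_nonneg_nonneg f_nonneg)
    also have "\<dots> = ?b * harmonic_sum N"
      unfolding harmonic_sum_def sum_distrib_left by (intro sum.cong refl) (simp only: mult_ac)
    finally show "(\<Sum>m\<in>{1..N}. f m / real m * real (card {q\<in>prime_factors m. q dvd divisor_sum m}))
      \<le> ?b * harmonic_sum N" .
  qed
qed

end

section \<open>Typical values of omega at s(mp)\<close>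

lemma sum_union_le:
  fixes g :: "'a \<Rightarrow> real"
  assumes "finite A" "finite B" "\<And>x. g x \<ge> 0"
  shows "sum g (A \<union> B) \<le> sum g A + sum g B"
  using assms sum.union_inter[of A B g] sum_nonneg[of "A \<inter> B" g] by simp

text \<open>The variance bound with T = \<open>N div m\<close> and z about T^(1/20). At this level
  ln z is still at least of order \<delta> ln N, so log log z = log log N + O(1) for fixed \<delta>,
  and s(m p) has O(1/\<delta>) prime factors above z, while z^4 \<le> (N/m)^(1/5) is negligible. The
  factor ln N on the left is what the density 2/ln(z + 1) saves.\<close>

lemma card_primes_atypical_omega_le:
  fixes \<delta> \<epsilon> :: real
  assumes \<delta>: "0 < \<delta>" "\<delta> \<le> 1" and \<epsilon>: "\<epsilon> > 0"
  obtains \<Lambda> where "\<Lambda> \<ge> 1"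
    "eventually (\<lambda>N. \<forall>m. 2 \<le> m \<longrightarrow> real N powr \<delta> \<le> real N / real m \<longrightarrow>
       real (card {q\<in>prime_factors m. q dvd divisor_sum m}) \<le> ln (ln (real N)) powr (1/4) \<longrightarrow>
       real (card {p\<in>primes_upto (N div m). \<not> p dvd m \<and>
          \<bar>real (omega (aliquot (m * p))) - ln (ln (real N))\<bar> \<ge> \<Lambda> * sqrt (ln (ln (real N)))}) * ln (real N)
       \<le> \<epsilon> * (real N / real m)) sequentially"
proof -
  obtain C1 :: real where C1: "C1 \<ge> 0"
    "\<And>n. n \<ge> 2 \<Longrightarrow> \<bar>(\<Sum>p\<in>primes_upto n. 1 / real p) - ln (ln (real n))\<bar> \<le> C1"
    using mertens_second by blast
  obtain C2 :: real where C2: "C2 \<ge> 0"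
    "\<And>N a. N \<ge> 16 \<Longrightarrow> a > 0 \<Longrightarrow> a \<le> N\<^sup>2 \<Longrightarrow> (\<Sum>q\<in>prime_factors a. 1 / real q) \<le> ln (ln (ln (real N))) + C2"
    using sum_inverse_prime_factors_le by blast
  \<comment> \<open>Here 21120 is twice 80 * 33 * 4: the bound for 2/ln(z + 1) gives 80, the bound
    33 L for 12 \<mu> + 9 gives 33, and h^2 = \<Lambda>^2 L / 4 gives 4. The other half of
    \<epsilon> pays for the powers of z.\<close>
  define \<Lambda> where "\<Lambda> = max 1 (sqrt (21120 / (\<delta> * \<epsilon>)))"
  have \<Lambda>1: "\<Lambda> \<ge> 1" by (simp add: \<Lambda>_def)
  have "sqrt (21120 / (\<delta> * \<epsilon>)) \<le> \<Lambda>" by (simp add: \<Lambda>_def)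
  hence "(sqrt (21120 / (\<delta> * \<epsilon>)))\<^sup>2 \<le> \<Lambda>\<^sup>2" using \<delta> \<epsilon> by (intro power_mono) auto
  hence "21120 / (\<delta> * \<epsilon>) \<le> \<Lambda>\<^sup>2" using \<delta> \<epsilon> by simp
  hence \<Lambda>2: "10560 / (\<delta> * \<Lambda>\<^sup>2) \<le> \<epsilon> / 2" using \<delta> \<epsilon> \<Lambda>1 by (simp add: field_simps)
  \<comment> \<open>Bounds the distance of \<mu> from L = log log N: \<open>C1\<close> comes from
    Mertens, ln(80/\<delta>) from log log z, and twice ln L + \<open>C2\<close> from the excluded
    primes dividing s(m) or sigma(m).\<close>
  define E1 where "E1 = (\<lambda>L. C1 + ln (80 / \<delta>) + 2 * ln L + 2 * C2)"
  \<comment> \<open>2097152 = 2^21 gives T \<ge> 2^20, and so z \<ge> 2.\<close>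
  have e1: "eventually (\<lambda>N. real N powr \<delta> \<ge> 2097152) sequentially" using \<delta> by real_asymp
  have e2: "eventually (\<lambda>N. \<delta> * ln (real N) \<ge> 2) sequentially" using \<delta> by real_asymp
  have e3: "eventually (\<lambda>N. ln (ln (real N)) \<ge> 1) sequentially" by real_asymp
  have lim4: "((\<lambda>N. (ln (ln (real N)) powr (1/4) + 1 + 80 / \<delta> + (C1 + ln (80 / \<delta>) + 2 * ln (ln (ln (real N))) + 2 * C2)) / sqrt (ln (ln (real N)))) \<longlongrightarrow> 0) sequentially"
    by real_asymp
  have e4: "eventually (\<lambda>N. (ln (ln (real N)) powr (1/4) + 1 + 80 / \<delta> + E1 (ln (ln (real N)))) / sqrt (ln (ln (real N))) < 1 / 2) sequentially"
    unfolding E1_def by (rule order_tendstoD(2)[OF lim4]) simp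
  have lim5: "((\<lambda>N. (C1 + ln (80 / \<delta>) + 2 * ln (ln (ln (real N))) + 2 * C2) / ln (ln (real N))) \<longlongrightarrow> 0) sequentially"
    by real_asymp
  have e5: "eventually (\<lambda>N. E1 (ln (ln (real N))) / ln (ln (real N)) < 1) sequentially"
    unfolding E1_def by (rule order_tendstoD(2)[OF lim5]) simp
  have lim6: "((\<lambda>N. 21 * ln (real N) * real N powr (-(4/5) * \<delta>)) \<longlongrightarrow> 0) sequentially"
    using \<delta> by real_asymp
  have e6: "eventually (\<lambda>N. 21 * ln (real N) * real N powr (-(4/5) * \<delta>) < \<epsilon> / 2) sequentially"
    by (rule order_tendstoD(2)[OF lim6]) (use \<epsilon> in simp)
  show ?thesis
  proof (rule that[OF \<Lambda>1], use e1 e2 e3 e4 e5 e6 eventually_ge_at_top[of 16] in eventually_elim, intro allI impI)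
    fix N m :: nat
    assume N1: "2097152 \<le> real N powr \<delta>" and N2: "2 \<le> \<delta> * ln (real N)" and N3: "1 \<le> ln (ln (real N))"
      and N4: "(ln (ln (real N)) powr (1/4) + 1 + 80 / \<delta> + E1 (ln (ln (real N)))) / sqrt (ln (ln (real N))) < 1 / 2"
      and N5: "E1 (ln (ln (real N))) / ln (ln (real N)) < 1"
      and N6: "21 * ln (real N) * real N powr (-(4/5) * \<delta>) < \<epsilon> / 2" and N7: "16 \<le> N"
      and m2: "2 \<le> m" and um: "real N powr \<delta> \<le> real N / real m"
      and common: "real (card {q\<in>prime_factors m. q dvd divisor_sum m}) \<le> ln (ln (real N)) powr (1/4)"
    define L where "L = ln (ln (real N))"
    define u where "u = real N / real m"
    define T where "T = N div m"
    define z where "z = nat \<lfloor>real T powr (1/20)\<rfloor>"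
    define a where "a = aliquot m"
    define b where "b = divisor_sum m"
    define P where "P = {q\<in>primes_upto z. \<not> q dvd a \<and> \<not> q dvd b}"
    define \<mu> where "\<mu> = (\<Sum>q\<in>P. 1 / real q)"
    have L1: "L \<ge> 1" and lN: "ln (real N) \<ge> 1" and m0: "m > 0"
      using N3 N7 m2 ln_le_minus_one[of "ln (real N)"] by (auto simp: L_def intro: order_trans ln_ge_iff[THEN iffD1])
    have uN: "u \<ge> real N powr \<delta>" using um by (simp add: u_def)
    have u21: "u \<ge> 2097152" using uN N1 by linarith
    have Tu: "real T \<le> u" unfolding T_def u_def by (rule of_nat_div_le_of_nat)
    have uT: "u - 1 \<le> real T" unfolding T_def u_def by (rule real_div_minus_one_le)
    have T2: "real T \<ge> u / 2" using uT u21 by linarith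
    have T20: "real T \<ge> 1048576" using T2 u21 by linarith
    have T0: "real T > 0" using T20 by linarith
    have Tz: "real T powr (1/20) \<ge> 2"
    proof -
      have "1048576 powr (1/20) \<le> real T powr (1/20)" using T20 by (intro powr_mono2) auto
      moreover have "(1048576 :: real) = 2 powr 20" by simp
      hence "(1048576 :: real) powr (1/20) = 2" by (simp only: powr_powr) simp
      ultimately show ?thesis by simp
    qed
    have z2: "z \<ge> 2" using Tz by (simp add: z_def le_nat_iff le_floor_iff)
    have zle: "real z \<le> real T powr (1/20)" using Tz by (simp add: z_def)
    have zge: "real z + 1 \<ge> real T powr (1/20)" unfolding z_def by linarith
    have lT: "ln (real T) \<ge> \<delta> * ln (real N) / 2"
    proof -
      have "real N powr \<delta> / 2 \<le> real T" using uN T2 by linarith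
      hence "ln (real N powr \<delta> / 2) \<le> ln (real T)" using N7 T0 by (subst ln_le_cancel_iff) auto
      also have "ln (real N powr \<delta> / 2) = \<delta> * ln (real N) - ln 2"
        using N7 by (simp add: ln_divide_pos ln_powr)
      finally show ?thesis using N2 ln_2_less_1 by linarith
    qed
    have lz1: "ln (real z + 1) \<ge> \<delta> * ln (real N) / 40"
    proof -
      have "ln (real T) / 20 = ln (real T powr (1/20))" using T0 by (simp add: ln_powr)
      also have "\<dots> \<le> ln (real z + 1)" using zge T0 by (subst ln_le_cancel_iff) auto
      finally show ?thesis using lT by linarith
    qed
    have lz: "ln (real z) \<ge> \<delta> / 80 * ln (real N)"
    proof -
      \<comment> \<open>For z \<ge> 2 one has z + 1 \<le> z^2, so ln z is at least half of ln(z +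
        1); this is how 40 becomes 80.\<close>
      have "2 * real z \<le> real z * real z" using z2 by (intro mult_right_mono) auto
      hence "real z + 1 \<le> (real z)\<^sup>2" using z2 unfolding power2_eq_square by linarith
      hence "ln (real z + 1) \<le> ln ((real z)\<^sup>2)" using z2 by (subst ln_le_cancel_iff) auto
      also have "\<dots> = 2 * ln (real z)" using z2 by (simp add: ln_realpow)
      finally show ?thesis using lz1 by linarith
    qed
    have uleN: "u \<le> real N" 
  proof -
    have "real N * 1 \<le> real N * real m" using m2 by (intro mult_left_mono) auto
    thus ?thesis using m0 by (simp add: u_def divide_le_eq)
  qed
    have zN: "real z \<le> real N"
    proof -
      have "real T powr (1/20) \<le> real T powr 1" using T20 by (intro powr_mono) auto
      thus ?thesis using zle Tu uleN T0 by simp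
    qed
    have llz: "\<bar>ln (ln (real z)) - L\<bar> \<le> ln (80 / \<delta>)"
    proof -
      have lzp: "ln (real z) > 0" using z2 by simp
      have "ln (real z) \<le> ln (real N)" using zN z2 by simp
      hence 1: "ln (ln (real z)) \<le> L" using lzp lN unfolding L_def by (subst ln_le_cancel_iff) auto
      have "ln (\<delta> / 80 * ln (real N)) \<le> ln (ln (real z))" using lz lzp \<delta> lN by (subst ln_le_cancel_iff) auto
      also have "ln (\<delta> / 80 * ln (real N)) = L - ln (80 / \<delta>)"
        using \<delta> lN by (simp add: L_def ln_mult ln_divide_pos)
      finally show ?thesis using 1 by linarith
    qed
    have mN: "m \<le> N"
    proof -
      have "1 \<le> u" using u21 by simp
      thus ?thesis using m0 by (simp add: u_def field_simps)
    qed
    have b0: "b > 0" and a0: "a > 0" and bN: "b \<le> N\<^sup>2" and aN: "a \<le> N\<^sup>2"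
    proof -
      show "b > 0" "a > 0" using m2 by (auto simp: a_def b_def intro: divisor_sum_pos aliquot_pos)
      have "m\<^sup>2 \<le> N\<^sup>2" using mN by (intro power_mono) auto
      thus "b \<le> N\<^sup>2" "a \<le> N\<^sup>2" 
        using divisor_sum_le[OF m0] aliquot_le[OF m0] unfolding a_def b_def by (blast intro: order_trans)+
    qed
    have \<mu>L: "\<bar>\<mu> - L\<bar> \<le> E1 L"
    proof -
      have "(\<Sum>q\<in>primes_upto z. 1 / real q) \<le> (\<Sum>q\<in>P \<union> (prime_factors a \<union> prime_factors b). 1 / real q)"
        using a0 b0 by (intro sum_mono2) (auto simp: P_def primes_upto_def in_prime_factors_iff)
      also have "\<dots> \<le> \<mu> + (\<Sum>q\<in>prime_factors a \<union> prime_factors b. 1 / real q)"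
        unfolding \<mu>_def by (rule sum_union_le) (auto simp: P_def)
      also have "(\<Sum>q\<in>prime_factors a \<union> prime_factors b. 1 / real q) \<le> (\<Sum>q\<in>prime_factors a. 1 / real q) + (\<Sum>q\<in>prime_factors b. 1 / real q)"
        by (rule sum_union_le) auto
      also have "(\<Sum>q\<in>prime_factors a. 1 / real q) \<le> ln L + C2" unfolding L_def by (rule C2(2)[OF N7 a0 aN])
      also have "(\<Sum>q\<in>prime_factors b. 1 / real q) \<le> ln L + C2" unfolding L_def by (rule C2(2)[OF N7 b0 bN])
      finally have 1: "(\<Sum>q\<in>primes_upto z. 1 / real q) \<le> \<mu> + (ln L + C2 + (ln L + C2))" by simp
      have 2: "\<mu> \<le> (\<Sum>q\<in>primes_upto z. 1 / real q)"
        unfolding \<mu>_def by (intro sum_mono2) (auto simp: P_def)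
      have 3: "\<bar>(\<Sum>q\<in>primes_upto z. 1 / real q) - ln (ln (real z))\<bar> \<le> C1" by (rule C1(2)[OF z2])
      have 4: "ln L \<ge> 0" using L1 by simp
      show ?thesis using 1 2 3 4 llz C2(1) unfolding E1_def by linarith
    qed
    have \<mu>2: "\<mu> \<le> 2 * L" using \<mu>L N5 L1 unfolding L_def[symmetric] by (simp add: divide_less_eq)
    \<comment> \<open>Half of the deviation is left for \<open>w\<close>. The other half absorbs the
      distance of \<mu> from L, the primes common to m and sigma(m), the prime p itself and the
      primes above z.\<close>
    define h where "h = \<Lambda> * sqrt L / 2"
    have sL: "sqrt L \<ge> 1" using L1 by simp
    have h0: "h > 0" using \<Lambda>1 sL by (simp add: h_def)
    have h2: "h\<^sup>2 = \<Lambda>\<^sup>2 * L / 4" using L1 by (simp add: h_def power_mult_distrib power_divide)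
    let ?X = "{p\<in>primes_upto T. \<not> p dvd m \<and> \<bar>real (omega (aliquot (m * p))) - L\<bar> \<ge> \<Lambda> * sqrt L}"
    let ?Y = "{p\<in>primes_upto T. \<bar>real (card {q\<in>P. q dvd a * p + b}) - \<mu>\<bar> \<ge> h}"
    have sub: "?X \<subseteq> ?Y"
    proof
      fix p assume p: "p \<in> ?X"
      hence pp: "prime p" "p \<le> T" "\<not> p dvd m" by (auto simp: primes_upto_def)
      define w where "w = real (card {q\<in>P. q dvd a * p + b})"
      define o' where "o' = real (omega (aliquot (m * p)))"
      have mp0: "m * p > 0" using m0 pp(1) by (simp add: prime_gt_0_nat)
      have "m * p \<le> N" using pp(2) m0 by (simp add: T_def less_eq_div_iff_mult_less_eq mult.commute)
      hence "(m * p)\<^sup>2 \<le> N\<^sup>2" by (intro power_mono) auto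
      hence "aliquot (m * p) \<le> N\<^sup>2" using aliquot_le[OF mp0] by linarith
      moreover have "aliquot (m * p) > 0"
        using aliquot_mult_prime[OF pp(1,3) m0] b0 by (simp add: b_def)
      ultimately have "ln (real (aliquot (m * p))) \<le> ln (real (N\<^sup>2))" using N7 by (subst ln_le_cancel_iff) (auto simp del: of_nat_power)
      also have "\<dots> = 2 * ln (real N)" using N7 by (simp add: ln_realpow)
      finally have "ln (real (aliquot (m * p))) / ln (real z + 1) \<le> 2 * ln (real N) / (\<delta> * ln (real N) / 40)"
        using lz1 \<delta> lN by (intro frac_le) auto
      also have "\<dots> = 80 / \<delta>" using \<delta> lN by (simp add: field_simps)
      finally have big: "ln (real (aliquot (m * p))) / ln (real z + 1) \<le> 80 / \<delta>" .
      have "w \<le> o'" "o' \<le> w + real (card {q\<in>prime_factors m. q dvd divisor_sum m}) + 1 + ln (real (aliquot (m * p))) / ln (real z + 1)"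
        using omega_linear_bounds[OF m2 pp(1,3), of z] z2 unfolding w_def o'_def P_def a_def b_def by simp_all
      hence o': "w \<le> o'" "o' \<le> w + L powr (1/4) + 1 + 80 / \<delta>" using common big unfolding L_def[symmetric] by linarith+
      have "L powr (1/4) + 1 + 80 / \<delta> + E1 L < sqrt L / 2"
        using N4 sL unfolding L_def[symmetric] by (simp add: divide_less_eq)
      also have "\<dots> \<le> h" using \<Lambda>1 sL by (simp add: h_def)
      finally have "L powr (1/4) + 1 + 80 / \<delta> + E1 L < h" .
      moreover have "\<bar>o' - L\<bar> \<ge> 2 * h" using p by (simp add: h_def o'_def)
      moreover have "80 / \<delta> \<ge> 0" using \<delta> by simp
      moreover have "L powr (1/4) \<ge> 0" by simp
      ultimately have "\<bar>w - \<mu>\<bar> \<ge> h" using o' \<mu>L by linarith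
      thus "p \<in> ?Y" using p unfolding w_def by simp
    qed
    have "real (card ?X) \<le> real (card ?Y)" using sub by (intro of_nat_mono card_mono) auto
    also have "\<dots> \<le> real z + (real T * (2 / ln (real z + 1)) * (12 * \<mu> + 9) + 5 * real z ^ 4) / h\<^sup>2"
      unfolding \<mu>_def using z2 h0 by (intro card_primes_abnormal_le) (auto simp: P_def)
    also have "\<dots> \<le> u powr (1/5) + (u * (80 / (\<delta> * ln (real N))) * (33 * L) + 5 * u powr (1/5)) / h\<^sup>2"
    proof -
      have u1: "u \<ge> 1" using u21 by linarith
      have zu: "real z \<le> u powr (1/20)"
      proof -
        have "real T powr (1/20) \<le> u powr (1/20)" using Tu T0 by (intro powr_mono2) auto
        thus ?thesis using zle by linarith
      qed
      have "u powr (1/20) \<le> u powr (1/5)" using u1 by (intro powr_mono) auto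
      hence 1: "real z \<le> u powr (1/5)" using zu by linarith
      have "real z ^ 4 \<le> (u powr (1/20)) ^ 4" using zu by (intro power_mono) auto
      also have "\<dots> = u powr (1/5)" using u1 by (simp add: powr_power)
      finally have 2: "real z ^ 4 \<le> u powr (1/5)" .
      have "2 / ln (real z + 1) \<le> 2 / (\<delta> * ln (real N) / 40)"
        using lz1 \<delta> lN z2 by (intro divide_left_mono mult_pos_pos) auto
      hence 3: "2 / ln (real z + 1) \<le> 80 / (\<delta> * ln (real N))" by simp
      have \<mu>0: "\<mu> \<ge> 0" by (simp add: \<mu>_def sum_nonneg)
      have 4: "12 * \<mu> + 9 \<le> 33 * L" using \<mu>2 L1 by linarith
      have 5: "real T * (2 / ln (real z + 1)) \<le> u * (80 / (\<delta> * ln (real N)))"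
        using Tu 3 z2 u1 by (intro mult_mono) auto
      have 6: "real T * (2 / ln (real z + 1)) * (12 * \<mu> + 9) \<le> u * (80 / (\<delta> * ln (real N))) * (33 * L)"
        using \<mu>0 u1 \<delta> lN by (intro mult_mono[OF 5 4]) auto
      show ?thesis using 1 2 6 by (intro add_mono divide_right_mono) auto
    qed
    also have "\<dots> = u powr (1/5) + u * (10560 / (\<delta> * \<Lambda>\<^sup>2)) / ln (real N) + 5 * u powr (1/5) / h\<^sup>2"
      unfolding h2 using L1 \<Lambda>1 \<delta> lN by (simp add: field_simps)
    also have "\<dots> \<le> u powr (1/5) + u * (\<epsilon> / 2) / ln (real N) + 20 * u powr (1/5)"
    proof -
      have "u * (10560 / (\<delta> * \<Lambda>\<^sup>2)) / ln (real N) \<le> u * (\<epsilon> / 2) / ln (real N)"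
        using \<Lambda>2 u21 lN by (intro divide_right_mono mult_left_mono) auto
      moreover have "1 / 4 \<le> h\<^sup>2"
      proof -
        have "1 * 1 \<le> \<Lambda>\<^sup>2 * L" using \<Lambda>1 L1 by (intro mult_mono) auto
        thus ?thesis by (simp add: h2)
      qed
      hence "5 * u powr (1/5) / h\<^sup>2 \<le> 5 * u powr (1/5) / (1/4)" by (intro divide_left_mono) auto
      hence "5 * u powr (1/5) / h\<^sup>2 \<le> 20 * u powr (1/5)" by simp
      ultimately show ?thesis by (intro add_mono order_refl)
    qed
    finally have "real (card ?X) \<le> 21 * u powr (1/5) + u * (\<epsilon> / 2) / ln (real N)" by linarith
    hence "real (card ?X) * ln (real N) \<le> (21 * u powr (1/5) + u * (\<epsilon> / 2) / ln (real N)) * ln (real N)"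
      using lN by (intro mult_right_mono) auto
    also have "\<dots> = 21 * ln (real N) * u powr (1/5) + u * (\<epsilon> / 2)"
      using lN by (simp add: field_simps)
    also have "21 * ln (real N) * u powr (1/5) \<le> u * (\<epsilon> / 2)"
    proof -
      have u0: "u > 0" using u21 by linarith
      have "u powr (1/5) = u powr 1 * u powr (-(4/5))" by (simp only: powr_add[symmetric]) simp
      also have "\<dots> \<le> u * (real N powr \<delta>) powr (-(4/5))"
        using u0 uN N7 by (simp, intro powr_mono2') auto
      also have "\<dots> = u * real N powr (-(4/5) * \<delta>)" by (simp add: powr_powr mult.commute)
      finally have "21 * ln (real N) * u powr (1/5) \<le> 21 * ln (real N) * (u * real N powr (-(4/5) * \<delta>))"
        using lN by (intro mult_left_mono) auto
      also have "\<dots> = u * (21 * ln (real N) * real N powr (-(4/5) * \<delta>))" by simp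
      also have "\<dots> \<le> u * (\<epsilon> / 2)" using N6 u0 by (intro mult_left_mono) auto
      finally show ?thesis .
    qed
    finally have "real (card ?X) * ln (real N) \<le> \<epsilon> * u" by (simp add: field_simps)
    thus "real (card {p\<in>primes_upto (N div m). \<not> p dvd m \<and>
          \<bar>real (omega (aliquot (m * p))) - ln (ln (real N))\<bar> \<ge> \<Lambda> * sqrt (ln (ln (real N)))}) * ln (real N)
       \<le> \<epsilon> * (real N / real m)" unfolding T_def L_def u_def .
  qed
qed

section \<open>The normal order\<close>

lemma sum_split_at:
  fixes g :: "nat \<Rightarrow> real"
  assumes "M \<le> N"
  shows "sum g {1..N} = sum g {1..M} + sum g {M<..N}"
proof -
  have "{1..N} = {1..M} \<union> {M<..N}" using assms by auto
  thus ?thesis by (simp only:) (rule sum.union_disjoint; auto)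
qed

context dense_arith_weight begin

text \<open>The log-weighted decomposition is applied to the atypical n > sqrt N. For ordinary m the
  inner sum over p is a small multiple of N/m; exceptional m get the trivial Chebyshev bound but
  carry a small part of the harmonic sum. The lower bound for \<open>weight_sum\<close> turns this
  into a proportion of the total.\<close>

lemma sum_f_atypical_le:
  assumes \<epsilon>: "\<epsilon> > 0"
  obtains \<Lambda> where "\<Lambda> \<ge> 1"
    "eventually (\<lambda>N. (\<Sum>n | n \<in> {1..N} \<and> \<bar>real (omega (aliquot n)) - ln (ln (real N))\<bar> \<ge> \<Lambda> * sqrt (ln (ln (real N))). f n)
       \<le> \<epsilon> * weight_sum N) sequentially"
proof -
  obtain c where c: "c > 0" "eventually (\<lambda>N. weight_sum N * ln (real N) \<ge> c * real N * harmonic_sum N) sequentially"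
    using weight_sum_ln_ge by blast
  obtain Ct where Ct: "Ct > 0" "\<And>\<delta>. 0 < \<delta> \<Longrightarrow> \<delta> \<le> 1/4 \<Longrightarrow>
    eventually (\<lambda>N. harmonic_sum N - harmonic_sum (nat \<lfloor>real N powr (1 - \<delta>)\<rfloor>) \<le> Ct * \<delta> * harmonic_sum N) sequentially"
    using harmonic_sum_tail_le by blast
  obtain C where C: "C > 0"
    "\<And>N X. X \<subseteq> {1..N} \<Longrightarrow> (\<Sum>n\<in>X. f n * ln (real n)) \<le>
       (\<Sum>m\<in>{1..N}. f m * (\<Sum>p | p \<in> primes_upto (N div m) \<and> \<not> p dvd m \<and> m * p \<in> X. f p * ln (real p)))
       + C * (\<Sum>m\<in>{1..N}. f m * (real N / real m) powr (7/8))"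
    using sum_f_ln_le by blast
  obtain K Cg where K: "K > 0" "Cg \<ge> 0"
    "\<And>N. N \<ge> 16 \<Longrightarrow> (\<Sum>m\<in>{1..N}. f m / real m * real (card {q\<in>prime_factors m. q dvd divisor_sum m}))
      \<le> K * (ln (ln (ln (real N))) + Cg) * harmonic_sum N"
    using sum_common_primes_le by blast
  \<comment> \<open>The unit of the error budget: 7e from the log-weighted sum, doubled because only
    ln n \<ge> (ln N)/2 is known, and 8e for n \<le> sqrt N. The total 22e stays within the 32e
    available.\<close>
  define e where "e = \<epsilon> * c / 32"
  have e0: "e > 0" using \<epsilon> c by (simp add: e_def)
  \<comment> \<open>The m > N^(1-\<delta>) enter twice, with factor 4 A1 through the primes and with
    factor C through higher prime powers; together they may cost 2e.\<close>
  define \<delta> where "\<delta> = min (1/4) (2 * e / ((4 * A1 + C) * Ct))"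
  have D: "(4 * A1 + C) * Ct > 0" using A1_pos C Ct by simp
  have \<delta>: "0 < \<delta>" "\<delta> \<le> 1/4" using e0 D by (auto simp: \<delta>_def)
  have "\<delta> \<le> 2 * e / ((4 * A1 + C) * Ct)" by (simp add: \<delta>_def)
  hence \<delta>e: "(4 * A1 + C) * (Ct * \<delta>) \<le> 2 * e" using D by (simp add: field_simps)
  \<comment> \<open>The division by A1 makes up for f(p) \<le> A1, which turns the weighted sum over
    p into a count.\<close>
  have \<epsilon>1: "2 * e / A1 > 0" using e0 A1_pos by simp
  have \<delta>1: "\<delta> \<le> 1" using \<delta> by simp
  obtain \<Lambda> where \<Lambda>: "\<Lambda> \<ge> 1"
    "eventually (\<lambda>N. \<forall>m. 2 \<le> m \<longrightarrow> real N powr \<delta> \<le> real N / real m \<longrightarrow>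
       real (card {q\<in>prime_factors m. q dvd divisor_sum m}) \<le> ln (ln (real N)) powr (1/4) \<longrightarrow>
       real (card {p\<in>primes_upto (N div m). \<not> p dvd m \<and>
          \<bar>real (omega (aliquot (m * p))) - ln (ln (real N))\<bar> \<ge> \<Lambda> * sqrt (ln (ln (real N)))}) * ln (real N)
       \<le> 2 * e / A1 * (real N / real m)) sequentially"
    using card_primes_atypical_omega_le[OF \<delta>(1) \<delta>1 \<epsilon>1] by blast
  have "((\<lambda>N. 4 * A1 * (K * (ln (ln (ln (real N))) + Cg) / ln (ln (real N)) powr (1/4))) \<longlongrightarrow> 0) sequentially"
    by real_asymp
  hence e1: "eventually (\<lambda>N. 4 * A1 * (K * (ln (ln (ln (real N))) + Cg) / ln (ln (real N)) powr (1/4)) < e) sequentially"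
    using e0 by (intro order_tendstoD(2)) auto
  have "((\<lambda>N. C * real N powr (- (\<delta> / 8))) \<longlongrightarrow> 0) sequentially" using \<delta> by real_asymp
  hence e2: "eventually (\<lambda>N. C * real N powr (- (\<delta> / 8)) < e) sequentially"
    using e0 by (intro order_tendstoD(2)) auto
  have "((\<lambda>N. A2 (1/4) * real N powr (3/4) * ln (real N) / real N) \<longlongrightarrow> 0) sequentially" by real_asymp
  hence e3: "eventually (\<lambda>N. A2 (1/4) * real N powr (3/4) * ln (real N) / real N < 8 * e) sequentially"
    using e0 by (intro order_tendstoD(2)) auto
  have e4: "eventually (\<lambda>N. harmonic_sum N \<ge> 4 * A1 / e) sequentially"
    using harmonic_sum_at_top unfolding filterlim_at_top by blast
  have e5: "eventually (\<lambda>N. ln (ln (real N)) \<ge> 1) sequentially" by real_asymp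
  show ?thesis
  proof (rule that[OF \<Lambda>(1)], use c(2) Ct(2)[OF \<delta>] \<Lambda>(2) e1 e2 e3 e4 e5 eventually_ge_at_top[of 16] in eventually_elim)
    case (elim N)
    define L where "L = ln (ln (real N))"
    define M where "M = nat \<lfloor>real N powr (1 - \<delta>)\<rfloor>"
    define bad where "bad = (\<lambda>n. \<bar>real (omega (aliquot n)) - L\<bar> \<ge> \<Lambda> * sqrt L)"
    \<comment> \<open>Restricting to n > sqrt N makes ln n comparable with ln N; for the smaller n
      the bound f(n) \<le> A2(1/4) n^(1/4) is enough.\<close>
    define X where "X = {n. n \<in> {1..N} \<and> bad n \<and> N < n\<^sup>2}"
    define com where "com = (\<lambda>m. real (card {q\<in>prime_factors m. q dvd divisor_sum m}))"
    \<comment> \<open>The exceptional m: m = 1, where s(m) = 0; m beyond N^(1-\<delta>), where the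
      sieve has too little room; and m sharing many primes with sigma(m). The threshold L^(1/4)
      exceeds the average O(log L), so that Markov's inequality applies, and is small compared with
      the deviation sqrt L.\<close>
    define E where "E = {m. m \<in> {1..N} \<and> (m = 1 \<or> m > M \<or> com m > L powr (1/4))}"
    define G where "G = (\<lambda>m. \<Sum>p | p \<in> primes_upto (N div m) \<and> \<not> p dvd m \<and> m * p \<in> X. f p * ln (real p))"
    let ?f = "\<lambda>m. f m / real m" and ?u = "\<lambda>m. real N / real m" and ?Q = "{n. n \<in> {1..N} \<and> n\<^sup>2 \<le> N}"
    let ?k = "K * (ln L + Cg) / L powr (1/4)" and ?W = "real N * harmonic_sum N"
    let ?A2 = "\<lambda>x. A2 (1/4) * real N powr x"
    have N16: "N \<ge> 16" and L1: "L \<ge> 1" using elim by (auto simp: L_def)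
    have lN: "ln (real N) > 0" using N16 by simp
    have F1: "harmonic_sum N \<ge> 1" using N16 by (intro harmonic_sum_ge_1) simp
    have "real N powr (1 - \<delta>) \<le> real N powr 1" using \<delta> N16 by (intro powr_mono) auto
    hence MN: "M \<le> N" using N16 by (simp add: M_def nat_le_iff floor_le_iff)
    have ratio: "real N powr \<delta> \<le> ?u m" if m: "1 \<le> m" "m \<le> M" for m
    proof -
      have "real m \<le> real N powr (1 - \<delta>)" using m unfolding M_def by (simp add: le_nat_iff le_floor_iff)
      hence "real N powr \<delta> * real m \<le> real N powr \<delta> * real N powr (1 - \<delta>)" by (intro mult_left_mono) auto
      also have "\<dots> = real N" using N16 by (simp add: powr_add[symmetric])
      finally show ?thesis using m by (simp add: field_simps)
    qed
    have fm0: "?f m \<ge> 0" for m using f_nonneg[of m] by (cases "m = 0") auto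
    have tail: "(\<Sum>m\<in>{M<..N}. ?f m) \<le> Ct * \<delta> * harmonic_sum N"
    proof -
      have "harmonic_sum N = harmonic_sum M + (\<Sum>m\<in>{M<..N}. ?f m)"
        unfolding harmonic_sum_def by (rule sum_split_at[OF MN])
      thus ?thesis using elim(2) unfolding M_def by linarith
    qed
    have FE: "4 * A1 * (\<Sum>m\<in>E. ?f m) \<le> (4 * A1) * (Ct * \<delta>) * harmonic_sum N + 2 * e * harmonic_sum N"
    proof -
      define E3 where "E3 = {m. m \<in> {1..N} \<and> com m > L powr (1/4)}"
      have "(\<Sum>m\<in>E. ?f m) \<le> (\<Sum>m\<in>({1} \<union> {M<..N}) \<union> E3. ?f m)"
        using fm0 by (intro sum_mono2) (auto simp: E_def E3_def)
      also have "\<dots> \<le> (\<Sum>m\<in>{1} \<union> {M<..N}. ?f m) + (\<Sum>m\<in>E3. ?f m)"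
        by (intro sum_union_le fm0) (auto simp: E3_def)
      also have "(\<Sum>m\<in>{1} \<union> {M<..N}. ?f m) \<le> 1 + (\<Sum>m\<in>{M<..N}. ?f m)"
        using sum_union_le[of "{1}" "{M<..N}" "\<lambda>m. ?f m"] fm0 by simp
      also have "(\<Sum>m\<in>E3. ?f m) \<le> ?k * harmonic_sum N"
      proof -
        have "L powr (1/4) * (\<Sum>m\<in>E3. ?f m) = (\<Sum>m\<in>E3. ?f m * L powr (1/4))"
          by (subst mult.commute) (simp only: sum_distrib_right)
        also have "\<dots> \<le> (\<Sum>m\<in>E3. ?f m * com m)"
          using fm0 by (intro sum_mono mult_left_mono) (auto simp: E3_def)
        also have "\<dots> \<le> (\<Sum>m\<in>{1..N}. ?f m * com m)"
          by (intro sum_mono2 mult_nonneg_nonneg fm0) (auto simp: E3_def com_def)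
        also have "\<dots> \<le> K * (ln L + Cg) * harmonic_sum N" unfolding com_def L_def by (rule K(3)[OF N16])
        finally show ?thesis using L1 by (simp add: field_simps)
      qed
      also note tail
      finally have "(\<Sum>m\<in>E. ?f m) \<le> 1 + Ct * \<delta> * harmonic_sum N + ?k * harmonic_sum N" by simp
      hence "4 * A1 * (\<Sum>m\<in>E. ?f m) \<le> 4 * A1 * (1 + Ct * \<delta> * harmonic_sum N + ?k * harmonic_sum N)"
        using A1_pos by (intro mult_left_mono) auto
      also have "\<dots> = 4 * A1 + 4 * A1 * (Ct * \<delta>) * harmonic_sum N + 4 * A1 * ?k * harmonic_sum N"
        by (simp add: algebra_simps)
      finally have "4 * A1 * (\<Sum>m\<in>E. ?f m) \<le> 4 * A1 + 4 * A1 * (Ct * \<delta>) * harmonic_sum N + 4 * A1 * ?k * harmonic_sum N" .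
      moreover have "4 * A1 \<le> e * harmonic_sum N" using elim(7) e0 by (simp add: field_simps)
      moreover have "4 * A1 * ?k * harmonic_sum N \<le> e * harmonic_sum N"
        using elim(4) F1 unfolding L_def[symmetric] by (intro mult_right_mono) auto
      moreover have "x \<le> b + 2 * d" if "x \<le> a + b + y" "a \<le> d" "y \<le> d" for x a b y d :: real
        using that by linarith
      ultimately have "4 * A1 * (\<Sum>m\<in>E. ?f m) \<le> 4 * A1 * (Ct * \<delta>) * harmonic_sum N + 2 * (e * harmonic_sum N)" by blast
      thus ?thesis by (simp only: mult.assoc)
    qed
    have Gall: "G m \<le> 4 * A1 * ?u m" if "m \<ge> 1" for m
      unfolding G_def using that by (rule sum_f_ln_primes_le)
    have Ggood: "G m \<le> 2 * e * ?u m" if m: "m \<in> {1..N} - E" for m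
    proof -
      have m': "2 \<le> m" "1 \<le> m" "m \<le> M" "com m \<le> L powr (1/4)" using m by (auto simp: E_def)
      let ?A = "{p. p \<in> primes_upto (N div m) \<and> \<not> p dvd m \<and> m * p \<in> X}"
      let ?B = "{p\<in>primes_upto (N div m). \<not> p dvd m \<and> \<bar>real (omega (aliquot (m * p))) - L\<bar> \<ge> \<Lambda> * sqrt L}"
      have "G m \<le> (\<Sum>p\<in>?A. A1 * ln (real N))"
        unfolding G_def
      proof (intro sum_mono)
        fix p assume p: "p \<in> ?A"
        hence pp: "prime p" "p \<le> N div m" by (auto simp: primes_upto_def)
        have "p \<le> N" using pp(2) div_le_dividend[of N m] by linarith
        hence "ln (real p) \<le> ln (real N)" "ln (real p) \<ge> 0" using prime_ge_1_nat[OF pp(1)] by auto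
        thus "f p * ln (real p) \<le> A1 * ln (real N)"
          using f_prime_le[OF pp(1)] A1_pos by (intro mult_mono) auto
      qed
      also have "\<dots> = A1 * (real (card ?A) * ln (real N))" by simp
      also have "\<dots> \<le> A1 * (real (card ?B) * ln (real N))"
        using A1_pos lN by (intro mult_left_mono mult_right_mono of_nat_mono card_mono) (auto simp: X_def bad_def)
      also have "\<dots> \<le> A1 * (2 * e / A1 * ?u m)"
        using elim(3) m' ratio[OF m'(2,3)] A1_pos unfolding com_def L_def by (intro mult_left_mono) auto
      also have "\<dots> = 2 * e * ?u m" using A1_pos by simp
      finally show ?thesis .
    qed
    have "(\<Sum>m\<in>{1..N}. f m * G m) = (\<Sum>m\<in>{1..N} - E. f m * G m) + (\<Sum>m\<in>E. f m * G m)"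
      by (intro sum.subset_diff) (auto simp: E_def)
    also have "\<dots> \<le> (\<Sum>m\<in>{1..N} - E. f m * (2 * e * ?u m)) + (\<Sum>m\<in>E. f m * (4 * A1 * ?u m))"
      using Gall Ggood by (intro add_mono sum_mono mult_left_mono f_nonneg) (auto simp: E_def)
    also have "(\<Sum>m\<in>{1..N} - E. f m * (2 * e * ?u m)) = 2 * e * real N * (\<Sum>m\<in>{1..N} - E. ?f m)"
      unfolding sum_distrib_left by (intro sum.cong refl) simp
    also have "(\<Sum>m\<in>E. f m * (4 * A1 * ?u m)) = real N * (4 * A1 * (\<Sum>m\<in>E. ?f m))"
      unfolding sum_distrib_left by (intro sum.cong refl) simp
    also have "(\<Sum>m\<in>{1..N} - E. ?f m) \<le> harmonic_sum N"
      unfolding harmonic_sum_def using fm0 by (intro sum_mono2) auto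
    finally have "(\<Sum>m\<in>{1..N}. f m * G m) \<le> 2 * e * ?W + real N * (4 * A1 * (\<Sum>m\<in>E. ?f m))"
      using e0 by (simp add: mult_left_mono)
    also have "real N * (4 * A1 * (\<Sum>m\<in>E. ?f m)) \<le> real N * ((4 * A1) * (Ct * \<delta>) * harmonic_sum N + 2 * e * harmonic_sum N)"
      using FE by (intro mult_left_mono) auto
    finally have 1: "(\<Sum>m\<in>{1..N}. f m * G m) \<le> ?W * (4 * e + 4 * A1 * (Ct * \<delta>))"
      by (simp add: algebra_simps)
    \<comment> \<open>For m \<le> M the exponent 7/8 saves a factor (N/m)^(-1/8) \<le>
      N^(-\<delta>/8). For m > M nothing is saved, but the tail of the harmonic sum is
      small.\<close>
    have "C * (\<Sum>m\<in>{1..N}. f m * ?u m powr (7/8)) = C * ((\<Sum>m\<in>{1..M}. f m * ?u m powr (7/8)) + (\<Sum>m\<in>{M<..N}. f m * ?u m powr (7/8)))"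
      by (simp only: sum_split_at[OF MN])
    also have "\<dots> \<le> C * ((\<Sum>m\<in>{1..M}. real N * real N powr (- (\<delta> / 8)) * ?f m) + (\<Sum>m\<in>{M<..N}. real N * ?f m))"
    proof (intro mult_left_mono add_mono sum_mono)
      fix m assume m: "m \<in> {1..M}"
      let ?v = "?u m"
      have u0: "?v > 0" using m N16 by simp
      have "?v powr (7/8) = ?v powr 1 * ?v powr (- (1/8))" by (simp only: powr_add[symmetric]) simp
      also have "\<dots> \<le> ?v * (real N powr \<delta>) powr (- (1/8))"
        using u0 ratio[of m] m N16 by (simp, intro divide_right_mono mult_left_mono powr_mono2') auto
      also have "\<dots> = ?v * real N powr (- (\<delta> / 8))" by (simp add: powr_powr)
      finally have "f m * ?v powr (7/8) \<le> f m * (?v * real N powr (- (\<delta> / 8)))"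
        using m by (intro mult_left_mono f_nonneg) auto
      thus "f m * ?v powr (7/8) \<le> real N * real N powr (- (\<delta> / 8)) * ?f m" by (simp add: mult_ac)
    next
      fix m assume m: "m \<in> {M<..N}"
      let ?v = "?u m"
      have "?v powr (7/8) \<le> ?v powr 1" using m by (intro powr_mono) auto
      hence "f m * ?v powr (7/8) \<le> f m * ?v" using m N16 by (intro mult_left_mono f_nonneg) auto
      thus "f m * ?v powr (7/8) \<le> real N * ?f m" by (simp add: mult_ac)
    qed (use C in auto)
    also have "\<dots> = real N * (C * real N powr (- (\<delta> / 8)) * harmonic_sum M + C * (\<Sum>m\<in>{M<..N}. ?f m))"
      unfolding harmonic_sum_def sum_distrib_left[symmetric] by (simp add: algebra_simps)
    also have "\<dots> \<le> real N * (e * harmonic_sum N + C * (Ct * \<delta> * harmonic_sum N))"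
    proof (intro mult_left_mono add_mono tail mult_mono)
      show "C * real N powr (- (\<delta> / 8)) \<le> e" using elim(5) by simp
      show "harmonic_sum M \<le> harmonic_sum N" by (rule harmonic_sum_mono[OF MN])
      show "0 \<le> harmonic_sum M" unfolding harmonic_sum_def using fm0 by (intro sum_nonneg) auto
    qed (use C e0 in auto)
    also have "\<dots> = ?W * (e + C * (Ct * \<delta>))" by (simp add: algebra_simps)
    finally have 2: "C * (\<Sum>m\<in>{1..N}. f m * ?u m powr (7/8)) \<le> ?W * (e + C * (Ct * \<delta>))" .
    have "(\<Sum>n\<in>X. f n * ln (real n)) \<le> (\<Sum>m\<in>{1..N}. f m * G m) + C * (\<Sum>m\<in>{1..N}. f m * ?u m powr (7/8))"
      unfolding G_def by (rule C(2)) (auto simp: X_def)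
    also have "\<dots> \<le> ?W * (4 * e + 4 * A1 * (Ct * \<delta>)) + ?W * (e + C * (Ct * \<delta>))"
      using 1 2 by (rule add_mono)
    also have "\<dots> = ?W * (5 * e + (4 * A1 + C) * (Ct * \<delta>))" by (simp add: algebra_simps)
    also have "\<dots> \<le> ?W * (7 * e)" using \<delta>e F1 by (intro mult_left_mono) auto
    finally have Xln: "(\<Sum>n\<in>X. f n * ln (real n)) \<le> ?W * (7 * e)" .
    have "ln (real N) / 2 * (\<Sum>n\<in>X. f n) = (\<Sum>n\<in>X. f n * (ln (real N) / 2))"
      by (subst mult.commute) (simp only: sum_distrib_right)
    also have "\<dots> \<le> (\<Sum>n\<in>X. f n * ln (real n))"
    proof (intro sum_mono mult_left_mono f_nonneg)
      fix n assume n: "n \<in> X"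
      have "real N < real (n\<^sup>2)" using n by (auto simp: X_def simp del: of_nat_power)
      hence "ln (real N) \<le> ln (real (n\<^sup>2))" using N16 n by (subst ln_le_cancel_iff) (auto simp: X_def)
      thus "ln (real N) / 2 \<le> ln (real n)" using n by (simp add: ln_realpow X_def)
    qed (auto simp: X_def)
    finally have 3: "ln (real N) * (\<Sum>n\<in>X. f n) \<le> ?W * (14 * e)" using Xln by simp
    have "(\<Sum>n | n \<in> {1..N} \<and> bad n. f n) \<le> (\<Sum>n\<in>X \<union> {n\<in>{1..N}. n\<^sup>2 \<le> N}. f n)"
      by (intro sum_mono2) (auto simp: X_def intro!: f_nonneg)
    also have "\<dots> = (\<Sum>n\<in>X. f n) + (\<Sum>n\<in>?Q. f n)"
      by (intro sum.union_disjoint) (auto simp: X_def)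
    also have "(\<Sum>n\<in>?Q. f n) \<le> ?A2 (3/4)"
    proof -
      have sq: "real n \<le> real N powr (1/2)" if "n\<^sup>2 \<le> N" for n
      proof -
        have "(real n)\<^sup>2 \<le> real N" using that by (metis of_nat_le_iff of_nat_power)
        thus ?thesis by (simp add: powr_half_sqrt real_le_rsqrt)
      qed
      have "(\<Sum>n\<in>?Q. f n) \<le> (\<Sum>n\<in>?Q. ?A2 (1/4))"
      proof (rule sum_mono)
        fix n assume n: "n \<in> ?Q"
        have "f n \<le> A2 (1/4) * real n powr (1/4)" using n by (intro f_le_powr) auto
        also have "\<dots> \<le> ?A2 (1/4)"
          using n A2_pos[of "1/4"] by (intro mult_left_mono powr_mono2) auto
        finally show "f n \<le> ?A2 (1/4)" .
      qed
      also have "\<dots> = real (card ?Q) * (?A2 (1/4))" by simp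
      also have "\<dots> \<le> real N powr (1/2) * (?A2 (1/4))"
      proof (rule mult_right_mono)
        have "?Q \<subseteq> {1..nat \<lfloor>real N powr (1/2)\<rfloor>}"
          using sq by (auto simp: le_nat_iff le_floor_iff)
        hence "card ?Q \<le> card {1..nat \<lfloor>real N powr (1/2)\<rfloor>}" by (intro card_mono) auto
        thus "real (card ?Q) \<le> real N powr (1/2)"
          by (simp add: le_nat_iff le_floor_iff)
        show "0 \<le> ?A2 (1/4)" using A2_pos[of "1/4"] by simp
      qed
      also have "\<dots> = A2 (1/4) * (real N powr (1/2) * real N powr (1/4))" by simp
      also have "real N powr (1/2) * real N powr (1/4) = real N powr (3/4)" by (simp only: powr_add[symmetric]) simp
      finally show ?thesis .
    qed
    finally have "(\<Sum>n | n \<in> {1..N} \<and> bad n. f n) * ln (real N) \<le> ((\<Sum>n\<in>X. f n) + ?A2 (3/4)) * ln (real N)"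
      using lN by (intro mult_right_mono) auto
    also have "\<dots> = ln (real N) * (\<Sum>n\<in>X. f n) + ?A2 (3/4) * ln (real N)" by (simp add: algebra_simps)
    also have "\<dots> \<le> ?W * (14 * e) + ?W * (8 * e)"
    proof (intro add_mono 3)
      have "?A2 (3/4) * ln (real N) \<le> real N * (8 * e)"
        using elim(6) N16 by (simp add: divide_less_eq mult.commute)
      also have "real N * 1 \<le> ?W" using F1 by (intro mult_left_mono) auto
      hence "real N * (8 * e) \<le> ?W * (8 * e)" using e0 by (intro mult_right_mono) auto
      finally show "?A2 (3/4) * ln (real N) \<le> ?W * (8 * e)" .
    qed
    also have "\<dots> \<le> ?W * (32 * e)" using F1 e0 by (simp add: algebra_simps)
    also have "\<dots> = \<epsilon> * (c * ?W)" by (simp add: e_def)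
    also have "\<dots> \<le> \<epsilon> * (weight_sum N * ln (real N))" using elim(1) \<epsilon> by (intro mult_left_mono) auto
    finally have "(\<Sum>n | n \<in> {1..N} \<and> bad n. f n) * ln (real N) \<le> (\<epsilon> * weight_sum N) * ln (real N)" by simp
    hence "(\<Sum>n | n \<in> {1..N} \<and> bad n. f n) \<le> \<epsilon> * weight_sum N" using lN by simp
    thus ?case unfolding bad_def L_def .
  qed
qed

end

section \<open>Passage from integers N to real x\<close>

theorem theorem1p6:
  fixes A1 B c0 :: real and A2 :: "real \<Rightarrow> real" and f :: "nat \<Rightarrow> real"
    and lam :: "real \<Rightarrow> real"
  assumes "A1 > 0"
    and "\<And>\<epsilon>. \<epsilon> > 0 \<Longrightarrow> A2 \<epsilon> > 0"
    and "f \<in> class_M A1 A2"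
    and "B > 0"
    and "\<forall>\<^sub>F t in at_top. (\<Sum>p | prime p \<and> real p \<le> t. f p) \<ge> B * (t / ln (2 * t))"
    and "c0 > 2"
    and "\<And>x. lam x = c0 * sqrt (ln (ln (ln (ln x))))"
  shows "((\<lambda>x::real. inverse (\<Sum>n | 0 < n \<and> real n \<le> x. f n) *
            (\<Sum>n | 0 < n \<and> real n \<le> x \<and>
                    \<bar>real (omega (aliquot n)) - ln (ln x)\<bar> \<ge> lam x * sqrt (ln (ln x)). f n))
          \<longlongrightarrow> 0) at_top"
proof -
  have "eventually (\<lambda>n. (\<Sum>p | prime p \<and> real p \<le> real n. f p) \<ge> B * (real n / ln (2 * real n))) sequentially"
    by (rule eventually_compose_filterlim[OF assms(5) filterlim_real_sequentially])
  hence lower: "eventually (\<lambda>n. (\<Sum>p\<in>primes_upto n. f p) \<ge> B * (real n / ln (2 * real n))) sequentially"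
    by (simp only: primes_upto_def of_nat_le_iff)
  interpret dense_arith_weight f A1 A2 B
    by unfold_locales (fact assms(1-4) lower)+
  show ?thesis
  proof (rule tendstoI)
    fix r :: real assume r: "r > 0"
    obtain \<Lambda> where \<Lambda>: "\<Lambda> \<ge> 1"
      "eventually (\<lambda>N. (\<Sum>n | n \<in> {1..N} \<and> \<bar>real (omega (aliquot n)) - ln (ln (real N))\<bar> \<ge> \<Lambda> * sqrt (ln (ln (real N))). f n)
         \<le> r / 2 * weight_sum N) sequentially"
      using sum_f_atypical_le[of "r / 2"] r by auto
    have "filterlim (\<lambda>x::real. nat \<lfloor>x\<rfloor>) sequentially at_top"
      by (rule filterlim_compose[OF filterlim_nat_sequentially filterlim_floor_sequentially])
    hence e1: "eventually (\<lambda>x::real. (\<Sum>n | n \<in> {1..nat \<lfloor>x\<rfloor>} \<and> \<bar>real (omega (aliquot n)) - ln (ln (real (nat \<lfloor>x\<rfloor>)))\<bar> \<ge> \<Lambda> * sqrt (ln (ln (real (nat \<lfloor>x\<rfloor>)))). f n)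
         \<le> r / 2 * weight_sum (nat \<lfloor>x\<rfloor>)) at_top"
      by (rule eventually_compose_filterlim[OF \<Lambda>(2)])
    have "filterlim (\<lambda>x. c0 * sqrt (ln (ln (ln (ln x))))) at_top at_top" using assms(6) by real_asymp
    \<comment> \<open>The extra 1 pays for replacing log log x by log log N: the change is at most
      1, which is at most sqrt(log log x).\<close>
    hence e2: "eventually (\<lambda>x. lam x \<ge> \<Lambda> + 1) at_top"
      unfolding assms(7) filterlim_at_top by blast
    have e3: "eventually (\<lambda>x::real. ln (ln x) \<ge> 1) at_top" by real_asymp
    show "eventually (\<lambda>x. dist (inverse (\<Sum>n | 0 < n \<and> real n \<le> x. f n) *
            (\<Sum>n | 0 < n \<and> real n \<le> x \<and>
                    \<bar>real (omega (aliquot n)) - ln (ln x)\<bar> \<ge> lam x * sqrt (ln (ln x)). f n)) 0 < r) at_top"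
      using e1 e2 e3 eventually_ge_at_top[of 4]
    proof eventually_elim
      case (elim x)
      define N where "N = nat \<lfloor>x\<rfloor>"
      have set: "n \<in> {1..N} \<longleftrightarrow> 0 < n \<and> real n \<le> x" for n
      proof -
        have "n \<le> N \<longleftrightarrow> real n \<le> x" using elim(4) by (simp add: N_def le_nat_iff le_floor_iff)
        thus ?thesis by (simp add: Suc_le_eq)
      qed
      have Nx: "real N \<le> x" "x \<le> real N + 1" "real N \<ge> 3" using elim(4) by (auto simp: N_def)
      have SN: "(\<Sum>n | 0 < n \<and> real n \<le> x. f n) = weight_sum N"
      proof -
        have "{n. 0 < n \<and> real n \<le> x} = {1..N}" using set by blast
        thus ?thesis by (simp only: weight_sum_def)
      qed
      have "(\<Sum>n\<in>{1}. f n) \<le> weight_sum N" unfolding weight_sum_def using Nx by (intro sum_mono2) (auto intro!: f_nonneg)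
      hence S1: "weight_sum N \<ge> 1" by simp
      have lN: "ln (real N) \<ge> 1"
      proof -
        have "exp 1 \<le> real N" using Nx(3) exp_le by linarith
        thus ?thesis using ln_ge_iff[of "real N" 1] Nx(3) by simp
      qed
      \<comment> \<open>From x \<le> N + 1 \<le> 2N follows ln x \<le> 2 ln N, so the iterated
        logarithms differ by at most ln 2.\<close>
      have "ln x \<le> ln (2 * real N)" using Nx by (subst ln_le_cancel_iff) auto
      also have "\<dots> = ln 2 + ln (real N)" using Nx by (subst ln_mult) auto
      also have "\<dots> \<le> 2 * ln (real N)" using lN ln_2_less_1 by linarith
      finally have "ln (ln x) \<le> ln (2 * ln (real N))" using lN elim(4) by (subst ln_le_cancel_iff) auto
      also have "\<dots> = ln 2 + ln (ln (real N))" using lN by (subst ln_mult) auto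
      finally have d1: "ln (ln x) - ln (ln (real N)) \<le> 1" using ln_2_less_1 by linarith
      have d2: "ln (ln (real N)) \<le> ln (ln x)"
      proof -
        have "ln (real N) \<le> ln x" using Nx by (subst ln_le_cancel_iff) auto
        thus ?thesis using lN by (subst ln_le_cancel_iff) auto
      qed
      define U where "U = (\<Sum>n | 0 < n \<and> real n \<le> x \<and> \<bar>real (omega (aliquot n)) - ln (ln x)\<bar> \<ge> lam x * sqrt (ln (ln x)). f n)"
      have "U \<le> (\<Sum>n | n \<in> {1..N} \<and> \<bar>real (omega (aliquot n)) - ln (ln (real N))\<bar> \<ge> \<Lambda> * sqrt (ln (ln (real N))). f n)"
        unfolding U_def
      proof (intro sum_mono2 subsetI)
        fix n assume n: "n \<in> {n. 0 < n \<and> real n \<le> x \<and> \<bar>real (omega (aliquot n)) - ln (ln x)\<bar> \<ge> lam x * sqrt (ln (ln x))}"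
        have s1: "sqrt (ln (ln x)) \<ge> 1" using elim(3) by simp
        have "(\<Lambda> + 1) * sqrt (ln (ln x)) \<le> lam x * sqrt (ln (ln x))" using elim(2) s1 by (intro mult_right_mono) auto
        hence "(\<Lambda> + 1) * sqrt (ln (ln x)) \<le> \<bar>real (omega (aliquot n)) - ln (ln x)\<bar>"
          using n unfolding mem_Collect_eq by linarith
        moreover have "(\<Lambda> + 1) * sqrt (ln (ln x)) = \<Lambda> * sqrt (ln (ln x)) + sqrt (ln (ln x))" by (simp add: algebra_simps)
        moreover have "\<Lambda> * sqrt (ln (ln (real N))) \<le> \<Lambda> * sqrt (ln (ln x))" using d2 \<Lambda>(1) by (intro mult_left_mono) auto
        ultimately have "\<Lambda> * sqrt (ln (ln (real N))) \<le> \<bar>real (omega (aliquot n)) - ln (ln (real N))\<bar>"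
          using s1 d1 d2 by linarith
        thus "n \<in> {n. n \<in> {1..N} \<and> \<bar>real (omega (aliquot n)) - ln (ln (real N))\<bar> \<ge> \<Lambda> * sqrt (ln (ln (real N)))}"
          using n set by blast
      next
        fix n assume "n \<in> {n. n \<in> {1..N} \<and> \<bar>real (omega (aliquot n)) - ln (ln (real N))\<bar> \<ge> \<Lambda> * sqrt (ln (ln (real N)))}
          - {n. 0 < n \<and> real n \<le> x \<and> \<bar>real (omega (aliquot n)) - ln (ln x)\<bar> \<ge> lam x * sqrt (ln (ln x))}"
        hence "n \<in> {1..N}" by blast
        thus "0 \<le> f n" by (intro f_nonneg) simp
      qed simp
      also have "\<dots> \<le> r / 2 * weight_sum N" using elim(1) unfolding N_def .
      also have "\<dots> < r * weight_sum N" using r S1 by simp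
      finally have U1: "U < r * weight_sum N" .
      have U0: "0 \<le> U" unfolding U_def by (intro sum_nonneg f_nonneg) blast
      have "inverse (weight_sum N) * U < r" using U1 S1 by (simp add: inverse_eq_divide divide_less_eq)
      moreover have "0 \<le> inverse (weight_sum N) * U" using U0 S1 by simp
      ultimately show ?case unfolding SN U_def[symmetric] dist_real_def by simp
    qed
  qed
qed

end
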